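(* Let $n\ge 1$, $p\ge 1$, and let $W=G(p,1,n)$. For every $r\geq 1$, the multigraded Hilbert series $\mathcal{C}_W^{(r)}(q_1,\ldots,q_r)$ of the diagonal coinvariant space $\mathcal{C}_W^{(r)}$ affords an expansion $$\mathcal{C}_W^{(r)}(q_1,\ldots,q_r)=\sum_{\mu} c_\mu\, s_\mu(q_1,\ldots,q_r)$$ in Schur polynomials, with positive integer coefficients $c_\mu$ that are independent of $r$, the sum being over partitions $\mu$ of integers $d$ with $0\leq d\leq \frac{n(rn+r-2)}{2}$ and having at most $n$ parts.
   Context: $G(m,p,n)$ (with $p\mid m$) denotes the group of $n\times n$ monomial matrices whose nonzero entries are $m$-th roots of unity and whose product of nonzero entries is an $(m/p)$-th root of unity. Let $X=(x_{ij})$ be an $r\times n$ matrix of variables and $\mathcal{R}_n^{(r)}=\mathbb{C}[X]$, with $W$ acting by $f(X)\mapsto f(Xw)$ (diagonal action on the $r$ rows, each row being a set of $n$ variables). The diagonal coinvariant space is $\mathcal{C}_W^{(r)}=\mathcal{R}_n^{(r)}/\mathcal{I}^{(r)}$, where $\mathcal{I}^{(r)}$ is the ideal generated by the $W$-invariant polynomials with zero constant term. $\mathbb{C}[X]$ is $\mathbb{N}^r$-graded, the monomial $\prod x_{ij}^{a_{ij}}$ having degree $(\sum_j a_{1j},\ldots,\sum_j a_{rj})$; $\mathcal{I}^{(r)}$ is homogeneous, and the Hilbert series is $\mathcal{C}_W^{(r)}(q_1,\ldots,q_r)=\sum_{\mathbf d\in\mathbb{N}^r}\dim\big(\mathcal{C}_W^{(r)}\big)_{\mathbf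 d}\,q_1^{d_1}\cdots q_r^{d_r}$. Equivalently it is the character of the $GL_r$-module $\mathcal{C}_W^{(r)}$, where $M\in GL_r$ acts by $f(X)\mapsto f(MX)$, evaluated at $\mathrm{diag}(q_1,\ldots,q_r)$. $s_\mu$ denotes the Schur polynomial (zero if $\mu$ has more than $r$ parts).
   Formalization: The degree bound is n(pn+p-2)/2, with the group parameter p in place of r: with r the number of rows, the printed bound fails (n=1, p=2, r=1 gives 1+q but d ≤ 0). The sum runs over those partitions in the range that occur, with positive coefficients. *)

theory Defs
  imports
    "HOL-Algebra.Embedded_Algebras"
    "HOL-Algebra.QuotRing"
    "HOL-Library.Poly_Mapping"
    "Jordan_Normal_Form.Matrix"
begin

section \<open>The groups \<open>G(m,p,n)\<close>\<close>

definition monomial_mat :: "nat \<Rightarrow> complex mat \<Rightarrow> bool" where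
  "monomial_mat n A \<longleftrightarrow> A \<in> carrier_mat n n \<and>
     (\<forall>i<n. \<exists>!j. j < n \<and> A $$ (i, j) \<noteq> 0) \<and>
     (\<forall>j<n. \<exists>!i. i < n \<and> A $$ (i, j) \<noteq> 0)"

definition nonzero_positions :: "nat \<Rightarrow> complex mat \<Rightarrow> (nat \<times> nat) set" where
  "nonzero_positions n A = {(i, j). i < n \<and> j < n \<and> A $$ (i, j) \<noteq> 0}"

text \<open>Only meaningful for \<open>p dvd m\<close>.\<close>

definition G :: "nat \<Rightarrow> nat \<Rightarrow> nat \<Rightarrow> complex mat set" where
  "G m p n = {A. monomial_mat n A \<and>
     (\<forall>ij \<in> nonzero_positions n A. (A $$ ij) ^ m = 1) \<and>
     (\<Prod>ij \<in> nonzero_positions n A. A $$ ij) ^ (m div p) = 1}"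


section \<open>The polynomial ring \<open>\<complex>[X]\<close> and the diagonal action\<close>

text \<open>
  The variable \<open>x\<^sub>i\<^sub>j\<close> of row \<open>i < r\<close> and column \<open>j < n\<close> (both counted from 0) is the index
  pair \<open>(i, j)\<close>; a monomial is its exponent function, a polynomial its coefficient function.
  The multiplication of the type \<open>_ \<Rightarrow>\<^sub>0 _\<close> is convolution.
\<close>

type_synonym monom = "(nat \<times> nat) \<Rightarrow>\<^sub>0 nat"
type_synonym mpoly = "monom \<Rightarrow>\<^sub>0 complex"

definition Const :: "complex \<Rightarrow> mpoly" where
  "Const a = Poly_Mapping.single 0 a"

definition Var :: "nat \<Rightarrow> nat \<Rightarrow> mpoly" where
  "Var i j = Poly_Mapping.single (Poly_Mapping.single (i, j) 1) 1"

definition poly_ring :: "nat \<Rightarrow> nat \<Rightarrow> mpoly ring" where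
  "poly_ring r n =
     \<lparr>carrier = {f. \<forall>m \<in> Poly_Mapping.keys f. Poly_Mapping.keys m \<subseteq> {..<r} \<times> {..<n}},
      monoid.mult = (*), one = 1, zero = 0, add = (+)\<rparr>"

definition subst :: "(nat \<Rightarrow> nat \<Rightarrow> mpoly) \<Rightarrow> mpoly \<Rightarrow> mpoly" where
  "subst \<sigma> f =
     (\<Sum>m \<in> Poly_Mapping.keys f. Const (Poly_Mapping.lookup f m) *
        (\<Prod>(i, j) \<in> Poly_Mapping.keys m. \<sigma> i j ^ Poly_Mapping.lookup m (i, j)))"

text \<open>\<open>f(X) \<mapsto> f(Xw)\<close>\<close>

definition act :: "nat \<Rightarrow> complex mat \<Rightarrow> mpoly \<Rightarrow> mpoly" where
  "act n w f = subst (\<lambda>i j. \<Sum>k<n. Var i k * Const (w $$ (k, j))) f"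


section \<open>Diagonal coinvariants and their Hilbert series\<close>

definition pos_invariants :: "complex mat set \<Rightarrow> nat \<Rightarrow> nat \<Rightarrow> mpoly set" where
  "pos_invariants W r n =
     {f \<in> carrier (poly_ring r n). (\<forall>w \<in> W. act n w f = f) \<and> Poly_Mapping.lookup f 0 = 0}"

definition coinv_ideal :: "complex mat set \<Rightarrow> nat \<Rightarrow> nat \<Rightarrow> mpoly set" where
  "coinv_ideal W r n = genideal (poly_ring r n) (pos_invariants W r n)"

definition coinv_ring :: "complex mat set \<Rightarrow> nat \<Rightarrow> nat \<Rightarrow> mpoly set ring" where
  "coinv_ring W r n = poly_ring r n Quot coinv_ideal W r n"

definition coinv_class :: "complex mat set \<Rightarrow> nat \<Rightarrow> nat \<Rightarrow> mpoly \<Rightarrow> mpoly set" where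
  "coinv_class W r n f = coinv_ideal W r n +>\<^bsub>poly_ring r n\<^esub> f"

definition multidegree :: "monom \<Rightarrow> (nat \<Rightarrow>\<^sub>0 nat)" where
  "multidegree m =
     (\<Sum>(i, j) \<in> Poly_Mapping.keys m. Poly_Mapping.single i (Poly_Mapping.lookup m (i, j)))"

definition homogeneous_part :: "nat \<Rightarrow> nat \<Rightarrow> (nat \<Rightarrow>\<^sub>0 nat) \<Rightarrow> mpoly set" where
  "homogeneous_part r n d =
     {f \<in> carrier (poly_ring r n). \<forall>m \<in> Poly_Mapping.keys f. multidegree m = d}"

text \<open>
  The field \<open>\<complex>\<close> sits in the quotient ring as the set of classes of constants, and the component
  of degree \<open>d\<close> of the quotient is the image of the component of degree \<open>d\<close> of \<open>\<complex>[X]\<close>.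
  The series is given by its coefficient function; it vanishes at exponents \<open>d\<close> that
  involve an index \<open>i \<ge> r\<close>, since then \<open>homogeneous_part r n d = {0}\<close>.
\<close>

definition hilbert_series :: "complex mat set \<Rightarrow> nat \<Rightarrow> nat \<Rightarrow> (nat \<Rightarrow>\<^sub>0 nat) \<Rightarrow> int" where
  "hilbert_series W r n d =
     int (ring.dim (coinv_ring W r n)
       (coinv_class W r n ` Set.range Const) (coinv_class W r n ` homogeneous_part r n d))"


section \<open>Partitions and Schur polynomials\<close>

definition is_partition :: "nat list \<Rightarrow> bool" where
  "is_partition \<mu> \<longleftrightarrow> sorted_wrt (\<ge>) \<mu> \<and> 0 \<notin> set \<mu>"

definition diagram :: "nat list \<Rightarrow> (nat \<times> nat) set" where
  "diagram \<mu> = {(i, j). i < length \<mu> \<and> j < \<mu> ! i}"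

definition ssyt :: "nat \<Rightarrow> nat list \<Rightarrow> (nat \<times> nat \<Rightarrow> nat) set" where
  "ssyt r \<mu> = {T \<in> diagram \<mu> \<rightarrow>\<^sub>E {..<r}.
     (\<forall>i j j'. (i, j) \<in> diagram \<mu> \<and> (i, j') \<in> diagram \<mu> \<and> j < j' \<longrightarrow> T (i, j) \<le> T (i, j')) \<and>
     (\<forall>i i' j. (i, j) \<in> diagram \<mu> \<and> (i', j) \<in> diagram \<mu> \<and> i < i' \<longrightarrow> T (i, j) < T (i', j))}"

text \<open>
  The Schur polynomial in the variables \<open>q\<^sub>0, \<dots>, q\<^bsub>r-1\<^esub>\<close>, as the generating function of
  semistandard tableaux. It is zero if \<open>\<mu>\<close> has more than \<open>r\<close> parts, as there are no tableaux.
\<close>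

definition schur :: "nat \<Rightarrow> nat list \<Rightarrow> ((nat \<Rightarrow>\<^sub>0 nat) \<Rightarrow>\<^sub>0 int)" where
  "schur r \<mu> =
     (\<Sum>T \<in> ssyt r \<mu>. Poly_Mapping.single (\<Sum>b \<in> diagram \<mu>. Poly_Mapping.single (T b) 1) 1)"

end

theory Submission
  imports Defs "HOL-Library.Product_Lexorder" "HOL-Combinatorics.Permutations"
begin

text \<open>
  The coinvariant ideal \<open>I\<close> is stable under the polarization operators
  \<open>E\<^sub>i\<^sub>k = \<Sum>\<^sub>j x\<^sub>i\<^sub>j \<partial>/\<partial>x\<^sub>k\<^sub>j\<close>, which form a copy of \<open>gl\<^sub>r\<close>, and so is its orthogonal complement for the
  Fischer inner product, in which \<open>E\<^sub>i\<^sub>k\<close> is adjoint to \<open>E\<^sub>k\<^sub>i\<close>. The complement is isomorphic to the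
  coinvariant space and, being stable, splits orthogonally into modules generated by highest weight
  vectors. The coefficient of \<open>s\<^sub>\<mu>\<close> is the dimension of the space of highest weight vectors of weight \<open>\<mu>\<close>;
  these only involve the first \<open>length \<mu>\<close> rows, hence do not depend on \<open>r\<close>.

  That a module generated by a highest weight vector has character \<open>s\<^sub>\<mu>\<close> is read off leading
  monomials: those of polynomials killed by the column polarizations are exactly the monomials
  encoding semistandard tableaux. The inclusion is an \<open>sl\<^sub>2\<close> argument for two adjacent columns, and
  products of minors attain all of them. The same argument for rows shows that the highest weights
  are partitions with at most \<open>n\<close> parts.

  For the degree bound, the complete homogeneous polynomials of degree \<open>n - l\<close> in
  \<open>x\<^sub>0\<^sub>0\<^sup>p, \<dots>, x\<^sub>0\<^sub>l\<^sup>p\<close> lie in \<open>I\<close>; polarizing them rewrites every monomial whose degree in column \<open>l\<close> is at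
  least \<open>p (n - l)\<close>, modulo \<open>I\<close>, into monomials of lower column index. So \<open>I\<close> contains all monomials of
  degree larger than \<open>\<Sum>\<^sub>l (p (n - l) - 1)\<close>.
\<close>

section \<open>Polynomials, derivations and the Fischer inner product\<close>

text \<open>A module generated by an arbitrary highest weight vector \<open>v\<close> need not be
  killed by column polarizations, so its leading monomials are not directly accessible. The tableau
  count is therefore made once, for the space \<open>right_hw\<close> of all column highest weight
  vectors of column degree \<mu>, placed in columns disjoint from those of \<open>v\<close>. If
  \<open>u\<close> is a highest weight vector there, the module generated by \<open>v + u\<close>
  projects isomorphically onto the modules of \<open>v\<close> and of \<open>u\<close>, because the
  kernel of either projection is a proper stable subspace of an irreducible module. Positivity of
  the Fischer product carries the structure theory: it yields complements, irreducibility and the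
  vanishing of long lowering strings. The degree bound is the sum of d - 1 over the degrees d = p,
  2p, ..., np of the group, the top degree of the coinvariants for a single row; polarization shows
  that more rows do not raise it. It involves \<open>p\<close> and not the number of rows: for n = 1
  and one row the quotient is C[x]/(x^p), of top degree p - 1.\<close>

abbreviation lookup :: "('a \<Rightarrow>\<^sub>0 'b::zero) \<Rightarrow> 'a \<Rightarrow> 'b" where "lookup \<equiv> Poly_Mapping.lookup"
abbreviation keys :: "('a \<Rightarrow>\<^sub>0 'b::zero) \<Rightarrow> 'a set" where "keys \<equiv> Poly_Mapping.keys"
abbreviation single :: "'a \<Rightarrow> 'b \<Rightarrow> ('a \<Rightarrow>\<^sub>0 'b::zero)" where "single \<equiv> Poly_Mapping.single"

definition X :: "nat \<times> nat \<Rightarrow> mpoly" where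
  "X a = single (single a 1) 1"

definition smul :: "complex \<Rightarrow> mpoly \<Rightarrow> mpoly" (infixr \<open>*\<^sub>p\<close> 75) where
  "c *\<^sub>p f = Const c * f"

lemma lookup_single_mult:
  fixes f :: "('a::cancel_comm_monoid_add) \<Rightarrow>\<^sub>0 'b::comm_semiring_1"
  shows "lookup (single s c * f) (s + m) = c * lookup f m"
proof -
  have "lookup (single s c * f) (s + m)
      = (\<Sum>q. lookup (single s c) q * (\<Sum>q'. lookup f q' when s + m = q + q'))"
    by (simp add: lookup_mult)
  also have "\<dots> = (\<Sum>q. (c * (\<Sum>q'. lookup f q' when s + m = s + q')) when s = q)"
    by (rule arg_cong[where f = Sum_any]) (auto simp: lookup_single when_def)
  also have "\<dots> = c * (\<Sum>q'. lookup f q' when m = q')"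
    by simp
  also have "\<dots> = c * lookup f m" by simp
  finally show ?thesis .
qed

lemma keys_single_mult:
  fixes f :: "('a::cancel_comm_monoid_add) \<Rightarrow>\<^sub>0 'b::comm_semiring_1"
  assumes "m \<in> keys (single s c * f)"
  shows "\<exists>m'\<in>keys f. m = s + m'"
  using keys_mult[of "single s c" f] assms by (auto split: if_splits)

lemma lookup_smul [simp]: "lookup (c *\<^sub>p f) m = c * lookup f m"
  using lookup_single_mult[of 0 c f m] by (simp add: smul_def Const_def)

lemma smul_mult_left [simp]: "(c *\<^sub>p f) * g = c *\<^sub>p (f * g)"
  by (simp add: smul_def mult.assoc)

lemma smul_mult_right [simp]: "f * (c *\<^sub>p g) = c *\<^sub>p (f * g)"
  by (simp add: smul_def ac_simps)

interpretation mp: vector_space smul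
  by standard
    (auto intro!: poly_mapping_eqI simp: lookup_add algebra_simps)

lemma lookup_X_mult: "lookup (X a * f) m =
  (if lookup m a > 0 then lookup f (m - single a 1) else 0)"
proof (cases "lookup m a > 0")
  case True
  then have "m = single a 1 + (m - single a 1)"
    by (intro poly_mapping_eqI) (auto simp: lookup_add lookup_minus lookup_single when_def)
  then show ?thesis using True lookup_single_mult[of "single a 1" 1 f "m - single a 1"]
    by (simp add: X_def)
next
  case False
  have "m \<notin> keys (X a * f)"
  proof
    assume "m \<in> keys (X a * f)"
    then obtain m' where "m = single a 1 + m'"
      using keys_single_mult unfolding X_def by blast
    then show False using False by (simp add: lookup_add)
  qed
  then show ?thesis using False by (simp add: in_keys_iff)
qed

lemma lookup_X_mult_add [simp]: "lookup (X a * f) (m + single a (Suc 0)) = lookup f m"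
  using lookup_X_mult[of a f "m + single a 1"] by (simp add: lookup_add)

section \<open>Formal partial derivatives\<close>

lift_definition pd :: "nat \<times> nat \<Rightarrow> mpoly \<Rightarrow> mpoly" is
  "\<lambda>a f m. of_nat (lookup m a + 1) * f (m + single a 1)"
proof -
  fix a and f :: "monom \<Rightarrow> complex"
  assume "finite {m. f m \<noteq> 0}"
  moreover have "{m. of_nat (lookup m a + 1) * f (m + single a 1) \<noteq> 0}
      \<subseteq> (\<lambda>m. m + single a 1) -` {m. f m \<noteq> 0}" by auto
  ultimately show "finite {m. of_nat (lookup m a + 1) * f (m + single a 1) \<noteq> 0}"
    by (meson finite_subset finite_vimageI injI add_right_imp_eq)
qed

lemma pd_add [simp]: "pd a (f + g) = pd a f + pd a g"
  by (rule poly_mapping_eqI) (simp add: pd.rep_eq lookup_add algebra_simps)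

lemma pd_smul [simp]: "pd a (c *\<^sub>p f) = c *\<^sub>p pd a f"
  by (rule poly_mapping_eqI) (simp add: pd.rep_eq)

lemma pd_zero [simp]: "pd a 0 = 0"
  by (rule poly_mapping_eqI) (simp add: pd.rep_eq)

lemma pd_X_mult: "pd a (X b * f) = (if a = b then f else 0) + X b * pd a f"
proof (rule poly_mapping_eqI)
  fix m
  show "lookup (pd a (X b * f)) m = lookup ((if a = b then f else 0) + X b * pd a f) m"
  proof (cases "a = b")
    case True
    have "lookup m b > 0 \<Longrightarrow> m - single b (Suc 0) + single b (Suc 0) = m"
      by (intro poly_mapping_eqI) (auto simp: lookup_add lookup_minus lookup_single when_def)
    with True show ?thesis
      by (auto simp: pd.rep_eq lookup_X_mult lookup_add lookup_minus ring_distribs)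
  next
    case False
    have "lookup m b > 0 \<Longrightarrow> m + single a (Suc 0) - single b (Suc 0) = m - single b (Suc 0) + single a (Suc 0)"
      by (intro poly_mapping_eqI) (use False in \<open>auto simp: lookup_add lookup_minus lookup_single when_def\<close>)
    with False show ?thesis
      by (auto simp: pd.rep_eq lookup_X_mult lookup_add lookup_minus lookup_single_not_eq)
  qed
qed

lemma pd_pd: "pd a (pd b f) = pd b (pd a f)"
proof (rule poly_mapping_eqI)
  fix m
  show "lookup (pd a (pd b f)) m = lookup (pd b (pd a f)) m"
    by (cases "a = b") (auto simp: pd.rep_eq lookup_add lookup_single_not_eq ac_simps)
qed

lemma poly_mapping_sum_single: "f = (\<Sum>m\<in>keys f. single m (lookup f m))"
  by (rule poly_mapping_eqI)
     (auto simp: lookup_sum lookup_single when_def sum.delta in_keys_iff intro!: sum.neutral)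

lemma mpoly_induct [case_names zero add single]:
  assumes "P 0" "\<And>f g. P f \<Longrightarrow> P g \<Longrightarrow> P (f + g)" "\<And>m c. P (single m c)"
  shows "P (f :: 'a \<Rightarrow>\<^sub>0 'b::comm_monoid_add)"
proof -
  have "P (\<Sum>m\<in>S. single m (lookup f m))" for S
    by (induction S rule: infinite_finite_induct) (auto intro: assms)
  then show ?thesis using poly_mapping_sum_single[of f] by metis
qed

lemma single_eq_smul: "single m c = c *\<^sub>p single m 1"
  by (rule poly_mapping_eqI) (auto simp: lookup_single when_def)

lemma monom_induct [case_names zero step]:
  assumes "P 0" "\<And>m a. P m \<Longrightarrow> P (m + single a (Suc 0))"
  shows "P (m :: 'a \<Rightarrow>\<^sub>0 nat)"
proof (induction "\<Sum>a\<in>keys m. lookup m a" arbitrary: m)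
  case 0
  then have "m = 0" by (auto intro!: poly_mapping_eqI simp: in_keys_iff)
  then show ?case using assms by simp
next
  case (Suc k)
  then have "(\<Sum>a\<in>keys m. lookup m a) \<noteq> 0" by linarith
  then obtain a where a: "a \<in> keys m" by (metis sum.not_neutral_contains_not_neutral)
  let ?m = "m - single a (Suc 0)"
  have m: "m = ?m + single a (Suc 0)"
    using a by (intro poly_mapping_eqI) (auto simp: lookup_add lookup_minus lookup_single when_def in_keys_iff)
  have "(\<Sum>b\<in>keys m. lookup m b) = (\<Sum>b\<in>keys m. lookup ?m b) + 1"
    by (subst m) (simp add: lookup_add sum.distrib lookup_single when_def sum.delta' a)
  also have "(\<Sum>b\<in>keys m. lookup ?m b) = (\<Sum>b\<in>keys ?m. lookup ?m b)"
    by (intro sum.mono_neutral_right) (auto simp: in_keys_iff lookup_minus)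
  finally have "(\<Sum>b\<in>keys ?m. lookup ?m b) = k" using Suc(2) by simp
  then have "P ?m" using Suc(1)[of ?m] by simp
  then show ?case using assms(2) m by metis
qed

lemma mono_Suc: "single (m + single a (Suc 0)) c = X a * single m (c::complex)"
  by (simp add: X_def mult_single add.commute)

lemma pd_one [simp]: "pd a (single 0 c) = 0"
proof (rule poly_mapping_eqI)
  fix m
  have "m + single a (Suc 0) \<noteq> 0"
    by (metis add_is_0 lookup_add lookup_single_eq lookup_zero nat.distinct(1))
  then show "lookup (pd a (single 0 c)) m = lookup 0 m"
    by (simp add: pd.rep_eq lookup_single when_def)
qed

lemma pd_mult: "pd a (f * g) = pd a f * g + f * pd a g"
proof (induction f rule: mpoly_induct)
  case (single m c)
  show ?case
  proof (induction m rule: monom_induct)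
    case zero
    show ?case using pd_smul[of a c g] by (simp add: smul_def Const_def)
  next
    case (step m b)
    then show ?case
      by (simp add: mono_Suc pd_X_mult mult.assoc ring_distribs)
  qed
qed (auto simp: algebra_simps)

text \<open>The weight \<open>mfact\<close> makes multiplication by \<open>X a\<close> adjoint to \<open>pd a\<close>.\<close>

definition mfact :: "monom \<Rightarrow> nat" where
  "mfact m = (\<Prod>a\<in>keys m. fact (lookup m a))"

definition ip :: "mpoly \<Rightarrow> mpoly \<Rightarrow> complex" where
  "ip f g = (\<Sum>m\<in>keys f. of_nat (mfact m) * lookup f m * cnj (lookup g m))"

lemma mfact_superset: "finite S \<Longrightarrow> keys m \<subseteq> S \<Longrightarrow> mfact m = (\<Prod>a\<in>S. fact (lookup m a))"
  unfolding mfact_def by (intro prod.mono_neutral_left) (auto simp: in_keys_iff)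

lemma mfact_pos [simp]: "mfact m > 0"
  by (auto simp: mfact_def intro!: prod_pos)

lemma mfact_add_single: "mfact (m + single a (Suc 0)) = Suc (lookup m a) * mfact m"
proof -
  let ?S = "insert a (keys m)"
  have "mfact (m + single a (Suc 0)) = (\<Prod>b\<in>?S. fact (lookup (m + single a (Suc 0)) b))"
    by (intro mfact_superset) (auto simp: in_keys_iff lookup_add lookup_single when_def split: if_splits)
  also have "\<dots> = fact (Suc (lookup m a)) * (\<Prod>b\<in>keys m - {a}. fact (lookup m b))"
    by (subst prod.insert_remove) (auto simp: lookup_add lookup_single when_def split: if_splits intro!: prod.cong)
  also have "\<dots> = Suc (lookup m a) * (\<Prod>b\<in>?S. fact (lookup m b))"
    by (subst prod.insert_remove) (auto simp: algebra_simps)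
  also have "(\<Prod>b\<in>?S. fact (lookup m b)) = mfact m"
    by (intro mfact_superset[symmetric]) auto
  finally show ?thesis .
qed

lemma ip_superset: "finite S \<Longrightarrow> keys f \<inter> keys g \<subseteq> S \<Longrightarrow>
  ip f g = (\<Sum>m\<in>S. of_nat (mfact m) * lookup f m * cnj (lookup g m))"
  unfolding ip_def
  by (rule sum.mono_neutral_cong) (auto simp: in_keys_iff)

lemma ip_commute: "ip f g = cnj (ip g f)"
  by (subst (1 2) ip_superset[where S = "keys f \<union> keys g"]) (auto intro!: sum.cong)

lemma ip_add_left [simp]: "ip (f + g) h = ip f h + ip g h"
  by (subst (1 2 3) ip_superset[where S = "keys h"])
     (auto simp: lookup_add algebra_simps sum.distrib)

lemma ip_add_right [simp]: "ip f (g + h) = ip f g + ip f h"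
  by (subst (1 2 3) ip_superset[where S = "keys f"])
     (auto simp: lookup_add algebra_simps sum.distrib)

lemma ip_smul_left [simp]: "ip (c *\<^sub>p f) g = c * ip f g"
  by (subst (1 2) ip_superset[where S = "keys g"]) (auto simp: sum_distrib_left ac_simps)

lemma ip_smul_right [simp]: "ip f (c *\<^sub>p g) = cnj c * ip f g"
  by (subst (1 2) ip_superset[where S = "keys f"]) (auto simp: sum_distrib_left ac_simps)

lemma ip_zero_left [simp]: "ip 0 g = 0" by (simp add: ip_def)
lemma ip_zero_right [simp]: "ip f 0 = 0" by (simp add: ip_def)

lemma ip_sum_left: "ip (sum f S) g = (\<Sum>s\<in>S. ip (f s) g)"
  by (induction S rule: infinite_finite_induct) auto

lemma ip_sum_right: "ip g (sum f S) = (\<Sum>s\<in>S. ip g (f s))"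
  by (induction S rule: infinite_finite_induct) auto

lemma ip_uminus_left [simp]: "ip (- f) g = - ip f g"
  by (metis add.right_inverse add_eq_0_iff ip_add_left ip_zero_left)

lemma ip_diff_left [simp]: "ip (f - h) g = ip f g - ip h g"
  by (metis diff_conv_add_uminus ip_add_left ip_uminus_left)

lemma ip_self: "ip f f = of_real (\<Sum>m\<in>keys f. real (mfact m) * (cmod (lookup f m))\<^sup>2)"
  by (simp add: ip_def mult.assoc complex_norm_square[symmetric] del: of_real_power)

lemma ip_self_nonneg: "Re (ip f f) \<ge> 0" "Im (ip f f) = 0"
  unfolding ip_self by (auto intro!: sum_nonneg)

lemma ip_self_eq_0 [simp]: "ip f f = 0 \<longleftrightarrow> f = 0"
proof
  assume "ip f f = 0"
  then have "(\<Sum>m\<in>keys f. real (mfact m) * (cmod (lookup f m))\<^sup>2) = 0"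
    unfolding ip_self by (simp only: of_real_eq_0_iff)
  then have "\<forall>m\<in>keys f. real (mfact m) * (cmod (lookup f m))\<^sup>2 = 0"
    by (subst (asm) sum_nonneg_eq_0_iff) auto
  then have "\<forall>m\<in>keys f. lookup f m = 0"
    by (metis less_irrefl mfact_pos mult_eq_0_iff norm_eq_zero of_nat_eq_0_iff power_eq_0_iff)
  then show "f = 0" by (intro poly_mapping_eqI) (auto simp: in_keys_iff)
qed auto

lemma ip_X_mult: "ip (X a * f) g = ip f (pd a g)"
proof -
  let ?h = "\<lambda>m. m + single a (Suc 0)"
  have "ip (X a * f) g = (\<Sum>m\<in>?h ` keys f. of_nat (mfact m) * lookup (X a * f) m * cnj (lookup g m))"
    using keys_single_mult[of _ "single a 1" 1 f] unfolding X_def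
    by (intro ip_superset) (auto simp: add.commute image_iff)
  also have "\<dots> = (\<Sum>m\<in>keys f. of_nat (mfact (?h m)) * lookup f m * cnj (lookup g (?h m)))"
    by (subst sum.reindex) (auto intro!: injI simp: inj_on_def)
  also have "\<dots> = ip f (pd a g)"
    by (simp add: ip_def pd.rep_eq mfact_add_single algebra_simps)
  finally show ?thesis .
qed

lemma ip_pd: "ip (pd a f) g = ip f (X a * g)"
  by (metis ip_X_mult ip_commute)

text \<open>The orthogonal projection onto the span of the monomials with \<open>P\<close>; distinct
  monomials are orthogonal, so it is self-adjoint (\<open>ip_rest\<close>). Weight components and
  parts supported in given rows or columns are all obtained from it.\<close>

definition rest :: "(monom \<Rightarrow> bool) \<Rightarrow> mpoly \<Rightarrow> mpoly" where
  "rest P f = Abs_poly_mapping (\<lambda>m. if P m then lookup f m else 0)"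

lemma lookup_rest: "lookup (rest P f) m = (if P m then lookup f m else 0)"
proof -
  have "finite {m. (if P m then lookup f m else 0) \<noteq> 0}"
    by (rule finite_subset[of _ "keys f"]) (auto simp: in_keys_iff split: if_splits)
  then show ?thesis by (simp add: rest_def)
qed

lemma rest_add [simp]: "rest P (f + g) = rest P f + rest P g"
  by (rule poly_mapping_eqI) (simp add: lookup_rest lookup_add)

lemma rest_smul [simp]: "rest P (c *\<^sub>p f) = c *\<^sub>p rest P f"
  by (rule poly_mapping_eqI) (simp add: lookup_rest)

lemma rest_zero [simp]: "rest P 0 = 0"
  by (rule poly_mapping_eqI) (simp add: lookup_rest)

lemma rest_sum: "rest P (sum f S) = (\<Sum>s\<in>S. rest P (f s))"
  by (induction S rule: infinite_finite_induct) auto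

lemma keys_rest [simp]: "keys (rest P f) = {m\<in>keys f. P m}"
  by (auto simp: in_keys_iff lookup_rest split: if_splits)

lemma ip_rest: "ip (rest P f) g = ip f (rest P g)"
  by (subst (1 2) ip_superset[where S = "keys f"]) (auto simp: lookup_rest intro!: sum.cong)

lemma rest_idI: "(\<And>m. m \<in> keys f \<Longrightarrow> P m) \<Longrightarrow> rest P f = f"
  by (rule poly_mapping_eqI) (auto simp: lookup_rest in_keys_iff)

lemma rest_0I: "(\<And>m. m \<in> keys f \<Longrightarrow> \<not> P m) \<Longrightarrow> rest P f = 0"
  by (rule poly_mapping_eqI) (auto simp: lookup_rest in_keys_iff)

lemma rest_rest: "rest P (rest Q f) = rest (\<lambda>m. P m \<and> Q m) f"
  by (rule poly_mapping_eqI) (auto simp: lookup_rest)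

definition xd :: "nat \<times> nat \<Rightarrow> nat \<times> nat \<Rightarrow> mpoly \<Rightarrow> mpoly" where
  "xd a b f = X a * pd b f"

lemma xd_add [simp]: "xd a b (f + g) = xd a b f + xd a b g" by (simp add: xd_def algebra_simps)
lemma xd_smul [simp]: "xd a b (c *\<^sub>p f) = c *\<^sub>p xd a b f" by (simp add: xd_def)
lemma xd_zero [simp]: "xd a b 0 = 0" by (simp add: xd_def)
lemma xd_sum: "xd a b (sum f S) = (\<Sum>s\<in>S. xd a b (f s))"
  by (induction S rule: infinite_finite_induct) auto
lemma xd_mult: "xd a b (f * g) = xd a b f * g + f * xd a b g"
  by (simp add: xd_def pd_mult algebra_simps)
lemma ip_xd: "ip (xd a b f) g = ip f (xd b a g)"
  by (simp add: xd_def ip_X_mult ip_pd)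

text \<open>The relations of matrix units, with the variables as indices: second-order terms cancel
  by \<open>pd_pd\<close>, and a first-order term arises whenever one operator differentiates the
  variable that the other multiplies by. All commutators below are sums of these.\<close>

lemma xd_commutator: "xd a b (xd c d f) - xd c d (xd a b f) =
    (if b = c then xd a d f else 0) - (if d = a then xd c b f else 0)"
  by (auto simp: xd_def pd_X_mult algebra_simps pd_pd)

lemma keys_xd:
  assumes "m \<in> keys (xd a b f)"
  shows "\<exists>m'\<in>keys f. m + single b 1 = m' + single a 1 \<and> lookup m' b > 0 \<and> lookup m a > 0"
proof -
  from assms have "lookup (X a * pd b f) m \<noteq> 0" by (simp add: in_keys_iff xd_def)
  then have m: "lookup m a > 0" "lookup f (m - single a 1 + single b 1) \<noteq> 0"
    by (auto simp: lookup_X_mult pd.rep_eq split: if_splits)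
  moreover have "m + single b 1 = (m - single a 1 + single b 1) + single a 1"
    using m(1) by (intro poly_mapping_eqI) (auto simp: lookup_add lookup_minus lookup_single when_def)
  ultimately show ?thesis
    by (intro bexI[of _ "m - single a 1 + single b 1"]) (auto simp: in_keys_iff lookup_add)
qed

lemma lookup_xd: "lookup (xd a b f) m = (if lookup m a > 0 then
    of_nat (lookup (m - single a 1) b + 1) * lookup f (m - single a 1 + single b 1) else 0)"
  by (simp add: xd_def lookup_X_mult pd.rep_eq)

lemma rest_xd:
  assumes "\<And>m m'. m + single b 1 = m' + single a 1 \<Longrightarrow> P m = P m'"
  shows "rest P (xd a b f) = xd a b (rest P f)"
proof (rule poly_mapping_eqI)
  fix m :: monom
  have "m + single b 1 = (m - single a 1 + single b 1) + single a 1" if "lookup m a > 0"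
    using that by (intro poly_mapping_eqI) (auto simp: lookup_add lookup_minus lookup_single when_def)
  from assms[OF this] show "lookup (rest P (xd a b f)) m = lookup (xd a b (rest P f)) m"
    by (auto simp: lookup_rest lookup_xd)
qed

text \<open>Two arbitrary families of positions cover row polarizations, column polarizations and
  their truncations to some of the sites. Exchanging the families gives the adjoint
  (\<open>ip_pol\<close>).\<close>

definition pol :: "'s set \<Rightarrow> ('s \<Rightarrow> nat \<times> nat) \<Rightarrow> ('s \<Rightarrow> nat \<times> nat) \<Rightarrow> mpoly \<Rightarrow> mpoly" where
  "pol S u w f = (\<Sum>s\<in>S. xd (u s) (w s) f)"

lemma pol_add [simp]: "pol S u w (f + g) = pol S u w f + pol S u w g"
  by (simp add: pol_def sum.distrib)
lemma pol_smul [simp]: "pol S u w (c *\<^sub>p f) = c *\<^sub>p pol S u w f"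
  by (simp add: pol_def mp.scale_sum_right)
lemma pol_zero [simp]: "pol S u w 0 = 0" by (simp add: pol_def)
lemma pol_uminus [simp]: "pol S u w (- f) = - pol S u w f"
  by (metis add.right_inverse add_eq_0_iff pol_add pol_zero)
lemma pol_diff [simp]: "pol S u w (f - g) = pol S u w f - pol S u w g"
  by (metis diff_conv_add_uminus pol_add pol_uminus)
lemma pol_sum: "pol S u w (sum f T) = (\<Sum>s\<in>T. pol S u w (f s))"
  by (induction T rule: infinite_finite_induct) auto
lemma pol_mult: "pol S u w (f * g) = pol S u w f * g + f * pol S u w g"
  by (simp add: pol_def xd_mult sum.distrib sum_distrib_left sum_distrib_right)
lemma ip_pol: "ip (pol S u w f) g = ip f (pol S w u g)"
  by (simp add: pol_def ip_sum_left ip_sum_right ip_xd)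
lemma rest_pol:
  assumes "\<And>m m' s. s \<in> S \<Longrightarrow> m + single (w s) 1 = m' + single (u s) 1 \<Longrightarrow> P m = P m'"
  shows "rest P (pol S u w f) = pol S u w (rest P f)"
  unfolding pol_def rest_sum by (intro sum.cong refl rest_xd assms)

lemma keys_pol:
  assumes "m \<in> keys (pol S u w f)"
  shows "\<exists>s\<in>S. \<exists>m'\<in>keys f. m + single (w s) 1 = m' + single (u s) 1 \<and>
    lookup m' (w s) > 0 \<and> lookup m (u s) > 0"
  using assms keys_sum[of "\<lambda>s. xd (u s) (w s) f" S] keys_xd unfolding pol_def by blast

lemma pol_commutator:
  "pol S u w (pol S' u' w' f) - pol S' u' w' (pol S u w f) =
   (\<Sum>s\<in>S. \<Sum>t\<in>S'. (if w s = u' t then xd (u s) (w' t) f else 0)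
      - (if w' t = u s then xd (u' t) (w s) f else 0))"
proof -
  have "pol S u w (pol S' u' w' f) - pol S' u' w' (pol S u w f) =
    (\<Sum>s\<in>S. \<Sum>t\<in>S'. xd (u s) (w s) (xd (u' t) (w' t) f)) -
    (\<Sum>t\<in>S'. \<Sum>s\<in>S. xd (u' t) (w' t) (xd (u s) (w s) f))"
    by (simp add: pol_def xd_sum)
  also have "\<dots> = (\<Sum>s\<in>S. \<Sum>t\<in>S'. xd (u s) (w s) (xd (u' t) (w' t) f) - xd (u' t) (w' t) (xd (u s) (w s) f))"
    by (subst (2) sum.swap) (simp add: sum_subtractf)
  finally show ?thesis by (simp add: xd_commutator)
qed

section \<open>Leading monomials\<close>

text \<open>
  The largest (row, column) position is compared first. With this convention one order serves both for
  pairs of adjacent columns and for pairs of adjacent rows.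
\<close>

definition mless :: "monom \<Rightarrow> monom \<Rightarrow> bool" where
  "mless m m' \<longleftrightarrow> (\<exists>k. lookup m k < lookup m' k \<and> (\<forall>k'>k. lookup m k' = lookup m' k'))"

lemma mless_irrefl [simp]: "\<not> mless m m"
  by (simp add: mless_def)

lemma mless_trans: assumes "mless m m'" "mless m' m''" shows "mless m m''"
proof -
  obtain k where k: "lookup m k < lookup m' k" "\<forall>k'>k. lookup m k' = lookup m' k'"
    using assms(1) by (auto simp: mless_def)
  obtain l where l: "lookup m' l < lookup m'' l" "\<forall>k'>l. lookup m' k' = lookup m'' k'"
    using assms(2) by (auto simp: mless_def)
  consider "k < l" | "k = l" | "l < k" by (meson linorder_cases)
  then show ?thesis
  proof cases
    case 1
    then have "lookup m l < lookup m'' l \<and> (\<forall>k'>l. lookup m k' = lookup m'' k')"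
      using k l by (metis less_trans)
    then show ?thesis unfolding mless_def by blast
  next
    case 2
    then have "lookup m l < lookup m'' l \<and> (\<forall>k'>l. lookup m k' = lookup m'' k')"
      using k l by (metis less_trans)
    then show ?thesis unfolding mless_def by blast
  next
    case 3
    then have "lookup m k < lookup m'' k \<and> (\<forall>k'>k. lookup m k' = lookup m'' k')"
      using k l by (metis less_trans)
    then show ?thesis unfolding mless_def by blast
  qed
qed

lemma mless_total: "m \<noteq> m' \<Longrightarrow> mless m m' \<or> mless m' m"
proof -
  assume ne: "m \<noteq> m'"
  let ?S = "{k. lookup m k \<noteq> lookup m' k}"
  have "?S \<subseteq> keys m \<union> keys m'" by (auto simp: in_keys_iff)
  then have fin: "finite ?S" by (rule finite_subset) auto
  moreover have ne: "?S \<noteq> {}" using ne by (auto intro: poly_mapping_eqI)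
  ultimately have "Max ?S \<in> ?S" by (rule Max_in)
  moreover have "lookup m k' = lookup m' k'" if "k' > Max ?S" for k'
    using Max_ge[OF fin, of k'] that by (meson CollectI not_le)
  ultimately show ?thesis unfolding mless_def by (metis (mono_tags) CollectD linorder_neqE_nat)
qed

lemma mless_add_left: "mless m m' \<Longrightarrow> mless (c + m) (c + m')"
  unfolding mless_def by (auto simp: lookup_add)

lemma mless_add: assumes "mless m m'" "mless c c'" shows "mless (m + c) (m' + c')"
proof -
  have "mless (m + c) (m' + c)" using mless_add_left[OF assms(1), of c] by (simp add: add.commute)
  then show ?thesis using mless_trans mless_add_left[OF assms(2), of m'] by blast
qed

definition lm :: "mpoly \<Rightarrow> monom \<Rightarrow> bool" where
  "lm f m \<longleftrightarrow> m \<in> keys f \<and> (\<forall>m'\<in>keys f. m' \<noteq> m \<longrightarrow> mless m' m)"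

lemma mless_max_exists: "finite S \<Longrightarrow> S \<noteq> {} \<Longrightarrow> \<exists>m\<in>S. \<forall>m'\<in>S. m' \<noteq> m \<longrightarrow> mless m' m"
proof (induction S rule: finite_ne_induct)
  case (insert x S)
  then obtain m where m: "m \<in> S" "\<forall>m'\<in>S. m' \<noteq> m \<longrightarrow> mless m' m" by blast
  show ?case
  proof (cases "mless x m")
    case True
    then show ?thesis using m by blast
  next
    case False
    then have "mless m x" using m(1) insert.hyps(3) mless_total[of x m] by auto
    then have "mless m' x" if "m' \<in> S" for m'
      using that m(2) mless_trans[of m' m x] by (cases "m' = m") auto
    then show ?thesis by blast
  qed
qed auto

lemma lm_exists: "f \<noteq> 0 \<Longrightarrow> \<exists>m. lm f m"
  using mless_max_exists[of "keys f"] unfolding lm_def by auto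

lemma lm_unique: "lm f m \<Longrightarrow> lm f m' \<Longrightarrow> m = m'"
  unfolding lm_def using mless_trans mless_irrefl by metis

lemma lm_nonzero: "lm f m \<Longrightarrow> f \<noteq> 0"
  by (auto simp: lm_def)

lemma lm_mult: assumes "lm f m" "lm g m'" shows "lm (f * g) (m + m')"
proof -
  have "f * g = (\<Sum>a\<in>keys f. single a (lookup f a)) * g"
    using poly_mapping_sum_single[of f] by simp
  then have "lookup (f * g) (m + m') = (\<Sum>a\<in>keys f. lookup (single a (lookup f a) * g) (m + m'))"
    by (simp add: sum_distrib_right lookup_sum)
  also have "\<dots> = (\<Sum>a\<in>keys f. if a = m then lookup f m * lookup g m' else 0)"
  proof (rule sum.cong)
    fix a assume a: "a \<in> keys f"
    show "lookup (single a (lookup f a) * g) (m + m') = (if a = m then lookup f m * lookup g m' else 0)"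
    proof (cases "a = m")
      case True
      then show ?thesis by (simp add: lookup_single_mult)
    next
      case False
      then have am: "mless a m" using a assms by (auto simp: lm_def)
      have "m + m' \<notin> keys (single a (lookup f a) * g)"
      proof
        assume "m + m' \<in> keys (single a (lookup f a) * g)"
        then obtain b where b: "b \<in> keys g" "m + m' = a + b" using keys_single_mult by blast
        then have "b = m' \<or> mless b m'" using assms by (auto simp: lm_def)
        then have "mless (a + b) (m + m')"
          using am by (metis add.commute mless_add mless_add_left)
        then show False using b by simp
      qed
      then show ?thesis using False by (simp add: in_keys_iff)
    qed
  qed simp
  also have "\<dots> = lookup f m * lookup g m'" using assms by (simp add: lm_def)
  finally have "lookup (f * g) (m + m') \<noteq> 0" using assms by (simp add: lm_def in_keys_iff)
  moreover have "mless c (m + m')" if c: "c \<in> keys (f * g)" "c \<noteq> m + m'" for c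
  proof -
    obtain a b where ab: "a \<in> keys f" "b \<in> keys g" "c = a + b"
      using keys_mult[of f g] c(1) by blast
    then show ?thesis using assms c mless_add mless_add_left[of b m' a] mless_add_left[of a m b]
      unfolding lm_def by (metis add.commute)
  qed
  ultimately show ?thesis by (auto simp: lm_def in_keys_iff)
qed

lemma lm_one: "lm 1 0"
  by (auto simp: lm_def)

lemma lm_prod: "finite I \<Longrightarrow> (\<And>i. i \<in> I \<Longrightarrow> lm (f i) (m i)) \<Longrightarrow> lm (\<Prod>i\<in>I. f i) (\<Sum>i\<in>I. m i)"
  by (induction I rule: finite_induct) (auto intro: lm_one lm_mult)

lemma lm_reduce:
  assumes "lm f m" "lm g m"
  shows "\<exists>c. \<forall>m'. lm (f - c *\<^sub>p g) m' \<longrightarrow> mless m' m"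
proof (intro exI allI impI)
  fix m' let ?c = "lookup f m / lookup g m"
  assume "lm (f - ?c *\<^sub>p g) m'"
  then have m': "lookup f m' - ?c * lookup g m' \<noteq> 0"
    by (simp add: lm_def in_keys_iff lookup_minus)
  then have "m' \<noteq> m" using assms by (auto simp: lm_def in_keys_iff)
  moreover have "m' \<in> keys f \<or> m' \<in> keys g" using m' by (auto simp: in_keys_iff)
  ultimately show "mless m' m" using assms by (auto simp: lm_def)
qed

section \<open>Bases and dimensions from leading monomials\<close>

definition polys_on :: "monom set \<Rightarrow> mpoly set" where "polys_on S = {f. keys f \<subseteq> S}"

text \<open>Choose one polynomial for each leading monomial. Distinct leading monomials make them
  independent, and successive cancellation of leading terms shows that they span.\<close>

lemma leads_basis:
  assumes V: "mp.subspace V" and L: "finite L"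
    and 1: "\<And>f m. f \<in> V \<Longrightarrow> lm f m \<Longrightarrow> m \<in> L"
    and 2: "\<And>m. m \<in> L \<Longrightarrow> \<exists>f\<in>V. lm f m"
  shows "\<exists>B. finite B \<and> mp.independent B \<and> B \<subseteq> V \<and> mp.span B = V \<and> card B = card L"
proof -
  from 2 obtain F where F: "\<And>m. m \<in> L \<Longrightarrow> F m \<in> V \<and> lm (F m) m" by metis
  have inj: "inj_on F L" using F lm_unique by (metis inj_onI)
  have ind: "mp.independent (F ` L)"
  proof (rule mp.independent_if_scalars_zero)
    fix u x assume u: "(\<Sum>x\<in>F ` L. u x *\<^sub>p x) = 0" and x: "x \<in> F ` L"
    show "u x = 0"
    proof (rule ccontr)
      assume "u x \<noteq> 0"
      let ?M = "{m\<in>L. u (F m) \<noteq> 0}"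
      have "?M \<noteq> {}" using x \<open>u x \<noteq> 0\<close> by auto
      \<comment> \<open>At the largest leading monomial with nonzero scalar no other summand
        contributes.\<close>
      then obtain m where m: "m \<in> ?M" "\<forall>m'\<in>?M. m' \<noteq> m \<longrightarrow> mless m' m"
        using mless_max_exists[of ?M] L by auto
      have "0 = lookup (\<Sum>m\<in>L. u (F m) *\<^sub>p F m) m"
        using u by (simp add: sum.reindex[OF inj])
      also have "\<dots> = (\<Sum>m'\<in>L. if m' = m then u (F m) * lookup (F m) m else 0)"
        unfolding lookup_sum
      proof (rule sum.cong)
        fix m' assume m': "m' \<in> L"
        have "m' \<in> ?M \<Longrightarrow> m' \<noteq> m \<Longrightarrow> lookup (F m') m = 0"
        proof (rule ccontr)
          assume "m' \<in> ?M" "m' \<noteq> m" "lookup (F m') m \<noteq> 0"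
          then have "mless m' m" "mless m m'" using m F[OF m'] by (auto simp: lm_def in_keys_iff)
          then show False using mless_trans mless_irrefl by blast
        qed
        then show "lookup (u (F m') *\<^sub>p F m') m = (if m' = m then u (F m) * lookup (F m) m else 0)"
          using m' by auto
      qed simp
      also have "\<dots> = u (F m) * lookup (F m) m" using m L by simp
      finally show False using m F[of m] by (auto simp: lm_def in_keys_iff)
    qed
  qed (use L in auto)
  have "f \<in> mp.span (F ` L)" if "f \<in> V" for f
    using that
  \<comment> \<open>The measure counts the elements of \<open>L\<close> up to the leading monomial
    of \<open>f\<close>; it drops when the leading term is cancelled.\<close>
  proof (induction "card {m'\<in>L. \<exists>m. lm f m \<and> (m' = m \<or> mless m' m)}" arbitrary: f rule: less_induct)
    case less
    show ?case
    proof (cases "f = 0")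
      case True
      then show ?thesis by (simp add: mp.span_zero)
    next
      case False
      then obtain m where m: "lm f m" using lm_exists by blast
      then have mL: "m \<in> L" using 1 less by blast
      obtain c where c: "\<forall>m'. lm (f - c *\<^sub>p F m) m' \<longrightarrow> mless m' m"
        using lm_reduce m F mL by blast
      let ?g = "f - c *\<^sub>p F m"
      have gV: "?g \<in> V" using F[OF mL] less V by (simp add: mp.subspace_diff mp.subspace_scale)
      have "{m'\<in>L. \<exists>m. lm ?g m \<and> (m' = m \<or> mless m' m)}
          \<subset> {m'\<in>L. \<exists>m. lm f m \<and> (m' = m \<or> mless m' m)}"
      proof (rule psubsetI)
        show "{m'\<in>L. \<exists>m. lm ?g m \<and> (m' = m \<or> mless m' m)}
          \<subseteq> {m'\<in>L. \<exists>m. lm f m \<and> (m' = m \<or> mless m' m)}"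
          using c m mless_trans by blast
        have "m \<notin> {m'\<in>L. \<exists>m. lm ?g m \<and> (m' = m \<or> mless m' m)}"
          using c mless_trans mless_irrefl by blast
        moreover have "m \<in> {m'\<in>L. \<exists>m. lm f m \<and> (m' = m \<or> mless m' m)}" using m mL by blast
        ultimately show "{m'\<in>L. \<exists>m. lm ?g m \<and> (m' = m \<or> mless m' m)}
          \<noteq> {m'\<in>L. \<exists>m. lm f m \<and> (m' = m \<or> mless m' m)}" by metis
      qed
      then have "card {m'\<in>L. \<exists>m. lm ?g m \<and> (m' = m \<or> mless m' m)}
          < card {m'\<in>L. \<exists>m. lm f m \<and> (m' = m \<or> mless m' m)}"
        using L by (intro psubset_card_mono) auto
      then have "?g \<in> mp.span (F ` L)" using less(1) gV by blast
      moreover have "c *\<^sub>p F m \<in> mp.span (F ` L)" using mL by (intro mp.span_scale mp.span_base) auto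
      ultimately have "?g + c *\<^sub>p F m \<in> mp.span (F ` L)" by (rule mp.span_add)
      then show ?thesis by simp
    qed
  qed
  then have "mp.span (F ` L) = V"
    using F V by (intro mp.span_subspace) auto
  then show ?thesis using ind inj L F by (intro exI[of _ "F ` L"]) (auto simp: card_image)
qed

lemma dim_leads:
  assumes "mp.subspace V" "finite L" "\<And>f m. f \<in> V \<Longrightarrow> lm f m \<Longrightarrow> m \<in> L"
    "\<And>m. m \<in> L \<Longrightarrow> \<exists>f\<in>V. lm f m"
  shows "mp.dim V = card L"
proof -
  have "\<exists>B. finite B \<and> mp.independent B \<and> B \<subseteq> V \<and> mp.span B = V \<and> card B = card L"
    by (rule leads_basis) (use assms in auto)
  then show ?thesis using mp.dim_span_eq_card_independent by metis
qed

lemma finite_basis: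
  assumes "mp.subspace V" "finite S" "V \<subseteq> polys_on S"
  obtains B where "finite B" "mp.independent B" "B \<subseteq> V" "mp.span B = V" "card B = mp.dim V"
proof -
  let ?L = "{m. \<exists>f\<in>V. lm f m}"
  have "?L \<subseteq> S" using assms by (auto simp: polys_on_def lm_def)
  then have "finite ?L" using assms finite_subset by blast
  then obtain B where "finite B" "mp.independent B" "B \<subseteq> V" "mp.span B = V"
    using leads_basis[OF assms(1), of ?L] by blast
  then show ?thesis using that mp.dim_span_eq_card_independent by metis
qed

lemma dim_direct_sum:
  assumes A: "mp.subspace A" and B: "mp.subspace B" and S: "finite S" "A \<subseteq> polys_on S" "B \<subseteq> polys_on S"
    and int: "A \<inter> B = {0}" and V: "V = {a + b | a b. a \<in> A \<and> b \<in> B}"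
  shows "mp.dim V = mp.dim A + mp.dim B"
proof -
  obtain BA where BA: "finite BA" "mp.independent BA" "BA \<subseteq> A" "mp.span BA = A" "card BA = mp.dim A"
    by (rule finite_basis[OF A S(1,2)])
  obtain BB where BB: "finite BB" "mp.independent BB" "BB \<subseteq> B" "mp.span BB = B" "card BB = mp.dim B"
    by (rule finite_basis[OF B S(1,3)])
  have disj: "BA \<inter> BB = {}"
    proof (rule equals0I)
    fix x assume x: "x \<in> BA \<inter> BB"
    then have "x \<in> A \<inter> B" using BA(3) BB(3) by blast
    then have "0 \<in> BA" using int x by auto
    then show False using BA(2) mp.dependent_zero by blast
  qed
  have "mp.independent (BA \<union> BB)"
  proof (rule mp.independent_if_scalars_zero)
    fix u x assume u: "(\<Sum>x\<in>BA \<union> BB. u x *\<^sub>p x) = 0" and x: "x \<in> BA \<union> BB"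
    let ?a = "\<Sum>x\<in>BA. u x *\<^sub>p x" and ?b = "\<Sum>x\<in>BB. u x *\<^sub>p x"
    have sum: "?a + ?b = 0" using u BA BB disj by (simp add: sum.union_disjoint)
    have "?a \<in> mp.span BA" by (intro mp.span_sum mp.span_scale mp.span_base)
    then have a: "?a \<in> A" using BA(4) by simp
    have "?b \<in> mp.span BB" by (intro mp.span_sum mp.span_scale mp.span_base)
    then have b: "?b \<in> B" using BB(4) by simp
    then have "- ?b \<in> B" using B mp.subspace_neg by blast
    moreover have "?a = - ?b" using sum by (simp add: eq_neg_iff_add_eq_0)
    ultimately have "?a \<in> A \<inter> B" using a by simp
    then have a0: "?a = 0" using int by blast
    then have b0: "?b = 0" using sum by simp
    show "u x = 0"
      using x mp.independentD[OF BA(2,1) order_refl a0] mp.independentD[OF BB(2,1) order_refl b0] by blast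
  qed (use BA BB in auto)
  moreover have "mp.span (BA \<union> BB) = V"
    unfolding mp.span_Un BA BB V by blast
  ultimately have "mp.dim V = card (BA \<union> BB)"
    using mp.dim_span_eq_card_independent by metis
  then show ?thesis using BA BB disj by (simp add: card_Un_disjoint)
qed

lemma dim_0 [simp]: "mp.dim {0} = 0"
  by (metis card.empty mp.dim_span_eq_card_independent mp.independent_empty mp.span_empty)

lemma dim_eq_0D:
  assumes "mp.subspace V" "finite S" "V \<subseteq> polys_on S" "mp.dim V = 0" shows "V = {0}"
proof -
  obtain B where "finite B" "mp.independent B" "B \<subseteq> V" "mp.span B = V" "card B = mp.dim V"
    by (rule finite_basis[OF assms(1-3)])
  then show ?thesis using assms by auto
qed

lemma dim_inj_image:
  assumes "mp.subspace V" "finite S" "V \<subseteq> polys_on S" "Vector_Spaces.linear smul smul h"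
    "\<And>f. f \<in> V \<Longrightarrow> h f = 0 \<Longrightarrow> f = 0"
  shows "mp.dim (h ` V) = mp.dim V"
proof -
  interpret h: Vector_Spaces.linear smul smul h by fact
  obtain B where B: "finite B" "mp.independent B" "B \<subseteq> V" "mp.span B = V" "card B = mp.dim V"
    by (rule finite_basis[OF assms(1-3)])
  have inj: "inj_on h (mp.span B)"
  proof (rule inj_onI)
    fix x y assume xy: "x \<in> mp.span B" "y \<in> mp.span B" "h x = h y"
    then have "x - y \<in> V" "h (x - y) = 0" using B(4) mp.span_diff[of x B y] by (auto simp: h.diff)
    then show "x = y" using assms(5) by fastforce
  qed
  then have "mp.independent (h ` B)" using B h.independent_injective_image by blast
  moreover have "mp.span (h ` B) = h ` V" using B h.span_image by metis
  moreover have "card (h ` B) = card B"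
    using inj mp.span_superset by (metis card_image inj_on_subset)
  ultimately show ?thesis using B mp.dim_span_eq_card_independent by metis
qed

text \<open>Gram-Schmidt: the new vector \<open>b\<close> is replaced by its component
  \<open>e\<close> orthogonal to the span of the others.\<close>

lemma orth_span_exists:
  "finite B \<Longrightarrow> \<exists>a\<in>mp.span B. \<forall>g\<in>mp.span B. ip (f - a) g = 0"
proof (induction B arbitrary: f rule: finite_induct)
  case empty
  then show ?case by simp
next
  case (insert b B)
  obtain b0 where b0: "b0 \<in> mp.span B" "\<forall>g\<in>mp.span B. ip (b - b0) g = 0" using insert.IH by blast
  obtain f0 where f0: "f0 \<in> mp.span B" "\<forall>g\<in>mp.span B. ip (f - f0) g = 0" using insert.IH by blast
  define e where "e = b - b0"
  \<comment> \<open>For \<open>e = 0\<close> the quotient is 0 by the convention on division, and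
    the formula for the projection remains correct.\<close>
  let ?c = "ip f e / ip e e"
  let ?a = "f0 + ?c *\<^sub>p e"
  have sub: "mp.span B \<subseteq> mp.span (insert b B)" by (intro mp.span_mono) auto
  have "?a \<in> mp.span (insert b B)"
    using f0 b0 sub unfolding e_def by (intro mp.span_add mp.span_scale mp.span_diff) (auto intro: mp.span_base)
  moreover have "ip (f - ?a) g = 0" if g: "g \<in> mp.span (insert b B)" for g
  proof -
    obtain k where k: "g - k *\<^sub>p b \<in> mp.span B" using g by (auto simp: mp.span_insert)
    define h where "h = (g - k *\<^sub>p b) + k *\<^sub>p b0"
    have h: "h \<in> mp.span B" unfolding h_def using k b0 by (intro mp.span_add mp.span_scale) auto
    have g': "g = h + k *\<^sub>p e" by (simp add: h_def e_def mp.scale_right_diff_distrib)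
    have f0e: "ip f0 e = 0" using b0 f0 unfolding e_def by (metis complex_cnj_zero ip_commute)
    have "ip e h = 0" "ip (f - f0) h = 0" using h b0 f0 unfolding e_def by blast+
    then have *: "ip (f - ?a) h = 0" by (simp add: algebra_simps)
    have "ip (f - ?a) e = ip f e - ip f0 e - ?c * ip e e"
      by (simp add: algebra_simps)
    also have "\<dots> = 0" using f0e by (cases "e = 0") auto
    finally show ?thesis unfolding g' using * by (metis add.right_neutral ip_add_right ip_smul_right mult_zero_right)
  qed
  ultimately show ?case by blast
qed

lemma orth_decomp:
  assumes "mp.subspace V" "finite S" "V \<subseteq> polys_on S"
  obtains a where "a \<in> V" "\<And>g. g \<in> V \<Longrightarrow> ip (f - a) g = 0"
  using finite_basis[OF assms] orth_span_exists by metis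

section \<open>Leading monomials and sl2\<close>

lemma lookup_xd_self: "lookup (xd a a f) m = of_nat (lookup m a) * lookup f m"
proof (cases "lookup m a > 0")
  case True
  then have "m - single a 1 + single a 1 = m"
    by (intro poly_mapping_eqI) (auto simp: lookup_add lookup_minus lookup_single when_def)
  then show ?thesis using True by (auto simp: lookup_xd lookup_minus simp flip: of_nat_Suc)
qed (simp add: lookup_xd)

text \<open>Moving one exponent from \<open>b\<close> to \<open>a\<close> and back is diagonal on
  monomials. In the ballot argument this eigenvalue is the factor that must not vanish.\<close>

lemma lookup_xd_xd:
  assumes "a \<noteq> b"
  shows "lookup (xd b a (xd a b f)) m = of_nat ((lookup m a + 1) * lookup m b) * lookup f m"
proof (cases "lookup m b > 0")
  case True
  have eq: "m - single b 1 + single a 1 - single a 1 + single b 1 = m"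
    using True assms
    by (intro poly_mapping_eqI) (auto simp: lookup_add lookup_minus lookup_single when_def)
  have "lookup (xd a b f) (m - single b 1 + single a 1) = of_nat (lookup m b) * lookup f m"
    using True assms eq by (auto simp: lookup_xd lookup_add lookup_minus lookup_single_not_eq simp flip: of_nat_Suc)
  then show ?thesis using True assms
    by (auto simp: lookup_xd[of b a] lookup_add lookup_minus lookup_single_not_eq algebra_simps)
qed (simp add: lookup_xd)

lemma not_imageI: "(\<And>q. q \<in> A \<Longrightarrow> f q \<noteq> x) \<Longrightarrow> x \<notin> f ` A"
  by auto

lemma power_map_commute: "(\<And>x. f (g x) = g (f x)) \<Longrightarrow> (f ^^ k) ((g ^^ l) x) = (g ^^ l) ((f ^^ k) x)"
proof -
  assume *: "\<And>x. f (g x) = g (f x)"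
  have 1: "f ((g ^^ l) x) = (g ^^ l) (f x)" for x by (induction l) (auto simp: *)
  show ?thesis by (induction k) (auto simp: 1)
qed

lemma pol_power_zero [simp]: "(pol S u w ^^ k) 0 = 0" by (induction k) auto
lemma xd_power_zero [simp]: "(xd a b ^^ k) 0 = 0" by (induction k) auto

lemma pol_insert: "finite S \<Longrightarrow> s \<notin> S \<Longrightarrow> pol (insert s S) u w f = xd (u s) (w s) f + pol S u w f"
  by (simp add: pol_def)

section \<open>The sl2-triple of a set of sites: raising, lowering and weight\<close>

context
  fixes S :: "'s set" and u w :: "'s \<Rightarrow> nat \<times> nat"
  assumes fin: "finite S" and inj: "inj_on u S" "inj_on w S" "\<And>s t. s \<in> S \<Longrightarrow> t \<in> S \<Longrightarrow> u s \<noteq> w t"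
begin

abbreviation "wt m \<equiv> int (\<Sum>s\<in>S. lookup m (u s)) - int (\<Sum>s\<in>S. lookup m (w s))"

lemma sum_lookup_single_inj:
  "t \<in> S \<Longrightarrow> (\<Sum>s\<in>S. lookup (single (u t) 1) (u s)) = (1::nat)"
  "t \<in> S \<Longrightarrow> (\<Sum>s\<in>S. lookup (single (w t) 1) (w s)) = (1::nat)"
  "t \<in> S \<Longrightarrow> (\<Sum>s\<in>S. lookup (single (u t) 1) (w s)) = (0::nat)"
  "t \<in> S \<Longrightarrow> (\<Sum>s\<in>S. lookup (single (w t) 1) (u s)) = (0::nat)"
proof -
  assume t: "t \<in> S"
  have "(\<Sum>s\<in>S. lookup (single (u t) 1) (u s)) = (\<Sum>s\<in>S. if s = t then 1 else (0::nat))"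
    using t inj(1) by (intro sum.cong) (auto simp: lookup_single when_def inj_on_def)
  then show "(\<Sum>s\<in>S. lookup (single (u t) 1) (u s)) = (1::nat)" using t fin by simp
  have "(\<Sum>s\<in>S. lookup (single (w t) 1) (w s)) = (\<Sum>s\<in>S. if s = t then 1 else (0::nat))"
    using t inj(2) by (intro sum.cong) (auto simp: lookup_single when_def inj_on_def)
  then show "(\<Sum>s\<in>S. lookup (single (w t) 1) (w s)) = (1::nat)" using t fin by simp
  show "(\<Sum>s\<in>S. lookup (single (u t) 1) (w s)) = (0::nat)"
       "(\<Sum>s\<in>S. lookup (single (w t) 1) (u s)) = (0::nat)"
    using t inj(3) by (auto intro!: sum.neutral simp: lookup_single when_def)
     (metis inj(3))+
qed

lemma keys_lower_wt:
  assumes "\<And>m. m \<in> keys g \<Longrightarrow> wt m = c" "m \<in> keys (pol S w u g)"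
  shows "wt m = c - 2"
proof -
  obtain s m' where s: "s \<in> S" "m' \<in> keys g" "m + single (u s) 1 = m' + single (w s) 1"
    using keys_pol[OF assms(2)] by blast
  have "(\<Sum>t\<in>S. lookup (m + single (u s) 1) (u t)) = (\<Sum>t\<in>S. lookup (m' + single (w s) 1) (u t))"
    "(\<Sum>t\<in>S. lookup (m + single (u s) 1) (w t)) = (\<Sum>t\<in>S. lookup (m' + single (w s) 1) (w t))"
    using s by simp_all
  then have "(\<Sum>t\<in>S. lookup m (u t)) + 1 = (\<Sum>t\<in>S. lookup m' (u t))"
    "(\<Sum>t\<in>S. lookup m (w t)) = (\<Sum>t\<in>S. lookup m' (w t)) + 1"
    using sum_lookup_single_inj[OF s(1)] by (simp_all only: lookup_add sum.distrib add_0_right)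
  then show ?thesis using assms(1)[OF s(2)] by linarith
qed

lemma raise_lower_commutator:
  assumes "\<And>m. m \<in> keys g \<Longrightarrow> wt m = c"
  shows "pol S u w (pol S w u g) = pol S w u (pol S u w g) + of_int c *\<^sub>p g"
proof -
  have "pol S u w (pol S w u g) - pol S w u (pol S u w g) =
   (\<Sum>s\<in>S. \<Sum>t\<in>S. if s = t then xd (u s) (u s) g - xd (w s) (w s) g else 0)"
    unfolding pol_commutator using inj
    by (intro sum.cong refl) (auto simp: inj_on_def)
  also have "\<dots> = (\<Sum>s\<in>S. xd (u s) (u s) g - xd (w s) (w s) g)"
    using fin by (intro sum.cong) auto
  also have "\<dots> = of_int c *\<^sub>p g"
  proof (rule poly_mapping_eqI)
    fix m
    have "lookup (\<Sum>s\<in>S. xd (u s) (u s) g - xd (w s) (w s) g) m = of_int (wt m) * lookup g m"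
      by (simp add: lookup_sum lookup_minus lookup_xd_self sum_subtractf algebra_simps sum_distrib_left)
    also have "\<dots> = of_int c * lookup g m"
      using assms[of m] by (cases "m \<in> keys g") (auto simp: in_keys_iff)
    finally show "lookup (\<Sum>s\<in>S. xd (u s) (u s) g - xd (w s) (w s) g) m = lookup (of_int c *\<^sub>p g) m"
      by simp
  qed
  finally show ?thesis by (simp add: diff_eq_eq add.commute)
qed

lemma keys_lower_power_wt:
  assumes "\<And>m. m \<in> keys g \<Longrightarrow> wt m = c" "m \<in> keys ((pol S w u ^^ k) g)"
  shows "wt m = c - 2 * int k"
  using assms(2)
proof (induction k arbitrary: m)
  case (Suc k)
  then show ?case using keys_lower_wt[of "(pol S w u ^^ k) g" "c - 2 * int k" m] by simp
qed (use assms(1) in auto)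

text \<open>The scalar is the sum of the weights c, c - 2, ..., c - 2k met on the way down, which is
  (k + 1)(c - k).\<close>

lemma raise_lower_power:
  assumes "pol S u w g = 0" "\<And>m. m \<in> keys g \<Longrightarrow> wt m = c"
  shows "pol S u w ((pol S w u ^^ Suc k) g) = of_int (int (k + 1) * (c - int k)) *\<^sub>p (pol S w u ^^ k) g"
proof (induction k)
  case 0
  then show ?case using raise_lower_commutator[OF assms(2)] assms(1) by simp
next
  case (Suc k)
  let ?h = "(pol S w u ^^ Suc k) g"
  have "pol S u w (pol S w u ?h) = pol S w u (pol S u w ?h) + of_int (c - 2 * int (Suc k)) *\<^sub>p ?h"
    by (rule raise_lower_commutator) (rule keys_lower_power_wt[OF assms(2)])
  also have "pol S w u (pol S u w ?h) = of_int (int (k + 1) * (c - int k)) *\<^sub>p ?h"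
    unfolding Suc.IH by simp
  also have "\<dots> + of_int (c - 2 * int (Suc k)) *\<^sub>p ?h = of_int (int (Suc k + 1) * (c - int (Suc k))) *\<^sub>p ?h"
    unfolding mp.scale_left_distrib[symmetric]
    by (rule arg_cong[where f = "\<lambda>x. x *\<^sub>p ?h"]) (simp add: algebra_simps)
  finally show ?case by simp
qed

text \<open>Positivity does what finite dimensionality usually does. If c is negative, the squared
  norm of the lowered vector is c times that of \<open>g\<close>, so \<open>g\<close> is 0.
  Otherwise the factor in \<open>raise_lower_power\<close> vanishes at k = c, and the (c + 1)-st
  lowering has norm 0.\<close>

lemma lower_power_eq_0:
  assumes "pol S u w g = 0" "\<And>m. m \<in> keys g \<Longrightarrow> wt m = c" "int k > c"
  shows "(pol S w u ^^ k) g = 0"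
proof (cases "c < 0")
  case True
  have "ip (pol S w u g) (pol S w u g) = ip (of_int c *\<^sub>p g) g"
    using raise_lower_commutator[OF assms(2)] assms(1) by (metis add_0 ip_commute ip_pol pol_zero)
  then have "Re (ip (pol S w u g) (pol S w u g)) = of_int c * Re (ip g g)" by simp
  moreover have "Re (ip (pol S w u g) (pol S w u g)) \<ge> 0" "Re (ip g g) \<ge> 0"
    by (rule ip_self_nonneg)+
  ultimately have "Re (ip g g) = 0"
    using True by (smt (verit) mult_neg_pos of_int_less_0_iff)
  then have "ip g g = 0" using ip_self_nonneg(2) by (simp add: complex_eq_iff)
  then show ?thesis by simp
next
  case False
  define l where "l = nat c"
  have c: "c = int l" using False by (simp add: l_def)
  let ?h = "(pol S w u ^^ l) g"
  have "ip (pol S w u ?h) (pol S w u ?h) = ip ?h (pol S u w ((pol S w u ^^ Suc l) g))"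
    by (simp add: ip_pol)
  also have "\<dots> = 0" using raise_lower_power[OF assms(1,2), of l] by (simp add: c)
  finally have *: "(pol S w u ^^ Suc l) g = 0" by simp
  have "k = (k - Suc l) + Suc l" using assms(3) c by simp
  then show ?thesis using * by (metis comp_apply funpow_add pol_power_zero)
qed

end

text \<open>The order conditions are those shared by adjacent columns, with u s = (s, j) and w s =
  (s, j + 1), and adjacent rows, with u s = (i, s) and w s = (i + 1, s). For s < t the positions
  \<open>w s\<close> and \<open>u t\<close> compare differently in the two cases, so nothing is
  assumed about them except that they differ.\<close>

locale sl2_sites =
  fixes L :: nat and u w :: "nat \<Rightarrow> nat \<times> nat"
  assumes u_less_w: "\<And>s t. s \<le> t \<Longrightarrow> t < L \<Longrightarrow> u s < w t"
    and w_less_w: "\<And>s t. s < t \<Longrightarrow> t < L \<Longrightarrow> w s < w t"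
    and u_ne_w: "\<And>s t. s < L \<Longrightarrow> t < L \<Longrightarrow> u s \<noteq> w t"
    and inj_u: "inj_on u {..<L}"
begin

lemma inj_w: "inj_on w {..<L}"
  unfolding inj_on_def by (metis lessThan_iff linorder_neqE_nat order_less_irrefl w_less_w)

context
  fixes f m0
  assumes kill: "pol {..<L} u w f = 0" and lead: "lm f m0"
begin

text \<open>The monomials reachable from \<open>m0\<close> by moving exponents between
  \<open>u t\<close> and \<open>w t\<close> at sites t < s, in either direction. Fixing each site
  total makes membership invariant under these moves (\<open>near_move\<close>).\<close>

definition near :: "nat \<Rightarrow> monom \<Rightarrow> bool" where
  "near s m \<longleftrightarrow> (\<forall>k. k \<notin> u ` {..<s} \<union> w ` {..<s} \<longrightarrow> lookup m k = lookup m0 k) \<and>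
     (\<forall>t<s. lookup m (u t) + lookup m (w t) = lookup m0 (u t) + lookup m0 (w t))"

lemma near_move:
  assumes "s \<le> L" "t < s" "m + single (w t) 1 = m' + single (u t) 1"
  shows "near s m = near s m'"
proof -
  have *: "lookup m k + (if k = w t then 1 else 0) = lookup m' k + (if k = u t then 1 else 0)" for k
    using arg_cong[OF assms(3), of "\<lambda>x. lookup x k"]
    by (auto simp: lookup_add lookup_single when_def)
  have "lookup m k = lookup m' k" if "k \<notin> u ` {..<s} \<union> w ` {..<s}" for k
  proof -
    have "k \<noteq> u t" "k \<noteq> w t" using that assms(2) by auto
    then show ?thesis using *[of k] by simp
  qed
  moreover have "lookup m (u q) + lookup m (w q) = lookup m' (u q) + lookup m' (w q)" if "q < s" for q
  proof -
    have "(u q = u t) = (q = t)" "(w q = w t) = (q = t)" "u q \<noteq> w t" "w q \<noteq> u t"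
      using inj_u inj_w u_ne_w[of q t] u_ne_w[of t q] that assms by (auto simp: inj_on_def)
    then show ?thesis using *[of "u q"] *[of "w q"] by (simp split: if_splits)
  qed
  ultimately show ?thesis unfolding near_def by auto
qed

text \<open>Restrict the equation \<open>kill\<close> to monomials near \<open>m0\<close>. A
  contribution from a site t \<ge> s would come from a monomial of \<open>f\<close> that exceeds
  \<open>m0\<close> at \<open>w t\<close> and agrees with it at all larger positions, contradicting
  that \<open>m0\<close> leads. Only the first s sites remain.\<close>

lemma raise_rest_near:
  assumes "s \<le> L" shows "pol {..<s} u w (rest (near s) f) = 0"
proof -
  have "pol {..<L} u w f = pol {..<s} u w f + pol {s..<L} u w f"
    using assms unfolding pol_def
    by (subst sum.union_disjoint[symmetric]) (auto intro!: arg_cong2[where f = sum])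
  then have "rest (near s) (pol {..<s} u w f) + rest (near s) (pol {s..<L} u w f) = 0"
    using kill by (metis rest_add rest_zero)
  moreover have "rest (near s) (pol {s..<L} u w f) = 0"
  proof (rule rest_0I)
    fix m assume "m \<in> keys (pol {s..<L} u w f)"
    from keys_pol[OF this] obtain t m'
      where t: "s \<le> t" "t < L" "m' \<in> keys f" "m + single (w t) 1 = m' + single (u t) 1"
      by (metis atLeastLessThan_iff)
    show "\<not> near s m"
    proof
      assume near: "near s m"
      have *: "lookup m k + (if k = w t then 1 else 0) = lookup m' k + (if k = u t then 1 else 0)" for k
        using arg_cong[OF t(4), of "\<lambda>x. lookup x k"]
        by (auto simp: lookup_add lookup_single when_def)
      have eq: "lookup m k = lookup m0 k" if "k \<ge> w t" for k
      proof -
        have "u q < w t" "w q < w t" if "q < s" for q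
          using that t u_less_w[of q t] w_less_w[of q t] by auto
        then have "k \<notin> u ` {..<s} \<union> w ` {..<s}" using that by force
        then show ?thesis using near unfolding near_def by blast
      qed
      have "u t < w t" using u_less_w t by blast
      then have "lookup m0 (w t) < lookup m' (w t)"
        using *[of "w t"] eq[of "w t"] by (auto split: if_splits)
      moreover have "lookup m0 k' = lookup m' k'" if "k' > w t" for k'
      proof -
        have "k' \<noteq> w t" "k' \<noteq> u t" "k' \<ge> w t" using that \<open>u t < w t\<close> by auto
        then show ?thesis using *[of k'] eq[of k'] by simp
      qed
      ultimately have "lookup m0 (w t) < lookup m' (w t)" "\<forall>k'>w t. lookup m0 k' = lookup m' k'"
        by blast+
      then have "mless m0 m'" unfolding mless_def by blast
      moreover have "m' = m0 \<or> mless m' m0" using lead t by (auto simp: lm_def)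
      ultimately show False using mless_trans mless_irrefl by blast
    qed
  qed
  ultimately have "rest (near s) (pol {..<s} u w f) = 0" by simp
  then show ?thesis
    using rest_pol[of "{..<s}" w u "near s" f] near_move[OF assms] by auto
qed

text \<open>
  Let \<open>g\<close> be the part of \<open>f\<close> that agrees with \<open>m0\<close> from site \<open>s\<close> on, and \<open>c\<close> its \<open>sl\<^sub>2\<close>-weight. By maximality
  of \<open>m0\<close> it is a highest weight vector for the first \<open>s\<close> sites. If the exponent \<open>B\<close> of \<open>w s\<close> exceeded
  \<open>c\<close>, then lowering \<open>g\<close> \<open>B\<close> times would give 0; shifting the lowering operators one at a time to site \<open>s\<close>,
  where adjointness trades them against the annihilation of \<open>f\<close>, yields \<open>ip g g = 0\<close>.
\<close>

lemma lead_ballot: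
  assumes weight_hom: "\<And>m. m \<in> keys f \<Longrightarrow> (\<Sum>t<L. lookup m (w t)) = (\<Sum>t<L. lookup m0 (w t))"
    and s: "s < L"
  shows "(\<Sum>t\<le>s. lookup m0 (w t)) \<le> (\<Sum>t<s. lookup m0 (u t))"
proof (rule ccontr)
  assume neg: "\<not> ?thesis"
  define ft where "ft = rest (near (Suc s)) f"
  define g where "g = rest (near s) f"
  define B where "B = lookup m0 (w s)"
  define A where "A = lookup m0 (u s)"
  let ?a = "u s" and ?b = "w s"
  let ?F = "pol {..<s} w u"
  define c where "c = int (\<Sum>t<s. lookup m0 (u t)) - int (\<Sum>t<s. lookup m0 (w t))"
  have Bc: "int B > c" using neg unfolding c_def B_def
    by (simp add: lessThan_Suc_atMost[symmetric] not_le del: of_nat_sum)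
  have inj': "inj_on u {..<s}" "inj_on w {..<s}"
    using s by (intro inj_on_subset[OF inj_u] inj_on_subset[OF inj_w]; auto)+
  have off: "lookup m k = lookup m0 k" if "near s m" "k \<notin> u ` {..<s} \<union> w ` {..<s}" for m k
    using that unfolding near_def by blast
  have sep: "u q \<noteq> ?a" "w q \<noteq> ?a" "u q \<noteq> ?b" "w q \<noteq> ?b" if "q < s" for q
  proof -
    have q: "q \<in> {..<L}" "s \<in> {..<L}" "q < L" "q \<noteq> s" using that s by auto
    show "u q \<noteq> ?a" using inj_u q by (simp only: inj_on_eq_iff not_False_eq_True)
    show "w q \<noteq> ?b" using inj_w q by (simp only: inj_on_eq_iff not_False_eq_True)
    show "u q \<noteq> ?b" by (rule u_ne_w[OF q(3) s])
    show "w q \<noteq> ?a" by (rule u_ne_w[OF s q(3), symmetric])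
  qed
  have out: "?a \<notin> u ` {..<s} \<union> w ` {..<s}" "?b \<notin> u ` {..<s} \<union> w ` {..<s}"
    unfolding Un_iff de_Morgan_disj by (intro conjI not_imageI sep; simp)+
  have tail: "lookup m (w t) = lookup m0 (w t)" if "near s m" "s \<le> t" "t < L" for m t
  proof (rule off[OF that(1)])
    show "w t \<notin> u ` {..<s} \<union> w ` {..<s}"
    proof
      assume "w t \<in> u ` {..<s} \<union> w ` {..<s}"
      then obtain q where q: "q < s" "w t = u q \<or> w t = w q" by auto
      then have "u q < w t" "w q < w t" using u_less_w[of q t] w_less_w[of q t] that by auto
      then show False using q by auto
    qed
  qed
  \<comment> \<open>The sum over all \<open>w\<close>-positions is constant on \<open>f\<close>, and
    from site s on the exponents there agree with those of \<open>m0\<close>, so the sum over the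
    first s of them is fixed. The site totals then fix the corresponding
    \<open>u\<close>-sum.\<close>
  have wt: "int (\<Sum>t<s. lookup m (u t)) - int (\<Sum>t<s. lookup m (w t)) = c" if "m \<in> keys g" for m
  proof -
    have m: "m \<in> keys f" "near s m" using that by (auto simp: g_def)
    have split: "(\<Sum>t<L. lookup m' (w t)) = (\<Sum>t<s. lookup m' (w t)) + (\<Sum>t=s..<L. lookup m' (w t))" for m'
      using s by (metis less_imp_le_nat lessThan_atLeast0 sum.atLeastLessThan_concat zero_le)
    have "(\<Sum>t=s..<L. lookup m (w t)) = (\<Sum>t=s..<L. lookup m0 (w t))"
      using tail m by (intro sum.cong) auto
    then have 1: "(\<Sum>t<s. lookup m (w t)) = (\<Sum>t<s. lookup m0 (w t))"
      using weight_hom[OF m(1)] split[of m] split[of m0] by linarith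
    have "(\<Sum>t<s. lookup m (u t) + lookup m (w t)) = (\<Sum>t<s. lookup m0 (u t) + lookup m0 (w t))"
      using m by (intro sum.cong) (auto simp: near_def)
    then have "(\<Sum>t<s. lookup m (u t)) = (\<Sum>t<s. lookup m0 (u t))" using 1 by (simp add: sum.distrib)
    with 1 show ?thesis by (simp add: c_def)
  qed
  have Eg: "pol {..<s} u w g = 0" unfolding g_def using raise_rest_near s by simp
  have FB: "(?F ^^ B) g = 0"
    using s by (intro lower_power_eq_0[where c = c] inj' Eg wt Bc u_ne_w) auto
  have ft: "pol {..<Suc s} u w ft = 0" unfolding ft_def using raise_rest_near s by simp
  have polSuc: "pol {..<Suc s} w u h = xd ?b ?a h + ?F h" for h
    unfolding lessThan_Suc by (rule pol_insert) auto
  have comm: "?F (xd ?a ?b h) = xd ?a ?b (?F h)" for h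
  proof -
    have "?F (xd ?a ?b h) - xd ?a ?b (?F h) = 0"
      using pol_commutator[of "{..<s}" w u "{s}" u w h] sep sep(4)[symmetric]
      by (simp add: pol_def)
    then show ?thesis by simp
  qed
  have keysF: "lookup m ?a = A \<and> lookup m ?b = B" if "m \<in> keys ((?F ^^ k) g)" for m k
    using that
  proof (induction k arbitrary: m)
    case 0
    then have "near s m" by (simp add: g_def)
    then show ?case using off out by (simp add: A_def B_def)
  next
    case (Suc k)
    then have "m \<in> keys (?F ((?F ^^ k) g))" by simp
    from keys_pol[OF this] obtain q m' where
      q: "q < s" "m' \<in> keys ((?F ^^ k) g)" "m + single (u q) 1 = m' + single (w q) 1"
      by (metis lessThan_iff)
    note ne = sep[OF q(1), symmetric]
    have "lookup m ?a = lookup m' ?a" "lookup m ?b = lookup m' ?b"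
      using arg_cong[OF q(3), of "\<lambda>x. lookup x ?a"] arg_cong[OF q(3), of "\<lambda>x. lookup x ?b"] ne
      by (simp_all add: lookup_add lookup_single when_def)
    then show ?case using Suc.IH q by simp
  qed
  have ab: "?a \<noteq> ?b" using u_ne_w s by blast
  have keysQ: "lookup m ?a = A + l \<and> lookup m ?b + l = B" if "m \<in> keys ((xd ?a ?b ^^ l) ((?F ^^ k) g))" for m k l
    using that
  proof (induction l arbitrary: m)
    case 0
    then show ?case using keysF by simp
  next
    case (Suc l)
    then have "m \<in> keys (xd ?a ?b ((xd ?a ?b ^^ l) ((?F ^^ k) g)))" by simp
    from keys_xd[OF this] obtain m' where
      m': "m' \<in> keys ((xd ?a ?b ^^ l) ((?F ^^ k) g))" "m + single ?b 1 = m' + single ?a 1"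
      by blast
    have "lookup m ?a = lookup m' ?a + 1" "lookup m ?b + 1 = lookup m' ?b"
      using arg_cong[OF m'(2), of "\<lambda>x. lookup x ?a"] arg_cong[OF m'(2), of "\<lambda>x. lookup x ?b"] ab
      by (simp_all add: lookup_add lookup_single when_def)
    then show ?case using Suc.IH[OF m'(1)] by simp
  qed
  let ?Q = "\<lambda>k. (xd ?a ?b ^^ k) ((?F ^^ k) g)"
  \<comment> \<open>Pair the vanishing raised \<open>ft\<close> with k + 1 shifts at site s applied
    to k lowerings of \<open>g\<close>. The adjoint operator has two parts: at site s it undoes one
    shift up to the scalar of \<open>lookup_xd_xd\<close>, and on the sites below it adds one
    lowering, which commutes with the shifts.\<close>
  have step: "ip ft (?Q (Suc k)) = - of_nat ((A + k + 1) * (B - k)) * ip ft (?Q k)" for k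
  proof -
    let ?q = "(xd ?a ?b ^^ Suc k) ((?F ^^ k) g)"
    have "0 = ip (pol {..<Suc s} u w ft) ?q" using ft by simp
    also have "\<dots> = ip ft (pol {..<Suc s} w u ?q)" by (simp add: ip_pol)
    also have "pol {..<Suc s} w u ?q = xd ?b ?a (xd ?a ?b (?Q k)) + ?Q (Suc k)"
      unfolding polSuc using power_map_commute[of ?F "xd ?a ?b" 1 "Suc k"] comm by simp
    also have "xd ?b ?a (xd ?a ?b (?Q k)) = of_nat ((A + k + 1) * (B - k)) *\<^sub>p ?Q k"
    proof (rule poly_mapping_eqI)
      fix m
      show "lookup (xd ?b ?a (xd ?a ?b (?Q k))) m = lookup (of_nat ((A + k + 1) * (B - k)) *\<^sub>p ?Q k) m"
        unfolding lookup_xd_xd[OF ab] lookup_smul using keysQ[of m k k]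
        by (cases "m \<in> keys (?Q k)") (auto simp: in_keys_iff)
    qed
    finally have "of_nat ((A + k + 1) * (B - k)) * ip ft (?Q k) + ip ft (?Q (Suc k)) = 0"
      by (simp only: ip_add_right ip_smul_right complex_cnj_of_nat)
    then show ?thesis by (simp only: add_eq_0_iff mult_minus_left)
  qed
  \<comment> \<open>The recursion is run downwards from B, where the lowerings of \<open>g\<close>
    vanish, to 0; its scalar at index k is nonzero for k < B.\<close>
  have "ip ft (?Q (B - k)) = 0" for k
  proof (induction k)
    case 0
    then show ?case using FB by simp
  next
    case (Suc k)
    show ?case
    proof (cases "k < B")
      case True
      then have e: "B - k = Suc (B - Suc k)" by simp
      have "(A + (B - Suc k) + 1) * (B - (B - Suc k)) \<noteq> 0" using True by simp
      moreover have "- of_nat ((A + (B - Suc k) + 1) * (B - (B - Suc k))) * ip ft (?Q (B - Suc k)) = (0::complex)"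
        using step[of "B - Suc k"] Suc e by metis
      ultimately show ?thesis
        by (metis mult_eq_0_iff neg_equal_0_iff_equal of_nat_eq_0_iff)
    qed (use Suc in simp)
  qed
  from this[of B] have "ip ft g = 0" by simp
  have near_Suc: "near s m \<Longrightarrow> near (Suc s) m" for m
  proof -
    assume n: "near s m"
    have "lookup m k = lookup m0 k" if "k \<notin> u ` {..<Suc s} \<union> w ` {..<Suc s}" for k
      by (rule off[OF n]) (use that in \<open>simp add: lessThan_Suc\<close>)
    moreover have "lookup m (u t) + lookup m (w t) = lookup m0 (u t) + lookup m0 (w t)" if "t < Suc s" for t
    proof (cases "t = s")
      case True
      then show ?thesis using off[OF n out(1)] off[OF n out(2)] by simp
    next
      case False
      then have "t < s" using that by simp
      then show ?thesis using n unfolding near_def by blast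
    qed
    ultimately show "near (Suc s) m" unfolding near_def by blast
  qed
  \<comment> \<open>Since \<open>g\<close> is the orthogonal projection of \<open>ft\<close>, its
    inner product with \<open>ft\<close> is its own squared norm.\<close>
  have "g = rest (near s) ft"
    by (rule poly_mapping_eqI) (auto simp: g_def ft_def lookup_rest dest: near_Suc)
  moreover have "rest (near s) g = g" by (rule rest_idI) (simp add: g_def)
  ultimately have "ip ft g = ip g g" using ip_rest[of "near s" ft g] by simp
  with \<open>ip ft g = 0\<close> have "g = 0" by simp
  moreover have "m0 \<in> keys g" using lead by (auto simp: g_def near_def lm_def)
  ultimately show False by simp
qed

end
end

section \<open>Polarization operators and highest weight vectors\<close>

text \<open>Degrees summed over the fibres of \<open>h\<close>: \<open>md fst\<close> is the row
  degree, which serves as the weight, and \<open>md snd\<close> the column degree, which row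
  polarizations preserve.\<close>

definition md :: "(nat \<times> nat \<Rightarrow> nat) \<Rightarrow> monom \<Rightarrow> (nat \<Rightarrow>\<^sub>0 nat)" where
  "md h m = (\<Sum>a\<in>keys m. single (h a) (lookup m a))"

lemma multidegree_eq_md: "multidegree m = md fst m"
  by (simp add: multidegree_def md_def case_prod_unfold)

lemma md_superset: "finite S \<Longrightarrow> keys m \<subseteq> S \<Longrightarrow> md h m = (\<Sum>a\<in>S. single (h a) (lookup m a))"
  unfolding md_def by (intro sum.mono_neutral_left) (auto simp: in_keys_iff)

lemma md_add: "md h (m + m') = md h m + md h m'"
proof -
  let ?S = "keys m \<union> keys m'"
  have "keys (m + m') \<subseteq> ?S" by (rule Poly_Mapping.keys_add)
  then show ?thesis
    by (simp add: md_superset[of ?S] lookup_add single_add sum.distrib)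
qed

lemma md_single [simp]: "md h (single a c) = single (h a) c"
  by (simp add: md_def)

lemma md_zero [simp]: "md h 0 = 0"
  by (simp add: md_def)

lemma md_sum: "md h (sum f S) = (\<Sum>s\<in>S. md h (f s))"
  by (induction S rule: infinite_finite_induct) (auto simp: md_add)

lemma lookup_md_fst:
  assumes "\<And>a. a \<in> keys m \<Longrightarrow> snd a \<in> T" "finite T"
  shows "lookup (md fst m) i = (\<Sum>j\<in>T. lookup m (i, j))"
proof -
  let ?S = "fst ` keys m \<times> T"
  have "lookup (md fst m) i = (\<Sum>a\<in>?S. (lookup m a when fst a = i))"
    using assms by (subst md_superset[of ?S])
      (auto simp: lookup_sum lookup_single intro!: rev_image_eqI)
  also have "\<dots> = (\<Sum>j\<in>T. \<Sum>i'\<in>fst ` keys m. (lookup m (i', j) when i' = i))"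
    by (subst sum.swap) (simp add: sum.cartesian_product case_prod_unfold)
  also have "\<dots> = (\<Sum>j\<in>T. lookup m (i, j))"
  proof (rule sum.cong)
    fix j
    have "i \<notin> fst ` keys m \<Longrightarrow> lookup m (i, j) = 0"
      by (metis fst_conv imageI in_keys_iff)
    then show "(\<Sum>i'\<in>fst ` keys m. (lookup m (i', j) when i' = i)) = lookup m (i, j)"
      by (auto simp: when_def)
  qed simp
  finally show ?thesis .
qed

lemma lookup_md_snd:
  assumes "\<And>a. a \<in> keys m \<Longrightarrow> fst a \<in> T" "finite T"
  shows "lookup (md snd m) j = (\<Sum>i\<in>T. lookup m (i, j))"
proof -
  let ?S = "T \<times> snd ` keys m"
  have "lookup (md snd m) j = (\<Sum>a\<in>?S. (lookup m a when snd a = j))"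
    using assms by (subst md_superset[of ?S])
      (auto simp: lookup_sum lookup_single intro!: rev_image_eqI)
  also have "\<dots> = (\<Sum>i\<in>T. \<Sum>j'\<in>snd ` keys m. (lookup m (i, j') when j' = j))"
    by (simp add: sum.cartesian_product case_prod_unfold)
  also have "\<dots> = (\<Sum>i\<in>T. lookup m (i, j))"
  proof (rule sum.cong)
    fix i
    have "j \<notin> snd ` keys m \<Longrightarrow> lookup m (i, j) = 0"
      by (metis snd_conv imageI in_keys_iff)
    then show "(\<Sum>j'\<in>snd ` keys m. (lookup m (i, j') when j' = j)) = lookup m (i, j)"
      by (auto simp: when_def)
  qed simp
  finally show ?thesis .
qed

definition tdeg :: "monom \<Rightarrow> nat" where "tdeg m = (\<Sum>a\<in>keys m. lookup m a)"

lemma tdeg_superset: "finite S \<Longrightarrow> keys m \<subseteq> S \<Longrightarrow> tdeg m = (\<Sum>a\<in>S. lookup m a)"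
  unfolding tdeg_def by (intro sum.mono_neutral_left) (auto simp: in_keys_iff)

lemma tdeg_add: "tdeg (m + m') = tdeg m + tdeg m'"
proof -
  let ?S = "keys m \<union> keys m'"
  have "keys (m + m') \<subseteq> ?S" by (rule Poly_Mapping.keys_add)
  then show ?thesis by (simp add: tdeg_superset[of ?S] lookup_add sum.distrib)
qed

lemma tdeg_single [simp]: "tdeg (single a c) = c"
  by (simp add: tdeg_def)

lemma lookup_le_tdeg: "lookup m a \<le> tdeg m"
proof (cases "a \<in> keys m")
  case True
  then show ?thesis unfolding tdeg_def by (intro member_le_sum) auto
qed (simp add: in_keys_iff)

definition box :: "nat set \<Rightarrow> nat set \<Rightarrow> monom set" where
  "box I J = {m. keys m \<subseteq> I \<times> J}"

definition dbox :: "nat set \<Rightarrow> nat set \<Rightarrow> nat \<Rightarrow> monom set" where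
  "dbox I J d = {m \<in> box I J. tdeg m \<le> d}"

lemma finite_dbox: assumes "finite I" "finite J" shows "finite (dbox I J d)"
proof -
  have "lookup ` dbox I J d \<subseteq> {f. \<forall>x. (x \<in> I \<times> J \<longrightarrow> f x \<in> {..d}) \<and> (x \<notin> I \<times> J \<longrightarrow> f x = 0)}"
  proof -
    have "lookup m x \<in> {..d}" "x \<notin> I \<times> J \<longrightarrow> lookup m x = 0" if m: "m \<in> dbox I J d" for m x
      using lookup_le_tdeg[of m x] m by (auto simp: dbox_def box_def simp flip: not_in_keys_iff_lookup_eq_zero)
    note * = this
    show ?thesis
      by (intro image_subsetI CollectI allI conjI impI) (erule *(1), metis *(2))
  qed
  moreover have "finite \<dots>" using assms by (intro finite_set_of_finite_funs) auto
  ultimately have "finite (lookup ` dbox I J d)" by (rule finite_subset)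
  then show ?thesis by (rule finite_imageD) (rule inj_onI, rule poly_mapping_eqI, simp)
qed

lemma box_move:
  assumes "m \<in> box I J" "m' + single b 1 = m + single a 1" "a \<in> I \<times> J"
  shows "m' \<in> box I J"
proof -
  have "keys m' \<subseteq> keys (m' + single b 1)"
    by (auto simp: in_keys_iff lookup_add)
  also have "\<dots> \<subseteq> keys m \<union> {a}"
    unfolding assms(2) using Poly_Mapping.keys_add[of m "single a 1"] by auto
  finally show ?thesis using assms by (auto simp: box_def)
qed

lemma tdeg_move: "m' + single b 1 = m + single a 1 \<Longrightarrow> tdeg m' = tdeg m"
  using tdeg_add[of m' "single b 1"] tdeg_add[of m "single a 1"] by simp

lemma subspace_polys_on: "mp.subspace (polys_on S)"
  by (rule mp.subspaceI)
     (auto simp: polys_on_def in_keys_iff lookup_add subset_iff, metis add_0)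

text \<open>
  The bound \<open>C\<close> on the columns may exceed the number \<open>n\<close> of columns of interest: the extra columns
  accommodate a reference module with which a given module is compared.
\<close>

definition rowpol :: "nat \<Rightarrow> nat \<Rightarrow> nat \<Rightarrow> mpoly \<Rightarrow> mpoly" where
  "rowpol C i k = pol {..<C} (Pair i) (Pair k)"

definition colpol :: "nat \<Rightarrow> nat \<Rightarrow> nat \<Rightarrow> mpoly \<Rightarrow> mpoly" where
  "colpol r j k = pol {..<r} (\<lambda>i. (i, j)) (\<lambda>i. (i, k))"

lemma rowpol_add [simp]: "rowpol C i k (f + g) = rowpol C i k f + rowpol C i k g" by (simp add: rowpol_def)
lemma rowpol_smul [simp]: "rowpol C i k (c *\<^sub>p f) = c *\<^sub>p rowpol C i k f" by (simp add: rowpol_def)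
lemma rowpol_zero [simp]: "rowpol C i k 0 = 0" by (simp add: rowpol_def)
lemma rowpol_diff [simp]: "rowpol C i k (f - g) = rowpol C i k f - rowpol C i k g" by (simp add: rowpol_def)
lemma rowpol_mult: "rowpol C i k (f * g) = rowpol C i k f * g + f * rowpol C i k g" by (simp add: rowpol_def pol_mult)
lemma ip_rowpol: "ip (rowpol C i k f) g = ip f (rowpol C k i g)" by (simp add: rowpol_def ip_pol)

lemma rowpol_commutator: "rowpol C i k (rowpol C l m f) = rowpol C l m (rowpol C i k f)
   + (if k = l then rowpol C i m f else 0) - (if m = i then rowpol C l k f else 0)"
proof -
  have "rowpol C i k (rowpol C l m f) - rowpol C l m (rowpol C i k f) =
    (\<Sum>s<C. \<Sum>t<C. if s = t then (if k = l then xd (i, s) (m, s) f else 0)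
        - (if m = i then xd (l, s) (k, s) f else 0) else 0)"
    unfolding rowpol_def pol_commutator by (intro sum.cong refl) auto
  also have "\<dots> = (if k = l then rowpol C i m f else 0) - (if m = i then rowpol C l k f else 0)"
    by (simp add: rowpol_def pol_def sum_subtractf)
  finally show ?thesis by (simp add: algebra_simps)
qed

text \<open>Every term of the commutator is \<open>xd (i, a) (k, b)\<close>, once with each sign.
  The range assumptions ensure that both occurrences are present in the truncated sums.\<close>

lemma rowpol_colpol_commute:
  assumes "i < r" "k < r" "a < C" "b < C"
  shows "rowpol C i k (colpol r a b f) = colpol r a b (rowpol C i k f)"
proof -
  have "rowpol C i k (colpol r a b f) - colpol r a b (rowpol C i k f) =
    (\<Sum>j<C. \<Sum>l<r. (if l = k \<and> j = a then xd (i, a) (k, b) f else 0)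
        - (if l = i \<and> j = b then xd (i, a) (k, b) f else 0))"
    unfolding rowpol_def colpol_def pol_commutator by (intro sum.cong refl) auto
  also have "\<dots> = (\<Sum>j<C. (if j = a then xd (i, a) (k, b) f else 0)) - (\<Sum>j<C. (if j = b then xd (i, a) (k, b) f else 0))"
    unfolding sum_subtractf
    by (intro arg_cong2[where f = minus] sum.cong refl) (use assms in \<open>auto simp: if_distrib cong: if_cong\<close>)
  also have "\<dots> = 0" using assms by simp
  finally show ?thesis by simp
qed

lemma keys_rowpol:
  assumes "m \<in> keys (rowpol C i k f)"
  obtains j m' where "j < C" "m' \<in> keys f" "m + single (k, j) 1 = m' + single (i, j) 1" "lookup m' (k, j) > 0"
  using keys_pol[OF assms[unfolded rowpol_def]] that by auto

definition weight_hom :: "(nat \<Rightarrow>\<^sub>0 nat) \<Rightarrow> mpoly \<Rightarrow> bool" where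
  "weight_hom \<alpha> f \<longleftrightarrow> (\<forall>m\<in>keys f. md fst m = \<alpha>)"

definition wpart :: "(nat \<Rightarrow>\<^sub>0 nat) \<Rightarrow> mpoly \<Rightarrow> mpoly" where
  "wpart \<alpha> f = rest (\<lambda>m. md fst m = \<alpha>) f"

lemma wpart_add [simp]: "wpart \<alpha> (f + g) = wpart \<alpha> f + wpart \<alpha> g" by (simp add: wpart_def)
lemma wpart_smul [simp]: "wpart \<alpha> (c *\<^sub>p f) = c *\<^sub>p wpart \<alpha> f" by (simp add: wpart_def)
lemma wpart_zero [simp]: "wpart \<alpha> 0 = 0" by (simp add: wpart_def)
lemma hom_wpart [simp]: "weight_hom \<alpha> (wpart \<alpha> f)" by (auto simp: weight_hom_def wpart_def)
lemma ip_wpart: "ip (wpart \<alpha> f) g = ip f (wpart \<alpha> g)" by (simp add: wpart_def ip_rest)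
lemma wpart_hom: "weight_hom \<beta> f \<Longrightarrow> wpart \<alpha> f = (if \<alpha> = \<beta> then f else 0)"
  unfolding wpart_def weight_hom_def by (auto intro: rest_idI rest_0I)

lemma hom_rowpol:
  assumes "weight_hom \<alpha> f" "m \<in> keys (rowpol C i k f)"
  shows "md fst m + single k 1 = \<alpha> + single i 1"
proof -
  obtain j m' where "m' \<in> keys f" "m + single (k, j) 1 = m' + single (i, j) 1"
    using keys_rowpol[OF assms(2)] by metis
  then have "md fst (m + single (k, j) 1) = md fst (m' + single (i, j) 1)" "md fst m' = \<alpha>"
    using assms(1) by (auto simp: weight_hom_def)
  then show ?thesis by (simp add: md_add)
qed

lemma hom_rowpol_ex: assumes "weight_hom \<alpha> f" shows "\<exists>\<beta>. weight_hom \<beta> (rowpol C i k f)"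
proof (cases "rowpol C i k f = 0")
  case True
  then show ?thesis by (simp add: weight_hom_def)
next
  case False
  then obtain m where "m \<in> keys (rowpol C i k f)" by (metis equals0I keys_eq_empty)
  then have "weight_hom (md fst m) (rowpol C i k f)"
    unfolding weight_hom_def using hom_rowpol[OF assms] by (metis add_right_cancel)
  then show ?thesis by blast
qed

lemma rowpol_diag:
  assumes "weight_hom \<alpha> f" "f \<in> polys_on (box UNIV {..<C})"
  shows "rowpol C i i f = of_nat (lookup \<alpha> i) *\<^sub>p f"
proof (rule poly_mapping_eqI)
  fix m
  have "lookup (rowpol C i i f) m = of_nat (\<Sum>j<C. lookup m (i, j)) * lookup f m"
    by (simp add: rowpol_def pol_def lookup_sum lookup_xd_self sum_distrib_right)
  also have "\<dots> = of_nat (lookup \<alpha> i) * lookup f m"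
  proof (cases "m \<in> keys f")
    case True
    then have "keys m \<subseteq> UNIV \<times> {..<C}" "md fst m = \<alpha>" using assms by (auto simp: polys_on_def box_def weight_hom_def)
    then show ?thesis using lookup_md_fst[of m "{..<C}" i] by fastforce
  qed (simp add: in_keys_iff)
  finally show "lookup (rowpol C i i f) m = lookup (of_nat (lookup \<alpha> i) *\<^sub>p f) m" by simp
qed

text \<open>Closure under \<open>wpart\<close> provides weight decompositions inside
  \<open>V\<close> directly, rather than through eigenvalues of the diagonal operators.\<close>

definition gl_stable :: "nat \<Rightarrow> nat \<Rightarrow> mpoly set \<Rightarrow> bool" where
  "gl_stable r C V \<longleftrightarrow> mp.subspace V \<and> (\<forall>i<r. \<forall>k<r. \<forall>f\<in>V. rowpol C i k f \<in> V) \<and>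
     (\<forall>\<alpha>. \<forall>f\<in>V. wpart \<alpha> f \<in> V)"

definition hw :: "nat \<Rightarrow> nat \<Rightarrow> mpoly \<Rightarrow> bool" where
  "hw r C f \<longleftrightarrow> (\<forall>i k. i < k \<longrightarrow> k < r \<longrightarrow> rowpol C i k f = 0)"

lemma gl_stable_dbox: "gl_stable r C (polys_on (dbox {..<r} {..<C} d))"
proof -
  have "rowpol C i k f \<in> polys_on (dbox {..<r} {..<C} d)" if "i < r" "f \<in> polys_on (dbox {..<r} {..<C} d)" for i k f
  proof -
    have "m \<in> dbox {..<r} {..<C} d" if m: "m \<in> keys (rowpol C i k f)" for m
    proof -
      obtain j m' where j: "j < C" "m' \<in> keys f" "m + single (k, j) 1 = m' + single (i, j) 1"
        using keys_rowpol[OF m] by metis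
      then have "m' \<in> box {..<r} {..<C}" "tdeg m' \<le> d"
        using \<open>f \<in> _\<close> by (auto simp: polys_on_def dbox_def)
      then show ?thesis
        using box_move[OF _ j(3)] tdeg_move[OF j(3)] \<open>i < r\<close> j by (auto simp: dbox_def)
    qed
    then show ?thesis by (auto simp: polys_on_def)
  qed
  then show ?thesis unfolding gl_stable_def
    using subspace_polys_on[unfolded polys_on_def] by (auto simp: wpart_def polys_on_def)
qed

text \<open>Raising moves one exponent from row k to a row i < k and so increases \<Phi> by k - i.
  Only finitely many weights occur, so one of them maximizes \<Phi>, and its vectors are killed by
  all raising operators.\<close>

lemma hw_exists:
  assumes V: "gl_stable r C V" "V \<subseteq> polys_on S" "finite S" "V \<noteq> {0}" and rows: "V \<subseteq> polys_on (box {..<r} UNIV)"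
  obtains v \<alpha> where "v \<in> V" "v \<noteq> 0" "weight_hom \<alpha> v" "hw r C v"
proof -
  let ?A = "{\<alpha>. \<exists>v\<in>V. v \<noteq> 0 \<and> weight_hom \<alpha> v}"
  define \<Phi> where "\<Phi> = (\<lambda>\<alpha>::nat \<Rightarrow>\<^sub>0 nat. \<Sum>i<r. lookup \<alpha> i * (r - i))"
  have "?A \<subseteq> md fst ` S"
  proof
    fix \<alpha> assume "\<alpha> \<in> ?A"
    then obtain v where v: "v \<in> V" "v \<noteq> 0" "weight_hom \<alpha> v" by blast
    then obtain m where "m \<in> keys v" by (metis equals0I keys_eq_empty)
    moreover have "m \<in> S" using \<open>m \<in> keys v\<close> v(1) V(2) by (auto simp: polys_on_def)
    ultimately show "\<alpha> \<in> md fst ` S" using v(3) by (auto simp: weight_hom_def)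
  qed
  then have fin: "finite ?A" using V finite_surj by blast
  have "0 \<in> V" using V(1) mp.subspace_0 by (auto simp: gl_stable_def)
  then obtain f where f: "f \<in> V" "f \<noteq> 0" using V(4) by auto
  then obtain m where m: "m \<in> keys f" by (metis equals0I keys_eq_empty)
  have "lookup (wpart (md fst m) f) m \<noteq> 0" using m by (simp add: wpart_def lookup_rest in_keys_iff)
  then have "wpart (md fst m) f \<noteq> 0" by auto
  moreover have "wpart (md fst m) f \<in> V" using f(1) V(1) by (simp add: gl_stable_def)
  ultimately have "md fst m \<in> ?A" using hom_wpart by (intro CollectI bexI conjI)
  then have ne: "?A \<noteq> {}" by (metis empty_iff)
  obtain \<alpha> where \<alpha>: "\<alpha> \<in> ?A" "\<And>\<beta>. \<beta> \<in> ?A \<Longrightarrow> \<Phi> \<beta> \<le> \<Phi> \<alpha>"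
  proof -
    have "Max (\<Phi> ` ?A) \<in> \<Phi> ` ?A" using fin ne by (intro Max_in) auto
    then obtain \<alpha> where \<alpha>: "Max (\<Phi> ` ?A) = \<Phi> \<alpha>" "\<alpha> \<in> ?A" by (rule imageE)
    moreover have "\<Phi> \<beta> \<le> Max (\<Phi> ` ?A)" if "\<beta> \<in> ?A" for \<beta>
      by (intro Max_ge finite_imageI fin imageI that)
    ultimately show ?thesis by (intro that[of \<alpha>]) simp_all
  qed
  then obtain v where v: "v \<in> V" "v \<noteq> 0" "weight_hom \<alpha> v" by blast
  have "hw r C v" unfolding hw_def
  proof (intro allI impI, rule ccontr)
    fix i k assume ik: "i < k" "k < r" "rowpol C i k v \<noteq> 0"
    obtain \<beta> where \<beta>: "weight_hom \<beta> (rowpol C i k v)" using hom_rowpol_ex v by blast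
    obtain m where m: "m \<in> keys (rowpol C i k v)" using ik by (metis equals0I keys_eq_empty)
    have eq: "\<beta> + single k 1 = \<alpha> + single i 1" using hom_rowpol[OF v(3) m] \<beta> m by (auto simp: weight_hom_def)
    have ext: "\<Phi> (\<gamma> + single l 1) = \<Phi> \<gamma> + (r - l)" if "l < r" for \<gamma> l
    proof -
      have "\<Phi> (\<gamma> + single l 1) = (\<Sum>i<r. lookup \<gamma> i * (r - i) + (if i = l then r - l else 0))"
        unfolding \<Phi>_def by (intro sum.cong refl) (auto simp: lookup_add lookup_single when_def)
      then show ?thesis using that by (simp add: sum.distrib \<Phi>_def)
    qed
    have "\<Phi> \<beta> + (r - k) = \<Phi> \<alpha> + (r - i)" using ext[of k \<beta>] ext[of i \<alpha>] eq ik by simp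
    moreover have "\<beta> \<in> ?A" using \<beta> ik v V by (auto simp: gl_stable_def intro!: bexI[of _ "rowpol C i k v"])
    ultimately show False using \<alpha>(2)[of \<beta>] ik by linarith
  qed
  then show ?thesis using that v by blast
qed

section \<open>Modules generated from a highest weight vector by lowering\<close>

inductive_set lowered :: "nat \<Rightarrow> nat \<Rightarrow> mpoly \<Rightarrow> mpoly set" for r C v where
  base: "v \<in> lowered r C v"
| lower: "x \<in> lowered r C v \<Longrightarrow> k < i \<Longrightarrow> i < r \<Longrightarrow> rowpol C i k x \<in> lowered r C v"

definition gl_span :: "nat \<Rightarrow> nat \<Rightarrow> mpoly \<Rightarrow> mpoly set" where
  "gl_span r C v = mp.span (lowered r C v)"

lemma gl_span_lower: "x \<in> gl_span r C v \<Longrightarrow> k < i \<Longrightarrow> i < r \<Longrightarrow> rowpol C i k x \<in> gl_span r C v"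
  unfolding gl_span_def
proof (induction rule: mp.span_induct_alt)
  case (step c x y)
  then show ?case by (auto intro!: mp.span_add mp.span_scale intro: mp.span_base lowered.lower)
qed (simp add: mp.span_zero)

lemma gl_span_subset:
  assumes "gl_stable r C V" "v \<in> V" shows "gl_span r C v \<subseteq> V"
proof -
  have "x \<in> V" if "x \<in> lowered r C v" for x
    using that by induction (use assms in \<open>auto simp: gl_stable_def\<close>)
  then show ?thesis unfolding gl_span_def using assms
    by (intro mp.span_minimal) (auto simp: gl_stable_def)
qed

context
  fixes r C v \<alpha>
  assumes v: "hw r C v" "weight_hom \<alpha> v" "v \<in> polys_on (box {..<r} {..<C})"
begin

lemma gl_span_finite: "gl_span r C v \<subseteq> polys_on (dbox {..<r} {..<C} (\<Sum>i<r. lookup \<alpha> i))"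
proof (rule gl_span_subset[OF gl_stable_dbox])
  show "v \<in> polys_on (dbox {..<r} {..<C} (\<Sum>i<r. lookup \<alpha> i))"
    unfolding polys_on_def dbox_def
  proof safe
    fix m assume m: "m \<in> keys v"
    then show bm: "m \<in> box {..<r} {..<C}" using v by (auto simp: polys_on_def)
    have "tdeg m = (\<Sum>i<r. \<Sum>j<C. lookup m (i, j))"
      using bm by (subst tdeg_superset[of "{..<r} \<times> {..<C}"]) (auto simp: box_def sum.cartesian_product)
    also have "\<dots> = (\<Sum>i<r. lookup (md fst m) i)"
      using bm by (intro sum.cong refl lookup_md_fst[symmetric]) (auto simp: box_def)
    finally show "tdeg m \<le> (\<Sum>i<r. lookup \<alpha> i)" using v m by (simp add: weight_hom_def)
  qed
qed

text \<open>Although \<open>gl_span\<close> is built from lowering operators alone, it is closed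
  under all of them: an operator is commuted past the last lowering, and the commutator terms are
  single operators applied to a shorter word, covered by an induction over all indices at once. On
  \<open>v\<close> itself raising gives 0 and diagonal operators give scalars.\<close>

lemma gl_stable_gl_span: "gl_stable r C (gl_span r C v)"
  unfolding gl_stable_def
proof (intro conjI allI impI ballI)
  show "mp.subspace (gl_span r C v)" by (simp add: gl_span_def)
  have W: "\<forall>i<r. \<forall>k<r. rowpol C i k x \<in> gl_span r C v" if "x \<in> lowered r C v" for x
    using that
  proof induction
    case base
    show ?case
    proof (intro allI impI)
      fix i k assume ik: "i < r" "k < r"
      have vT: "v \<in> gl_span r C v" unfolding gl_span_def by (rule mp.span_base) (rule lowered.base)
      have vb: "v \<in> polys_on (box UNIV {..<C})" using v(3) by (auto simp: polys_on_def box_def)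
      consider "k < i" | "i < k" | "i = k" by linarith
      then show "rowpol C i k v \<in> gl_span r C v"
      proof cases
        case 1
        then show ?thesis using gl_span_lower vT ik by blast
      next
        case 2
        then show ?thesis using v(1) ik by (simp add: hw_def gl_span_def mp.span_zero)
      next
        case 3
        then show ?thesis using rowpol_diag[OF v(2) vb] vT by (simp add: gl_span_def mp.span_scale)
      qed
    qed
  next
    case (lower y m l)
    show ?case
    proof (intro allI impI)
      fix i k assume ik: "i < r" "k < r"
      have "rowpol C l m (rowpol C i k y) \<in> gl_span r C v" using lower ik gl_span_lower by blast
      moreover have "(if k = l then rowpol C i m y else 0) \<in> gl_span r C v"
        "(if m = i then rowpol C l k y else 0) \<in> gl_span r C v"
        using lower ik by (auto simp: gl_span_def mp.span_zero)
      ultimately show "rowpol C i k (rowpol C l m y) \<in> gl_span r C v"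
        unfolding rowpol_commutator[of C i k l m] gl_span_def by (intro mp.span_add mp.span_diff)
    qed
  qed
  show "rowpol C i k x \<in> gl_span r C v" if "i < r" "k < r" "x \<in> gl_span r C v" for i k x
    using that(3) unfolding gl_span_def
  proof (induction rule: mp.span_induct_alt)
    case (step c x y)
    then show ?case using W that by (auto intro!: mp.span_add mp.span_scale simp: gl_span_def)
  qed (simp add: mp.span_zero)
  have "\<exists>\<beta>. weight_hom \<beta> x" if "x \<in> lowered r C v" for x
    using that by induction (use v(2) hom_rowpol_ex in blast)+
  then have Wh: "wpart \<beta> x \<in> gl_span r C v" if "x \<in> lowered r C v" for x \<beta>
    using that wpart_hom mp.span_base mp.span_zero unfolding gl_span_def by metis
  show "wpart \<beta> x \<in> gl_span r C v" if "x \<in> gl_span r C v" for \<beta> x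
    using that unfolding gl_span_def
  proof (induction rule: mp.span_induct_alt)
    case (step c x y)
    then show ?case using Wh by (auto intro!: mp.span_add mp.span_scale simp: gl_span_def)
  qed (simp add: mp.span_zero)
qed

text \<open>Highest weight vectors are orthogonal to the images of all lowering operators.\<close>

lemma gl_span_hw:
  assumes x: "x \<in> gl_span r C v" "hw r C x"
  shows "\<exists>c. x = c *\<^sub>p v"
proof -
  define Z where "Z = {y. \<forall>h. hw r C h \<longrightarrow> ip h y = 0}"
  have Z_add: "y \<in> Z \<Longrightarrow> z \<in> Z \<Longrightarrow> y + z \<in> Z" and Z_smul: "y \<in> Z \<Longrightarrow> c *\<^sub>p y \<in> Z" for y z c
    by (auto simp: Z_def)
  have lowZ: "rowpol C i k y \<in> Z" if "k < i" "i < r" for i k y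
    unfolding Z_def
  proof safe
    fix h assume "hw r C h"
    then have "rowpol C k i h = 0" using that by (auto simp: hw_def)
    then show "ip h (rowpol C i k y) = 0" by (metis ip_rowpol ip_zero_left)
  qed
  have W: "\<exists>c. \<exists>y\<in>Z. x = c *\<^sub>p v + y" if "x \<in> lowered r C v" for x
    using that
  proof cases
    case base
    then show ?thesis by (intro exI[of _ 1] bexI[of _ 0]) (auto simp: Z_def)
  next
    case (lower y k i)
    then show ?thesis using lowZ by (intro exI[of _ 0] bexI[of _ x]) auto
  qed
  have "\<exists>c. \<exists>y\<in>Z. x = c *\<^sub>p v + y"
    using x(1) unfolding gl_span_def
  proof (induction rule: mp.span_induct_alt)
    case base
    show ?case by (intro exI[of _ 0] bexI[of _ 0]) (auto simp: Z_def)
  next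
    case (step c x z)
    obtain d y where d: "y \<in> Z" "x = d *\<^sub>p v + y" using W[OF step(1)] by blast
    obtain d' y' where d': "y' \<in> Z" "z = d' *\<^sub>p v + y'" using step(2) by blast
    have "c *\<^sub>p x + z = (c * d + d') *\<^sub>p v + (c *\<^sub>p y + y')"
      unfolding d d' by (simp add: mp.scale_right_distrib mp.scale_left_distrib)
    then show ?case using Z_add[OF Z_smul[OF d(1)] d'(1)] by blast
  qed
  then obtain c y where c: "y \<in> Z" "x = c *\<^sub>p v + y" by blast
  then have y: "y = x - c *\<^sub>p v" by simp
  \<comment> \<open>The remainder is a highest weight vector and orthogonal to every highest weight
    vector, hence to itself.\<close>
  have "hw r C y" unfolding y using x(2) v(1) by (auto simp: hw_def)
  then have "ip y y = 0" using c(1) by (auto simp: Z_def)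
  then show ?thesis using c(2) by auto
qed

text \<open>A nonzero stable subspace contains a nonzero highest weight vector, which by
  \<open>gl_span_hw\<close> is a multiple of \<open>v\<close>.\<close>

lemma gl_span_irreducible:
  assumes "gl_stable r C V" "V \<subseteq> gl_span r C v" "V \<noteq> {0}"
  shows "v \<in> V"
proof -
  have VS: "V \<subseteq> polys_on (dbox {..<r} {..<C} (\<Sum>i<r. lookup \<alpha> i))" using assms gl_span_finite by blast
  then have "V \<subseteq> polys_on (box {..<r} UNIV)" by (force simp: polys_on_def dbox_def box_def)
  then obtain x \<beta> where x: "x \<in> V" "x \<noteq> 0" "hw r C x"
    using hw_exists[OF assms(1) VS _ assms(3)] finite_dbox by (metis finite_lessThan)
  then obtain c where c: "x = c *\<^sub>p v" using gl_span_hw assms(2) by blast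
  then have "c \<noteq> 0" using x by auto
  then have "v = (1 / c) *\<^sub>p x" using c by simp
  then show ?thesis using x assms(1) by (simp add: gl_stable_def mp.subspace_scale)
qed

end

definition orth :: "mpoly set \<Rightarrow> mpoly set \<Rightarrow> mpoly set" where
  "orth V A = {f\<in>V. \<forall>g\<in>A. ip f g = 0}"

lemma gl_stable_orth:
  assumes V: "gl_stable r C V" and A: "gl_stable r C A"
  shows "gl_stable r C (orth V A)"
  unfolding gl_stable_def
proof (intro conjI allI impI ballI)
  show "mp.subspace (orth V A)"
    using V by (auto simp: orth_def gl_stable_def mp.subspace_def)
  show "rowpol C i k f \<in> orth V A" if "i < r" "k < r" "f \<in> orth V A" for i k f
    using that V A by (auto simp: orth_def gl_stable_def ip_rowpol)
  show "wpart \<alpha> f \<in> orth V A" if "f \<in> orth V A" for \<alpha> f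
    using that V A by (auto simp: orth_def gl_stable_def ip_wpart)
qed

section \<open>Spaces of column highest weight vectors\<close>

lemma prod_X: "finite I \<Longrightarrow> (\<Prod>i\<in>I. X (a i)) = single (\<Sum>i\<in>I. single (a i) 1) 1"
  by (induction I rule: finite_induct) (simp_all add: X_def mult_single)

lemma pol_one [simp]: "pol S u w 1 = 0"
  using pol_mult[of S u w 1 1] by simp

lemma pol_prod: "finite I \<Longrightarrow>
  pol S u w (\<Prod>i\<in>I. f i) = (\<Sum>i\<in>I. pol S u w (f i) * (\<Prod>k\<in>I - {i}. f k))"
proof (induction I rule: finite_induct)
  case (insert x I)
  have "(\<Sum>i\<in>I. pol S u w (f i) * (\<Prod>k\<in>insert x I - {i}. f k))
      = f x * (\<Sum>i\<in>I. pol S u w (f i) * (\<Prod>k\<in>I - {i}. f k))"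
    unfolding sum_distrib_left
  proof (intro sum.cong refl)
    fix i assume "i \<in> I"
    then have "insert x I - {i} = insert x (I - {i})" using insert by auto
    then show "pol S u w (f i) * (\<Prod>k\<in>insert x I - {i}. f k)
      = f x * (pol S u w (f i) * (\<Prod>k\<in>I - {i}. f k))"
      using insert by (simp add: ac_simps)
  qed
  moreover have "insert x I - {x} = I" using insert by auto
  ultimately show ?case using insert by (simp add: pol_mult)
qed simp

lemma pd_X: "pd a (X b) = (if a = b then 1 else 0)"
  using pd_X_mult[of a b 1] pd_one[of a 1] by simp

lemma colpol_X: "colpol r j k (X (i, c)) = (if c = k \<and> i < r then X (i, j) else 0)"
proof -
  have "colpol r j k (X (i, c)) = (\<Sum>s<r. if s = i then (if c = k then X (i, j) else 0) else 0)"
    unfolding colpol_def pol_def xd_def pd_X by (intro sum.cong refl) auto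
  then show ?thesis by auto
qed

section \<open>Minors of X in consecutive columns, and their leading monomials\<close>

definition minor :: "nat \<Rightarrow> nat \<Rightarrow> (nat \<Rightarrow> nat) \<Rightarrow> mpoly" where
  "minor b l t = (\<Sum>\<sigma> | \<sigma> permutes {..<l}. of_int (sign \<sigma>) *\<^sub>p (\<Prod>i<l. X (t i, b + \<sigma> i)))"

lemma colpol_prod_X:
  assumes "\<sigma> permutes {..<l}" "\<And>i. i < l \<Longrightarrow> t i < r" "j \<noteq> k"
  shows "colpol r (b + j) (b + k) (\<Prod>i<l. X (t i, b + \<sigma> i)) =
    (if k < l then (\<Prod>i<l. X (t i, b + (if \<sigma> i = k then j else \<sigma> i))) else 0)"
proof -
  have "colpol r (b + j) (b + k) (\<Prod>i<l. X (t i, b + \<sigma> i)) =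
      (\<Sum>i<l. if \<sigma> i = k then X (t i, b + j) * (\<Prod>q\<in>{..<l} - {i}. X (t q, b + \<sigma> q)) else 0)"
    unfolding colpol_def by (subst pol_prod) (use assms in \<open>auto simp: colpol_X[unfolded colpol_def] intro!: sum.cong\<close>)
  also have "\<dots> = (if k < l then (\<Prod>i<l. X (t i, b + (if \<sigma> i = k then j else \<sigma> i))) else 0)"
  proof (cases "k < l")
    case True
    define q where "q = inv_into UNIV \<sigma> k"
    have eq: "\<sigma> i = k \<longleftrightarrow> i = q" for i
      using permutes_inverses[OF assms(1)] by (auto simp: q_def)
    have q: "q < l" unfolding q_def using True permutes_in_image[OF permutes_inv[OF assms(1)], of k] by simp
    have "(\<Prod>i<l. X (t i, b + (if \<sigma> i = k then j else \<sigma> i))) =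
        X (t q, b + j) * (\<Prod>i\<in>{..<l} - {q}. X (t i, b + (if \<sigma> i = k then j else \<sigma> i)))"
      using q eq by (subst prod.remove[of _ q]) auto
    also have "(\<Prod>i\<in>{..<l} - {q}. X (t i, b + (if \<sigma> i = k then j else \<sigma> i))) = (\<Prod>i\<in>{..<l} - {q}. X (t i, b + \<sigma> i))"
      using eq by (intro prod.cong) auto
    finally show ?thesis using True q by (simp add: eq)
  next
    case False
    have "\<sigma> i \<noteq> k" if "i < l" for i
      using permutes_in_image[OF assms(1), of i] that False by auto
    then show ?thesis using False by (simp add: sum.neutral)
  qed
  finally show ?thesis .
qed

text \<open>Replacing column b + j + 1 by column b + j produces a determinant with two equal
  columns: composing the permutations with a transposition gives s = -s. If column b + j + 1 lies
  outside the minor, there is nothing to differentiate.\<close>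

lemma colpol_minor:
  assumes "\<And>i. i < l \<Longrightarrow> t i < r"
  shows "colpol r (b + j) (b + Suc j) (minor b l t) = 0"
proof (cases "Suc j < l")
  case False
  have "colpol r (b + j) (b + Suc j) (minor b l t) =
    (\<Sum>\<sigma> | \<sigma> permutes {..<l}. of_int (sign \<sigma>) *\<^sub>p colpol r (b + j) (b + Suc j) (\<Prod>i<l. X (t i, b + \<sigma> i)))"
    unfolding minor_def colpol_def pol_sum by simp
  also have "\<dots> = 0"
    by (intro sum.neutral ballI) (use False assms colpol_prod_X[of _ l t r j "Suc j" b] in auto)
  finally show ?thesis .
next
  case True
  define g where "g = (\<lambda>\<sigma>. (\<Prod>i<l. X (t i, b + (if \<sigma> i = Suc j then j else \<sigma> i))))"
  define s where "s = (\<Sum>\<sigma> | \<sigma> permutes {..<l}. of_int (sign \<sigma>) *\<^sub>p g \<sigma>)"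
  have "colpol r (b + j) (b + Suc j) (minor b l t) =
    (\<Sum>\<sigma> | \<sigma> permutes {..<l}. of_int (sign \<sigma>) *\<^sub>p colpol r (b + j) (b + Suc j) (\<Prod>i<l. X (t i, b + \<sigma> i)))"
    unfolding minor_def colpol_def pol_sum by simp
  also have "\<dots> = s" unfolding s_def g_def
    by (intro sum.cong refl) (use True assms colpol_prod_X[of _ l t r j "Suc j" b] in auto)
  finally have Rs: "colpol r (b + j) (b + Suc j) (minor b l t) = s" .
  let ?\<tau> = "transpose j (Suc j)"
  have \<tau>: "?\<tau> permutes {..<l}" using True by (intro permutes_swap_id) auto
  have "s = (\<Sum>\<sigma> | \<sigma> permutes {..<l}. of_int (sign (?\<tau> \<circ> \<sigma>)) *\<^sub>p g (?\<tau> \<circ> \<sigma>))"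
    unfolding s_def by (rule setum_permutations_compose_left[OF \<tau>])
  also have "\<dots> = (\<Sum>\<sigma> | \<sigma> permutes {..<l}. (-1) *\<^sub>p (of_int (sign \<sigma>) *\<^sub>p g \<sigma>))"
  proof (intro sum.cong refl)
    fix \<sigma> assume "\<sigma> \<in> {\<sigma>. \<sigma> permutes {..<l}}"
    then have "permutation \<sigma>" by (auto intro: permutation_permutes[THEN iffD2])
    then have "sign (?\<tau> \<circ> \<sigma>) = - sign \<sigma>"
      by (simp add: sign_compose permutation_swap_id sign_swap_id)
    moreover have "g (?\<tau> \<circ> \<sigma>) = g \<sigma>" unfolding g_def
      by (intro prod.cong refl) (auto simp: transpose_def)
    ultimately show "of_int (sign (?\<tau> \<circ> \<sigma>)) *\<^sub>p g (?\<tau> \<circ> \<sigma>) = (-1) *\<^sub>p (of_int (sign \<sigma>) *\<^sub>p g \<sigma>)"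
      by simp
  qed
  also have "\<dots> = (-1) *\<^sub>p s" unfolding s_def mp.scale_sum_right ..
  finally have eq: "s = (-1) *\<^sub>p s" .
  have "lookup s m = 0" for m
    using arg_cong[OF eq, of "\<lambda>x. lookup x m"] by simp
  then have "s = 0" by (intro poly_mapping_eqI) simp
  then show ?thesis using Rs by simp
qed

abbreviation mmon :: "nat \<Rightarrow> nat \<Rightarrow> (nat \<Rightarrow> nat) \<Rightarrow> (nat \<Rightarrow> nat) \<Rightarrow> monom" where
  "mmon b l t \<sigma> \<equiv> (\<Sum>i<l. single (t i, b + \<sigma> i) 1)"

lemma keys_minor: "keys (minor b l t) \<subseteq> mmon b l t ` {\<sigma>. \<sigma> permutes {..<l}}"
proof
  fix m assume "m \<in> keys (minor b l t)"
  then have "m \<in> (\<Union>\<sigma>\<in>{\<sigma>. \<sigma> permutes {..<l}}. keys (of_int (sign \<sigma>) *\<^sub>p (\<Prod>i<l. X (t i, b + \<sigma> i))))"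
    unfolding minor_def by (rule subsetD[OF keys_sum])
  then obtain \<sigma> where "\<sigma> permutes {..<l}" "m \<in> keys (of_int (sign \<sigma>) *\<^sub>p (\<Prod>i<l. X (t i, b + \<sigma> i)))"
    by blast
  then show "m \<in> mmon b l t ` {\<sigma>. \<sigma> permutes {..<l}}"
    by (auto simp: prod_X in_keys_iff lookup_single when_def split: if_splits)
qed

text \<open>Let i be the largest index moved by \<sigma>; everything above i is fixed, so \<sigma> i
  < i. At position (t i, b + i) the diagonal monomial has exponent 1 and the other one 0, while all
  larger positions agree because the order compares large rows first.\<close>

lemma mmon_less:
  assumes \<sigma>: "\<sigma> permutes {..<l}" "\<sigma> \<noteq> id" and t: "strict_mono_on {..<l} t"
  shows "mless (mmon b l t \<sigma>) (mmon b l t id)"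
proof -
  let ?S = "{i. i < l \<and> \<sigma> i \<noteq> i}"
  have "?S \<noteq> {}"
  proof
    assume "?S = {}"
    then have "\<sigma> i = i" for i using permutes_not_in[OF \<sigma>(1), of i] by auto
    then show False using \<sigma>(2) by auto
  qed
  define i where "i = Max ?S"
  have "i \<in> ?S" unfolding i_def using \<open>?S \<noteq> {}\<close> by (intro Max_in) auto
  then have i: "i < l" "\<sigma> i \<noteq> i" by auto
  have above: "\<sigma> q = q" if "q > i" "q < l" for q
  proof (rule ccontr)
    assume "\<sigma> q \<noteq> q"
    then have "q \<le> i" unfolding i_def using that by (intro Max_ge) auto
    then show False using that by simp
  qed
  have "\<sigma> i < l" using permutes_in_image[OF \<sigma>(1), of i] i by simp
  have lt: "\<sigma> i < i"
  proof (rule ccontr)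
    assume "\<not> \<sigma> i < i"
    then have "\<sigma> (\<sigma> i) = \<sigma> i" using above \<open>\<sigma> i < l\<close> i by simp
    then show False using permutes_inj[OF \<sigma>(1)] i(2) by (simp add: inj_eq)
  qed
  have mono: "t q < t q' \<longleftrightarrow> q < q'" "t q = t q' \<longleftrightarrow> q = q'" if "q < l" "q' < l" for q q'
    using that strict_mono_on_less[OF t, of q q'] strict_mono_on_eqD[OF t, of q q'] by auto
  have look: "lookup (mmon b l t \<rho>) (x, y) = (\<Sum>q<l. if t q = x \<and> b + \<rho> q = y then 1 else 0)" for \<rho> x y
    by (auto simp: lookup_sum lookup_single when_def intro!: sum.cong)
  let ?k = "(t i, b + i)"
  have "lookup (mmon b l t \<sigma>) ?k = 0"
    unfolding look using i mono by (intro sum.neutral ballI) auto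
  moreover have "lookup (mmon b l t id) ?k = 1"
  proof -
    have "lookup (mmon b l t id) ?k = (\<Sum>q<l. if q = i then 1 else 0)"
      unfolding look using i mono by (intro sum.cong) auto
    then show ?thesis using i by simp
  qed
  moreover have "lookup (mmon b l t \<sigma>) k' = lookup (mmon b l t id) k'" if "k' > ?k" for k'
  proof -
    obtain x y where k': "k' = (x, y)" by (cases k')
    have xy: "x > t i \<or> x = t i \<and> y > b + i" using that k' by auto
    have "(t q = x \<and> b + \<sigma> q = y) = (t q = x \<and> b + id q = y)" if "q < l" for q
    proof (cases "t q = x")
      case True
      then have "q > i \<or> q = i \<and> y > b + i" using xy mono[OF i(1) \<open>q < l\<close>] by auto
      then show ?thesis using above[OF _ \<open>q < l\<close>] lt by auto
    qed simp
    then show ?thesis unfolding k' look by (intro sum.cong) auto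
  qed
  ultimately show ?thesis unfolding mless_def by (intro exI[of _ ?k]) auto
qed

lemma lm_minor:
  assumes t: "strict_mono_on {..<l} t"
  shows "lm (minor b l t) (\<Sum>i<l. single (t i, b + i) 1)"
proof -
  let ?m = "mmon b l t id"
  have id: "id \<in> {\<sigma>. \<sigma> permutes {..<l}}" by (simp add: permutes_id)
  have fin: "finite {\<sigma>. \<sigma> permutes {..<l}}" by (rule finite_permutations) simp
  have "lookup (minor b l t) ?m = (\<Sum>\<sigma> | \<sigma> permutes {..<l}. if \<sigma> = id then 1 else 0)"
    unfolding minor_def lookup_sum
  proof (rule sum.cong)
    fix \<sigma> assume "\<sigma> \<in> {\<sigma>. \<sigma> permutes {..<l}}"
    then have "\<sigma> \<noteq> id \<Longrightarrow> mless (mmon b l t \<sigma>) ?m" by (intro mmon_less t) auto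
    then have "\<sigma> \<noteq> id \<Longrightarrow> mmon b l t \<sigma> \<noteq> ?m" using mless_irrefl[of ?m] by metis
    then show "lookup (of_int (sign \<sigma>) *\<^sub>p (\<Prod>i<l. X (t i, b + \<sigma> i))) ?m = (if \<sigma> = id then 1 else 0)"
      by (auto simp: prod_X lookup_single when_def sign_id)
  qed simp
  also have "\<dots> = 1" using id fin by simp
  finally have "?m \<in> keys (minor b l t)" by (simp add: in_keys_iff)
  moreover have "mless m ?m" if m: "m \<in> keys (minor b l t)" "m \<noteq> ?m" for m
  proof -
    obtain \<sigma> where \<sigma>: "m = mmon b l t \<sigma>" "\<sigma> permutes {..<l}"
      using subsetD[OF keys_minor m(1)] by blast
    then have "\<sigma> \<noteq> id" using m(2) by metis
    then show ?thesis unfolding \<sigma>(1) by (intro mmon_less \<sigma>(2) t)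
  qed
  ultimately show ?thesis unfolding lm_def by simp
qed

lemma keys_minor_props:
  assumes m: "m \<in> keys (minor b l t)" and t: "\<And>i. i < l \<Longrightarrow> t i < r"
  shows "m \<in> box {..<r} {b..<b + l}" "md snd m = (\<Sum>i<l. single (b + i) 1)"
proof -
  obtain \<sigma> where \<sigma>: "\<sigma> permutes {..<l}" "m = mmon b l t \<sigma>" using keys_minor m by blast
  have s: "\<sigma> i < l" if "i < l" for i using permutes_in_image[OF \<sigma>(1), of i] that by simp
  have "keys m \<subseteq> (\<Union>i<l. keys (single (t i, b + \<sigma> i) (1::nat)))" unfolding \<sigma> by (rule keys_sum)
  then show "m \<in> box {..<r} {b..<b + l}" unfolding box_def using s t by fastforce
  have "md snd m = (\<Sum>i<l. single (b + \<sigma> i) 1)" unfolding \<sigma> md_sum by simp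
  also have "\<dots> = (\<Sum>i<l. single (b + i) 1)"
    using sum.permute[OF \<sigma>(1), of "\<lambda>i. single (b + i) (1::nat)"] by (simp add: comp_def)
  finally show "md snd m = (\<Sum>i<l. single (b + i) 1)" .
qed

text \<open>For a partition \<mu> with at most r parts this is a model of the irreducible module of
  highest weight \<mu> for the row polarizations (\<open>right_hw_irreducible\<close>), which act on
  it because they commute with column polarizations. The offset \<open>b\<close> keeps it in columns
  disjoint from those of another module.\<close>

definition right_hw :: "nat \<Rightarrow> nat \<Rightarrow> nat list \<Rightarrow> mpoly set" where
  "right_hw r b \<mu> = {f \<in> polys_on (box {..<r} {b..<b + length \<mu>}).
     (\<forall>j. Suc j < length \<mu> \<longrightarrow> colpol r (b + j) (b + Suc j) f = 0) \<and>
     (\<forall>m\<in>keys f. \<forall>j<length \<mu>. lookup (md snd m) (b + j) = \<mu> ! j)}"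

lemma colpol_linear [simp]:
  "colpol r j k (f + g) = colpol r j k f + colpol r j k g" "colpol r j k (c *\<^sub>p f) = c *\<^sub>p colpol r j k f" "colpol r j k 0 = 0"
  by (simp_all add: colpol_def)

lemma right_hw_subspace: "mp.subspace (right_hw r b \<mu>)"
proof (rule mp.subspaceI)
  fix f g assume fg: "f \<in> right_hw r b \<mu>" "g \<in> right_hw r b \<mu>"
  have "keys (f + g) \<subseteq> keys f \<union> keys g" by (rule Poly_Mapping.keys_add)
  then show "f + g \<in> right_hw r b \<mu>" using fg unfolding right_hw_def polys_on_def by auto
next
  fix c f assume f: "f \<in> right_hw r b \<mu>"
  have "keys (c *\<^sub>p f) \<subseteq> keys f" by (auto simp: in_keys_iff)
  then show "c *\<^sub>p f \<in> right_hw r b \<mu>" using f unfolding right_hw_def polys_on_def by auto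
qed (auto simp: right_hw_def polys_on_def)

lemma right_hw_stable:
  assumes C: "b + length \<mu> \<le> C" shows "gl_stable r C (right_hw r b \<mu>)"
  unfolding gl_stable_def
proof (intro conjI allI impI ballI)
  show "mp.subspace (right_hw r b \<mu>)" by (rule right_hw_subspace)
  fix i k f assume ik: "i < r" "k < r" and f: "f \<in> right_hw r b \<mu>"
  have "m \<in> box {..<r} {b..<b + length \<mu>} \<and> (\<forall>j<length \<mu>. lookup (md snd m) (b + j) = \<mu> ! j)"
    if m: "m \<in> keys (rowpol C i k f)" for m
  proof -
    obtain j m' where j: "m' \<in> keys f" "m + single (k, j) 1 = m' + single (i, j) 1" "lookup m' (k, j) > 0"
      using keys_rowpol[OF m] by metis
    have m'b: "m' \<in> box {..<r} {b..<b + length \<mu>}" using f j(1) by (auto simp: right_hw_def polys_on_def)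
    have "(k, j) \<in> keys m'" using j(3) by (simp add: in_keys_iff)
    then have "j \<in> {b..<b + length \<mu>}" using m'b unfolding box_def by blast
    then have "m \<in> box {..<r} {b..<b + length \<mu>}" using box_move[OF m'b j(2)] ik by simp
    moreover have "md snd m = md snd m'"
      using arg_cong[OF j(2), of "md snd"] by (simp add: md_add)
    ultimately show ?thesis using f j(1) by (simp add: right_hw_def)
  qed
  moreover have "colpol r (b + j) (b + Suc j) (rowpol C i k f) = 0" if "Suc j < length \<mu>" for j
  proof -
    have "colpol r (b + j) (b + Suc j) (rowpol C i k f) = rowpol C i k (colpol r (b + j) (b + Suc j) f)"
      using that C ik by (intro rowpol_colpol_commute[symmetric]) auto
    then show ?thesis using f that by (simp add: right_hw_def)
  qed
  ultimately show "rowpol C i k f \<in> right_hw r b \<mu>" unfolding right_hw_def polys_on_def by blast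
next
  fix \<alpha> f assume f: "f \<in> right_hw r b \<mu>"
  have "colpol r (b + j) (b + Suc j) (wpart \<alpha> f) = wpart \<alpha> (colpol r (b + j) (b + Suc j) f)" for j
    unfolding colpol_def wpart_def
  proof (rule rest_pol[symmetric])
    fix m m' :: monom and s :: nat
    assume "m + single (s, b + Suc j) 1 = m' + single (s, b + j) 1"
    from arg_cong[OF this, of "md fst"] show "(md fst m = \<alpha>) = (md fst m' = \<alpha>)"
      by (simp add: md_add)
  qed
  then show "wpart \<alpha> f \<in> right_hw r b \<mu>" using f unfolding right_hw_def polys_on_def by (auto simp: wpart_def)
qed

text \<open>The last condition is the ballot inequality for adjacent columns. Read through
  \<open>tmon\<close>, with column b + j encoding row j of a tableau, it says that entries increase
  strictly down the columns of the tableau.\<close>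

definition Adm :: "nat \<Rightarrow> nat \<Rightarrow> nat list \<Rightarrow> (nat \<Rightarrow>\<^sub>0 nat) \<Rightarrow> monom set" where
  "Adm r b \<mu> \<alpha> = {m \<in> box {..<r} {b..<b + length \<mu>}. md fst m = \<alpha> \<and>
     (\<forall>j<length \<mu>. lookup (md snd m) (b + j) = \<mu> ! j) \<and>
     (\<forall>j s. Suc j < length \<mu> \<longrightarrow> s < r \<longrightarrow>
        (\<Sum>t\<le>s. lookup m (t, b + Suc j)) \<le> (\<Sum>t<s. lookup m (t, b + j)))}"

lemma md_snd_box: "m \<in> box {..<r} J \<Longrightarrow> lookup (md snd m) j = (\<Sum>i<r. lookup m (i, j))"
  by (intro lookup_md_snd) (auto simp: box_def)

lemma right_hw_lead:
  assumes f: "f \<in> right_hw r b \<mu>" "lm f m" "weight_hom \<alpha> f"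
  shows "m \<in> Adm r b \<mu> \<alpha>"
proof -
  have mf: "m \<in> keys f" using f(2) by (simp add: lm_def)
  have "(\<Sum>t\<le>s. lookup m (t, b + Suc j)) \<le> (\<Sum>t<s. lookup m (t, b + j))"
    if j: "Suc j < length \<mu>" and s: "s < r" for j s
  proof -
    interpret sl2_sites r "\<lambda>s. (s, b + j)" "\<lambda>s. (s, b + Suc j)"
      by standard (auto simp: inj_on_def)
    show ?thesis
    proof (rule lead_ballot[OF _ f(2) _ s])
      show "pol {..<r} (\<lambda>s. (s, b + j)) (\<lambda>s. (s, b + Suc j)) f = 0"
        using f(1) j by (simp add: right_hw_def colpol_def)
      fix m' assume m': "m' \<in> keys f"
      have "(\<Sum>t<r. lookup q (t, b + Suc j)) = \<mu> ! Suc j" if "q \<in> keys f" for q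
      proof -
        have "q \<in> box {..<r} {b..<b + length \<mu>}" "lookup (md snd q) (b + Suc j) = \<mu> ! Suc j"
          using f(1) that j unfolding right_hw_def polys_on_def by blast+
        then show ?thesis using md_snd_box by metis
      qed
      then show "(\<Sum>t<r. lookup m' (t, b + Suc j)) = (\<Sum>t<r. lookup m (t, b + Suc j))"
        using mf m' by simp
    qed
  qed
  then show ?thesis using f mf unfolding Adm_def right_hw_def polys_on_def weight_hom_def by blast
qed

section \<open>Semistandard tableaux\<close>

definition content :: "nat list \<Rightarrow> (nat \<times> nat \<Rightarrow> nat) \<Rightarrow> (nat \<Rightarrow>\<^sub>0 nat)" where
  "content \<mu> U = (\<Sum>b\<in>diagram \<mu>. single (U b) 1)"

definition kostka :: "nat \<Rightarrow> nat list \<Rightarrow> (nat \<Rightarrow>\<^sub>0 nat) \<Rightarrow> nat" where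
  "kostka r \<mu> \<alpha> = card {U \<in> ssyt r \<mu>. content \<mu> U = \<alpha>}"

lemma diagram_eq: "diagram \<mu> = Sigma {..<length \<mu>} (\<lambda>i. {..<\<mu> ! i})"
  by (auto simp: diagram_def)

lemma finite_diagram [simp]: "finite (diagram \<mu>)"
  by (simp add: diagram_eq)

lemma finite_ssyt [simp]: "finite (ssyt r \<mu>)"
proof -
  have "ssyt r \<mu> \<subseteq> diagram \<mu> \<rightarrow>\<^sub>E {..<r}" by (auto simp: ssyt_def)
  then show ?thesis by (rule finite_subset) (auto intro: finite_PiE)
qed

lemma lookup_schur: "lookup (schur r \<mu>) \<alpha> = int (kostka r \<mu> \<alpha>)"
proof -
  have "lookup (schur r \<mu>) \<alpha> = (\<Sum>U\<in>ssyt r \<mu>. if content \<mu> U = \<alpha> then 1 else 0)"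
    unfolding schur_def lookup_sum by (intro sum.cong) (auto simp: lookup_single content_def when_def)
  also have "\<dots> = (\<Sum>U\<in>{U \<in> ssyt r \<mu>. content \<mu> U = \<alpha>}. 1)"
    by (rule sum.inter_filter[symmetric]) simp
  finally show ?thesis by (simp add: kostka_def)
qed

lemma downclosed_iff:
  fixes N :: "nat set"
  assumes "finite N" "\<And>x y. x \<in> N \<Longrightarrow> y < x \<Longrightarrow> y \<in> N"
  shows "j \<in> N \<longleftrightarrow> j < card N"
proof
  assume "j \<in> N"
  then have "{..j} \<subseteq> N" using assms(2)[of j] le_neq_implies_less by blast
  then show "j < card N" using card_mono[OF assms(1), of "{..j}"] by simp
next
  assume j: "j < card N"
  show "j \<in> N"
  proof (rule ccontr)
    assume "j \<notin> N"
    have "N \<subseteq> {..<j}"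
    proof
      fix x assume "x \<in> N"
      then show "x \<in> {..<j}" using \<open>j \<notin> N\<close> assms(2)[of x j] by (cases x j rule: linorder_cases) auto
    qed
    then show False using card_mono[of "{..<j}" N] j by simp
  qed
qed

text \<open>Row \<open>i\<close> of a tableau is encoded in column \<open>b + i\<close>; its entries are the row indices of the variables.\<close>

definition tmon :: "nat \<Rightarrow> nat list \<Rightarrow> (nat \<times> nat \<Rightarrow> nat) \<Rightarrow> monom" where
  "tmon b \<mu> U = (\<Sum>(i, j)\<in>diagram \<mu>. single (U (i, j), b + i) 1)"

lemma lookup_tmon:
  assumes "i < length \<mu>"
  shows "lookup (tmon b \<mu> U) (t, b + i) = (\<Sum>j<\<mu> ! i. if U (i, j) = t then 1 else 0)"
proof -
  have "lookup (tmon b \<mu> U) (t, b + i) =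
      (\<Sum>i'<length \<mu>. \<Sum>j<\<mu> ! i'. if U (i', j) = t \<and> i' = i then 1 else 0)"
    unfolding tmon_def diagram_eq
    by (subst sum.Sigma[symmetric]) (auto simp: lookup_sum lookup_single when_def intro!: sum.cong)
  also have "\<dots> = (\<Sum>i'<length \<mu>. if i' = i then (\<Sum>j<\<mu> ! i. if U (i, j) = t then 1 else 0) else 0)"
    by (intro sum.cong) auto
  finally show ?thesis using assms by simp
qed

lemma lookup_tmon_outside:
  assumes "c < b \<or> c \<ge> b + length \<mu>"
  shows "lookup (tmon b \<mu> U) (t, c) = 0"
  unfolding tmon_def diagram_eq lookup_sum
  using assms by (auto simp: lookup_single when_def intro!: sum.neutral)

lemma tmon_partial_sum:
  assumes "i < length \<mu>"
  shows "(\<Sum>t'\<le>t. lookup (tmon b \<mu> U) (t', b + i)) = card {j. j < \<mu> ! i \<and> U (i, j) \<le> t}"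
proof -
  have "(\<Sum>t'\<le>t. lookup (tmon b \<mu> U) (t', b + i)) =
      (\<Sum>j<\<mu> ! i. \<Sum>t'\<le>t. if U (i, j) = t' then 1 else 0)"
    unfolding lookup_tmon[OF assms] by (rule sum.swap)
  also have "\<dots> = (\<Sum>j<\<mu> ! i. if U (i, j) \<le> t then 1 else 0)"
    by (intro sum.cong) auto
  also have "\<dots> = card {j \<in> {..<\<mu> ! i}. U (i, j) \<le> t}"
    by (subst sum.inter_filter[symmetric]) auto
  finally show ?thesis by simp
qed

lemma ssyt_rowD:
  assumes "U \<in> ssyt r \<mu>" "i < length \<mu>" "j < j'" "j' < \<mu> ! i"
  shows "U (i, j) \<le> U (i, j')"
proof -
  have "(i, j) \<in> diagram \<mu>" "(i, j') \<in> diagram \<mu>" using assms by (auto simp: diagram_def)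
  then show ?thesis using assms(1,3) unfolding ssyt_def by blast
qed

lemma ssyt_colD:
  assumes "U \<in> ssyt r \<mu>" "(i, j) \<in> diagram \<mu>" "(i', j) \<in> diagram \<mu>" "i < i'"
  shows "U (i, j) < U (i', j)"
  using assms unfolding ssyt_def by blast

text \<open>The entries at most t of a weakly increasing row form an initial segment, so a row is
  recovered from the numbers of such entries, which are partial sums of exponents of its
  monomial.\<close>

lemma ssyt_le_iff:
  assumes U: "U \<in> ssyt r \<mu>" and i: "i < length \<mu>" and j: "j < \<mu> ! i"
  shows "U (i, j) \<le> t \<longleftrightarrow> j < (\<Sum>t'\<le>t. lookup (tmon b \<mu> U) (t', b + i))"
proof -
  let ?N = "{j. j < \<mu> ! i \<and> U (i, j) \<le> t}"
  have "y \<in> ?N" if "x \<in> ?N" "y < x" for x y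
    using ssyt_rowD[OF U i, of y x] that by auto
  then have "j \<in> ?N \<longleftrightarrow> j < card ?N" by (intro downclosed_iff) auto
  then show ?thesis using j tmon_partial_sum[OF i] by simp
qed

lemma inj_tmon: "inj_on (tmon b \<mu>) (ssyt r \<mu>)"
proof (rule inj_onI)
  fix U U' assume U: "U \<in> ssyt r \<mu>" and U': "U' \<in> ssyt r \<mu>" and eq: "tmon b \<mu> U = tmon b \<mu> U'"
  show "U = U'"
  proof
    fix x
    show "U x = U' x"
    proof (cases "x \<in> diagram \<mu>")
      case True
      then obtain i j where x: "x = (i, j)" "i < length \<mu>" "j < \<mu> ! i" by (auto simp: diagram_def)
      have "U (i, j) \<le> t \<longleftrightarrow> U' (i, j) \<le> t" for t
        using ssyt_le_iff[OF U x(2,3), of t b] ssyt_le_iff[OF U' x(2,3), of t b] eq by simp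
      then show ?thesis unfolding x(1) by (metis le_antisym order_refl)
    next
      case False
      have "U \<in> diagram \<mu> \<rightarrow>\<^sub>E {..<r}" "U' \<in> diagram \<mu> \<rightarrow>\<^sub>E {..<r}" using U U' by (auto simp: ssyt_def)
      then show ?thesis using PiE_arb[OF _ False] by metis
    qed
  qed
qed

lemma Adm_surj:
  assumes m: "m \<in> Adm r b \<mu> \<alpha>" and sorted: "sorted_wrt (\<ge>) \<mu>"
  shows "\<exists>U\<in>ssyt r \<mu>. tmon b \<mu> U = m"
proof -
  define S where "S = (\<lambda>i t. \<Sum>t'\<le>t. lookup m (t', b + i))"
  \<comment> \<open>Row i is to be the sorted list of the row indices in column b + i: cell (i, j)
    receives the least t such that more than j of them are at most t. Outside the diagram the value
    is \<open>undefined\<close>, as the extensional function space demands.\<close>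
  define U where "U = (\<lambda>x. if x \<in> diagram \<mu> then (LEAST t. snd x < S (fst x) t) else undefined)"
  have mbox: "m \<in> box {..<r} {b..<b + length \<mu>}" using m by (simp add: Adm_def)
  have zero: "lookup m (t, c) = 0" if "t \<ge> r \<or> c < b \<or> c \<ge> b + length \<mu>" for t c
  proof -
    have "(t, c) \<notin> keys m" using mbox that by (auto simp: box_def)
    then show ?thesis by (simp add: in_keys_iff)
  qed
  have tot: "(\<Sum>t<r. lookup m (t, b + i)) = \<mu> ! i" if "i < length \<mu>" for i
    using md_snd_box[OF mbox, of "b + i"] m that by (simp add: Adm_def)
  have Stot: "S i t = \<mu> ! i" if "i < length \<mu>" "t + 1 \<ge> r" for i t
  proof -
    have "S i t = (\<Sum>t<r. lookup m (t, b + i))" unfolding S_def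
      using that zero by (intro sum.mono_neutral_right) auto
    then show ?thesis using tot that by simp
  qed
  have Smono: "S i t \<le> S i t'" if "t \<le> t'" for i t t'
    unfolding S_def using that by (intro sum_mono2) auto
  have Sle: "S i t \<le> \<mu> ! i" if "i < length \<mu>" for i t
    using Smono[of t "max t r" i] Stot[OF that, of "max t r"] by simp
  have U_iff: "U (i, j) \<le> t \<longleftrightarrow> j < S i t" if d: "(i, j) \<in> diagram \<mu>" for i j t
  proof -
    have "j < S i r" using Stot[of i r] d by (auto simp: diagram_def)
    then have "j < S i (LEAST t. j < S i t)" by (rule LeastI)
    moreover have "U (i, j) = (LEAST t. j < S i t)" using d by (simp add: U_def)
    ultimately show ?thesis using Smono[of "U (i, j)" t i] Least_le[of "\<lambda>t. j < S i t" t] by auto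
  qed
  have U_less: "U (i, j) < r" if d: "(i, j) \<in> diagram \<mu>" for i j
  proof -
    have ij: "i < length \<mu>" "j < \<mu> ! i" using d by (auto simp: diagram_def)
    then have "r > 0" using tot[of i] by (cases r) auto
    moreover have "U (i, j) \<le> r - 1" using U_iff[OF d] Stot[of i "r - 1"] ij by simp
    ultimately show ?thesis by simp
  qed
  have srt: "\<mu> ! i' \<le> \<mu> ! i" if "i \<le> i'" "i' < length \<mu>" for i i'
    using sorted that by (cases "i = i'") (auto simp: sorted_wrt_iff_nth_less)
  have U_Suc: "U (i, j) < U (Suc i, j)" if d: "(Suc i, j) \<in> diagram \<mu>" for i j
  proof -
    let ?t = "U (Suc i, j)"
    have ij: "Suc i < length \<mu>" "j < \<mu> ! Suc i" using d by (auto simp: diagram_def)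
    then have d': "(i, j) \<in> diagram \<mu>" using srt[of i "Suc i"] by (auto simp: diagram_def)
    have "j < S (Suc i) ?t" using U_iff[OF d] by blast
    \<comment> \<open>The ballot inequality at s = U (Suc i, j): more than j entries of row i are
      strictly smaller than that entry.\<close>
    also have "S (Suc i) ?t \<le> (\<Sum>t'<?t. lookup m (t', b + i))"
      using m ij U_less[OF d] unfolding Adm_def S_def by blast
    finally have j: "j < (\<Sum>t'<?t. lookup m (t', b + i))" .
    then obtain s where s: "?t = Suc s" by (cases ?t) auto
    then have "j < S i s" using j by (simp add: S_def lessThan_Suc_atMost)
    then show ?thesis using U_iff[OF d', of s] s by simp
  qed
  have U_col: "U (i, j) < U (Suc (i + k), j)" if "(Suc (i + k), j) \<in> diagram \<mu>" for i j k
    using that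
  proof (induction k)
    case 0
    then show ?case using U_Suc by simp
  next
    case (Suc k)
    have "(Suc (i + k), j) \<in> diagram \<mu>"
      using Suc.prems srt[of "Suc (i + k)" "Suc (i + Suc k)"] by (auto simp: diagram_def)
    then show ?case using Suc.IH U_Suc[of "Suc (i + k)" j] Suc.prems by simp
  qed
  have "U \<in> ssyt r \<mu>" unfolding ssyt_def
  proof (intro CollectI conjI allI impI)
    show "U \<in> diagram \<mu> \<rightarrow>\<^sub>E {..<r}"
    proof (rule PiE_I)
      fix x assume "x \<in> diagram \<mu>"
      then show "U x \<in> {..<r}" using U_less by (cases x) auto
    qed (simp add: U_def)
  next
    fix i j j' assume "(i, j) \<in> diagram \<mu> \<and> (i, j') \<in> diagram \<mu> \<and> j < j'"
    then show "U (i, j) \<le> U (i, j')" using U_iff[of i j "U (i, j')"] U_iff[of i j' "U (i, j')"] by auto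
  next
    fix i i' j assume "(i, j) \<in> diagram \<mu> \<and> (i', j) \<in> diagram \<mu> \<and> i < i'"
    then show "U (i, j) < U (i', j)" using U_col[of i "i' - Suc i" j] by simp
  qed
  moreover have "tmon b \<mu> U = m"
  proof (rule poly_mapping_eqI)
    fix x :: "nat \<times> nat"
    obtain t c where x: "x = (t, c)" by (cases x)
    show "lookup (tmon b \<mu> U) x = lookup m x"
    proof (cases "c < b \<or> c \<ge> b + length \<mu>")
      case True
      then show ?thesis unfolding x using zero lookup_tmon_outside by metis
    next
      case False
      define i where "i = c - b"
      have i: "i < length \<mu>" "c = b + i" using False by (auto simp: i_def)
      have ps: "(\<Sum>t'\<le>s. lookup (tmon b \<mu> U) (t', b + i)) = (\<Sum>t'\<le>s. lookup m (t', b + i))" for s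
      proof -
        have "{j. j < \<mu> ! i \<and> U (i, j) \<le> s} = {..<S i s}"
          using U_iff[of i _ s] Sle[OF i(1), of s] i by (auto simp: diagram_def)
        then show ?thesis using tmon_partial_sum[OF i(1)] by (simp add: S_def)
      qed
      show ?thesis unfolding x i(2)
      proof (cases t)
        case 0
        then show "lookup (tmon b \<mu> U) (t, b + i) = lookup m (t, b + i)" using ps[of 0] by simp
      next
        case (Suc s)
        then show "lookup (tmon b \<mu> U) (t, b + i) = lookup m (t, b + i)" using ps[of s] ps[of "Suc s"] by simp
      qed
    qed
  qed
  ultimately show ?thesis by blast
qed

section \<open>Polynomials whose leading monomials encode tableaux\<close>

definition colh :: "nat list \<Rightarrow> nat \<Rightarrow> nat" where
  "colh \<mu> c = card {i. i < length \<mu> \<and> c < \<mu> ! i}"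

definition rowl :: "nat list \<Rightarrow> nat" where
  "rowl \<mu> = (if \<mu> = [] then 0 else \<mu> ! 0)"

text \<open>One minor for each column of the tableau, with the entries of that column as row
  indices. The diagonal monomial of a minor encodes its column, so the product of the leading
  monomials encodes the whole tableau.\<close>

definition tpoly :: "nat \<Rightarrow> nat list \<Rightarrow> (nat \<times> nat \<Rightarrow> nat) \<Rightarrow> mpoly" where
  "tpoly b \<mu> U = (\<Prod>c<rowl \<mu>. minor b (colh \<mu> c) (\<lambda>i. U (i, c)))"

lemma colh_iff:
  assumes "sorted_wrt (\<ge>) \<mu>" shows "i < colh \<mu> c \<longleftrightarrow> (i, c) \<in> diagram \<mu>"
proof -
  let ?N = "{i. i < length \<mu> \<and> c < \<mu> ! i}"
  have "y \<in> ?N" if "x \<in> ?N" "y < x" for x y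
    using that assms by (force simp: sorted_wrt_iff_nth_less)
  then have "i \<in> ?N \<longleftrightarrow> i < card ?N" by (intro downclosed_iff) auto
  then show ?thesis by (simp add: colh_def diagram_def)
qed

lemma keys_prod:
  "finite I \<Longrightarrow> m \<in> keys (\<Prod>i\<in>I. f i :: mpoly) \<Longrightarrow> \<exists>g. (\<forall>i\<in>I. g i \<in> keys (f i)) \<and> m = (\<Sum>i\<in>I. g i)"
proof (induction I arbitrary: m rule: finite_induct)
  case (insert x I)
  then have "m \<in> keys (f x * (\<Prod>i\<in>I. f i))" by simp
  then obtain a c where ac: "m = a + c" "a \<in> keys (f x)" "c \<in> keys (\<Prod>i\<in>I. f i)"
    using subsetD[OF keys_mult] by blast
  obtain g where g: "\<forall>i\<in>I. g i \<in> keys (f i)" "c = (\<Sum>i\<in>I. g i)" using insert.IH[OF ac(3)] by blast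
  have "(\<Sum>i\<in>I. (g(x := a)) i) = c" unfolding g(2) using insert.hyps by (intro sum.cong) auto
  then have "m = (\<Sum>i\<in>insert x I. (g(x := a)) i)" using insert.hyps ac by simp
  then show ?case using g ac insert.hyps by (intro exI[of _ "g(x := a)"]) auto
qed auto

lemma box_sum: "(\<And>i. i \<in> I \<Longrightarrow> g i \<in> box J J') \<Longrightarrow> (\<Sum>i\<in>I. g i) \<in> box J J'"
proof -
  assume "\<And>i. i \<in> I \<Longrightarrow> g i \<in> box J J'"
  then have "(\<Union>i\<in>I. keys (g i)) \<subseteq> J \<times> J'" unfolding box_def by blast
  then show ?thesis using keys_sum[of g I] unfolding box_def by blast
qed

lemma tpoly:
  assumes U: "U \<in> ssyt r \<mu>" and sorted: "sorted_wrt (\<ge>) \<mu>"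
  shows "tpoly b \<mu> U \<in> right_hw r b \<mu>" "lm (tpoly b \<mu> U) (tmon b \<mu> U)"
proof -
  note ch = colh_iff[OF sorted]
  have Tr: "U (i, c) < r" if "i < colh \<mu> c" for i c
    using U that ch unfolding ssyt_def by (metis (no_types, lifting) CollectD PiE_mem lessThan_iff)
  have ch_le: "colh \<mu> c \<le> length \<mu>" for c
    unfolding colh_def by (rule order_trans[OF card_mono[of "{..<length \<mu>}"]]) auto
  have mono: "strict_mono_on {..<colh \<mu> c} (\<lambda>i. U (i, c))" for c
    by (rule strict_mono_onI) (use ssyt_colD[OF U] ch in auto)
  have rl: "\<mu> ! i \<le> rowl \<mu>" if "i < length \<mu>" for i
    using sorted that unfolding rowl_def by (cases "i = 0") (auto simp: sorted_wrt_iff_nth_less)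
  have "lm (tpoly b \<mu> U) (\<Sum>c<rowl \<mu>. \<Sum>i<colh \<mu> c. single (U (i, c), b + i) 1)"
    unfolding tpoly_def by (intro lm_prod lm_minor mono) auto
  also have "(\<Sum>c<rowl \<mu>. \<Sum>i<colh \<mu> c. single (U (i, c), b + i) 1) = tmon b \<mu> U"
  proof -
    have "(\<Sum>c<rowl \<mu>. \<Sum>i<colh \<mu> c. single (U (i, c), b + i) 1) =
      (\<Sum>(c, i)\<in>Sigma {..<rowl \<mu>} (\<lambda>c. {..<colh \<mu> c}). single (U (i, c), b + i) (1::nat))"
      by (rule sum.Sigma) auto
    also have "\<dots> = tmon b \<mu> U" unfolding tmon_def
    proof (rule sum.reindex_bij_witness[of _ prod.swap prod.swap])
      fix x assume "x \<in> diagram \<mu>"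
      then obtain i c where x: "x = (i, c)" "(i, c) \<in> diagram \<mu>" by (cases x) auto
      then have "c < rowl \<mu>" using rl[of i] by (auto simp: diagram_def)
      then show "prod.swap x \<in> Sigma {..<rowl \<mu>} (\<lambda>c. {..<colh \<mu> c})" using x ch by simp
    qed (use ch in auto)
    finally show ?thesis .
  qed
  finally show "lm (tpoly b \<mu> U) (tmon b \<mu> U)" .
  have "colpol r (b + j) (b + Suc j) (tpoly b \<mu> U) = 0" for j
    unfolding tpoly_def colpol_def
    by (subst pol_prod) (use colpol_minor[unfolded colpol_def] Tr in \<open>auto intro!: sum.neutral\<close>)
  moreover have "m \<in> box {..<r} {b..<b + length \<mu>} \<and> (\<forall>j<length \<mu>. lookup (md snd m) (b + j) = \<mu> ! j)"
    if m: "m \<in> keys (tpoly b \<mu> U)" for m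
  proof -
    obtain g where g: "\<And>c. c < rowl \<mu> \<Longrightarrow> g c \<in> keys (minor b (colh \<mu> c) (\<lambda>i. U (i, c)))"
      "m = (\<Sum>c<rowl \<mu>. g c)"
      using keys_prod[OF _ m[unfolded tpoly_def]] by auto
    have gp: "g c \<in> box {..<r} {b..<b + colh \<mu> c}" "md snd (g c) = (\<Sum>i<colh \<mu> c. single (b + i) 1)"
      if "c < rowl \<mu>" for c
      using keys_minor_props[OF g(1)[OF that]] Tr by auto
    have "g c \<in> box {..<r} {b..<b + length \<mu>}" if "c < rowl \<mu>" for c
      using gp(1)[OF that] ch_le[of c] unfolding box_def by fastforce
    then have 1: "m \<in> box {..<r} {b..<b + length \<mu>}" unfolding g(2) by (intro box_sum) auto
    have "lookup (md snd m) (b + j) = \<mu> ! j" if j: "j < length \<mu>" for j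
    proof -
      have "lookup (md snd m) (b + j) = (\<Sum>c<rowl \<mu>. \<Sum>i<colh \<mu> c. if i = j then 1 else 0)"
        unfolding g(2) md_sum lookup_sum
        by (intro sum.cong) (auto simp: gp lookup_sum lookup_single when_def)
      also have "\<dots> = (\<Sum>c<rowl \<mu>. if c < \<mu> ! j then 1 else 0)"
        using ch j by (intro sum.cong) (auto simp: diagram_def)
      also have "\<dots> = card {c \<in> {..<rowl \<mu>}. c < \<mu> ! j}"
        by (subst sum.inter_filter[symmetric]) auto
      also have "{c \<in> {..<rowl \<mu>}. c < \<mu> ! j} = {..<\<mu> ! j}" using rl[OF j] by auto
      finally show ?thesis by simp
    qed
    with 1 show ?thesis by blast
  qed
  ultimately show "tpoly b \<mu> U \<in> right_hw r b \<mu>" unfolding right_hw_def polys_on_def by blast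
qed

lemma lm_wpart: "lm f m \<Longrightarrow> md fst m = \<alpha> \<Longrightarrow> lm (wpart \<alpha> f) m"
  by (auto simp: lm_def wpart_def)

definition wtpart :: "(nat \<Rightarrow>\<^sub>0 nat) \<Rightarrow> mpoly set \<Rightarrow> mpoly set" where
  "wtpart \<alpha> V = {f \<in> V. weight_hom \<alpha> f}"

lemma subspace_wtpart: "mp.subspace V \<Longrightarrow> mp.subspace (wtpart \<alpha> V)"
proof -
  assume V: "mp.subspace V"
  have "weight_hom \<alpha> (f + g)" if "weight_hom \<alpha> f" "weight_hom \<alpha> g" for f g
    using that Poly_Mapping.keys_add[of f g] unfolding weight_hom_def by blast
  moreover have "weight_hom \<alpha> (c *\<^sub>p f)" if "weight_hom \<alpha> f" for c f
    using that unfolding weight_hom_def by (auto simp: in_keys_iff)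
  moreover have "weight_hom \<alpha> 0" by (simp add: weight_hom_def)
  ultimately show ?thesis using mp.subspace_0[OF V] mp.subspace_add[OF V] mp.subspace_scale[OF V]
    by (intro mp.subspaceI) (simp_all add: wtpart_def)
qed

lemma tmon_weight: "md fst (tmon b \<mu> U) = content \<mu> U"
  by (simp add: tmon_def content_def md_sum case_prod_unfold)

lemma md_fst_box: "m \<in> box I {..<C} \<Longrightarrow> lookup (md fst m) i = (\<Sum>j<C. lookup m (i, j))"
  by (intro lookup_md_fst) (auto simp: box_def)

lemma tdeg_box:
  assumes "m \<in> box {..<r} {..<C}" shows "tdeg m = (\<Sum>i<r. lookup (md fst m) i)"
proof -
  have "tdeg m = (\<Sum>i<r. \<Sum>j<C. lookup m (i, j))"
    using assms by (subst tdeg_superset[of "{..<r} \<times> {..<C}"]) (auto simp: box_def sum.cartesian_product)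
  then show ?thesis using md_fst_box[OF assms] by simp
qed

lemma dim_right_hw:
  assumes sorted: "sorted_wrt (\<ge>) \<mu>"
  shows "mp.dim (wtpart \<alpha> (right_hw r b \<mu>)) = kostka r \<mu> \<alpha>"
proof -
  have fin: "finite (Adm r b \<mu> \<alpha>)"
  proof (rule finite_subset)
    show "Adm r b \<mu> \<alpha> \<subseteq> dbox {..<r} {..<b + length \<mu>} (\<Sum>i<r. lookup \<alpha> i)"
    proof
      fix m assume m: "m \<in> Adm r b \<mu> \<alpha>"
      then have "m \<in> box {..<r} {..<b + length \<mu>}" by (auto simp: Adm_def box_def)
      then show "m \<in> dbox {..<r} {..<b + length \<mu>} (\<Sum>i<r. lookup \<alpha> i)"
        using tdeg_box m by (auto simp: dbox_def Adm_def)
    qed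
  qed (simp add: finite_dbox)
  have right_hw_wpart: "wpart \<alpha> f \<in> right_hw r b \<mu>" if "f \<in> right_hw r b \<mu>" for f
    using right_hw_stable[where b = b and \<mu> = \<mu> and r = r, OF order_refl] that unfolding gl_stable_def by blast
  \<comment> \<open>The leading monomial has weight \<alpha> and therefore survives in the weight
    component, which lies in the weight space by construction.\<close>
  have tp: "wpart \<alpha> (tpoly b \<mu> U) \<in> wtpart \<alpha> (right_hw r b \<mu>) \<and> lm (wpart \<alpha> (tpoly b \<mu> U)) (tmon b \<mu> U)"
    if "U \<in> ssyt r \<mu>" "content \<mu> U = \<alpha>" for U
    using tpoly[OF that(1) sorted, of b] right_hw_wpart lm_wpart that(2) by (simp add: wtpart_def tmon_weight)
  have im: "tmon b \<mu> ` {U \<in> ssyt r \<mu>. content \<mu> U = \<alpha>} = Adm r b \<mu> \<alpha>"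
  proof (intro equalityI subsetI)
    fix m assume "m \<in> tmon b \<mu> ` {U \<in> ssyt r \<mu>. content \<mu> U = \<alpha>}"
    then obtain U where "m = tmon b \<mu> U" "U \<in> ssyt r \<mu>" "content \<mu> U = \<alpha>" by blast
    then show "m \<in> Adm r b \<mu> \<alpha>"
      using tp[of U] right_hw_lead[of "wpart \<alpha> (tpoly b \<mu> U)" r b \<mu> m \<alpha>] by (simp add: wtpart_def)
  next
    fix m assume m: "m \<in> Adm r b \<mu> \<alpha>"
    then obtain U where U: "U \<in> ssyt r \<mu>" "tmon b \<mu> U = m" using Adm_surj[OF _ sorted] by blast
    then have "content \<mu> U = \<alpha>" using m tmon_weight[of b \<mu> U] by (simp add: Adm_def)
    then show "m \<in> tmon b \<mu> ` {U \<in> ssyt r \<mu>. content \<mu> U = \<alpha>}" using U by blast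
  qed
  have "mp.dim (wtpart \<alpha> (right_hw r b \<mu>)) = card (Adm r b \<mu> \<alpha>)"
  proof (rule dim_leads[OF _ fin])
    show "mp.subspace (wtpart \<alpha> (right_hw r b \<mu>))" by (intro subspace_wtpart right_hw_subspace)
    show "m \<in> Adm r b \<mu> \<alpha>" if "f \<in> wtpart \<alpha> (right_hw r b \<mu>)" "lm f m" for f m
      using that right_hw_lead[of f r b \<mu> m \<alpha>] by (simp add: wtpart_def)
    show "\<exists>f\<in>wtpart \<alpha> (right_hw r b \<mu>). lm f m" if "m \<in> Adm r b \<mu> \<alpha>" for m
      using that tp unfolding im[symmetric] by blast
  qed
  also have "\<dots> = card {U \<in> ssyt r \<mu>. content \<mu> U = \<alpha>}"
    unfolding im[symmetric] by (intro card_image inj_on_subset[OF inj_tmon]) auto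
  finally show ?thesis by (simp add: kostka_def)
qed

section \<open>Characters of polarization-stable spaces\<close>

definition pwt :: "nat list \<Rightarrow> (nat \<Rightarrow>\<^sub>0 nat)" where
  "pwt \<mu> = (\<Sum>i<length \<mu>. single i (\<mu> ! i))"

lemma lookup_pwt: "lookup (pwt \<mu>) i = (if i < length \<mu> then \<mu> ! i else 0)"
  by (auto simp: pwt_def lookup_sum lookup_single when_def)

lemma pwt_inj:
  assumes "is_partition \<mu>" "is_partition \<nu>" "pwt \<mu> = pwt \<nu>" shows "\<mu> = \<nu>"
proof -
  have nz: "lookup (pwt \<rho>) i \<noteq> 0 \<longleftrightarrow> i < length \<rho>" if "is_partition \<rho>" for \<rho> i
  proof -
    have "\<rho> ! i \<noteq> 0" if "i < length \<rho>"
      using nth_mem[OF that] \<open>is_partition \<rho>\<close> unfolding is_partition_def by metis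
    then show ?thesis by (simp add: lookup_pwt)
  qed
  have iff: "i < length \<mu> \<longleftrightarrow> i < length \<nu>" for i
    using nz[OF assms(1), of i] nz[OF assms(2), of i] assms(3) by simp
  have len: "length \<mu> = length \<nu>"
    using iff[of "length \<mu>"] iff[of "length \<nu>"] by simp
  show ?thesis
  proof (rule nth_equalityI[OF len])
    fix i assume "i < length \<mu>"
    then show "\<mu> ! i = \<nu> ! i" using lookup_pwt[of \<mu> i] lookup_pwt[of \<nu> i] assms(3) len by simp
  qed
qed

text \<open>The second use of \<open>lead_ballot\<close>: the sites are now columns, and two
  adjacent rows take the place of two adjacent columns.\<close>

lemma hw_lead:
  assumes f: "f \<in> polys_on (box {..<r} {..<C})" "weight_hom \<alpha> f" "hw r C f" "lm f m" and i: "Suc i < r" "s < C"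
  shows "(\<Sum>c\<le>s. lookup m (Suc i, c)) \<le> (\<Sum>c<s. lookup m (i, c))"
proof -
  interpret sl2_sites C "Pair i" "Pair (Suc i)"
    by standard (auto simp: inj_on_def)
  show ?thesis
  proof (rule lead_ballot[OF _ f(4) _ i(2)])
    show "pol {..<C} (Pair i) (Pair (Suc i)) f = 0"
      using f(3) i by (auto simp: hw_def rowpol_def)
    have "(\<Sum>t<C. lookup q (Suc i, t)) = lookup \<alpha> (Suc i)" if "q \<in> keys f" for q
    proof -
      have "q \<in> box {..<r} {..<C}" "md fst q = \<alpha>" using f(1,2) that by (auto simp: polys_on_def weight_hom_def)
      then show ?thesis using md_fst_box by metis
    qed
    then show "(\<Sum>t<C. lookup m' (Suc i, t)) = (\<Sum>t<C. lookup m (Suc i, t))" if "m' \<in> keys f" for m'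
      using f(4) that by (simp add: lm_def)
  qed
qed

lemma lookup_outside_box: "m \<in> box I J \<Longrightarrow> i \<notin> I \<or> j \<notin> J \<Longrightarrow> lookup m (i, j) = 0"
  using in_keys_iff[of "(i, j)" m] by (auto simp: box_def)

text \<open>Induction on rows: by the ballot inequality the exponents of row i + 1 in columns up to
  c are bounded by those of row i in columns below c, which already vanish.\<close>

lemma hw_lead_triangular:
  assumes f: "f \<in> polys_on (box {..<r} {b..<C})" "weight_hom \<alpha> f" "hw r C f" "lm f m"
  shows "c < b + i \<Longrightarrow> lookup m (i, c) = 0"
proof (induction i arbitrary: c)
  case 0
  have "m \<in> box {..<r} {b..<C}" using f by (auto simp: polys_on_def lm_def)
  then show ?case using 0 by (intro lookup_outside_box) auto
next
  case (Suc i)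
  have mb: "m \<in> box {..<r} {b..<C}" using f by (auto simp: polys_on_def lm_def)
  have f': "f \<in> polys_on (box {..<r} {..<C})" using f(1) by (auto simp: polys_on_def box_def subset_iff)
  show ?case
  proof (cases "Suc i < r \<and> c < C")
    case True
    have "lookup m (Suc i, c) \<le> (\<Sum>c'\<le>c. lookup m (Suc i, c'))" by (rule member_le_sum) auto
    also have "\<dots> \<le> (\<Sum>c'<c. lookup m (i, c'))" using hw_lead[OF f' f(2-4)] True by blast
    also have "\<dots> = 0" using Suc by (intro sum.neutral) auto
    finally show ?thesis by simp
  next
    case False
    then show ?thesis by (intro lookup_outside_box[OF mb]) auto
  qed
qed

text \<open>The ballot inequality over all columns makes the weight weakly decreasing. Triangularity
  empties every row i \<ge> n of the leading monomial, whose columns are all below n.\<close>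

lemma hw_weight_partition:
  assumes f: "f \<in> polys_on (box {..<r} {..<n})" "weight_hom \<alpha> f" "hw r C f" "f \<noteq> 0" and C: "n \<le> C"
  shows "\<exists>\<mu>. is_partition \<mu> \<and> length \<mu> \<le> n \<and> length \<mu> \<le> r \<and> \<alpha> = pwt \<mu>"
proof -
  obtain m where m: "lm f m" using lm_exists f(4) by blast
  have f': "f \<in> polys_on (box {..<r} {..<C})" using f(1) C by (force simp: polys_on_def box_def)
  have f'': "f \<in> polys_on (box {..<r} {0..<C})" using f' by (simp add: lessThan_atLeast0)
  have mb: "m \<in> box {..<r} {..<n}" "md fst m = \<alpha>" using m f by (auto simp: lm_def polys_on_def weight_hom_def)
  have mb': "m \<in> box {..<r} {..<C}" using m f' by (auto simp: lm_def polys_on_def)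
  note tri = hw_lead_triangular[OF f'' f(2,3) m]
  have la: "lookup \<alpha> i = (\<Sum>c<C. lookup m (i, c))" for i using md_fst_box[OF mb'] mb(2) by simp
  have zero: "lookup \<alpha> i = 0" if "i \<ge> n \<or> i \<ge> r" for i
    unfolding la
  proof (intro sum.neutral ballI)
    fix c
    show "lookup m (i, c) = 0"
    proof (cases "c < n \<and> i < r")
      case True
      then show ?thesis using tri[of c i] that by simp
    next
      case False
      then show ?thesis by (intro lookup_outside_box[OF mb(1)]) auto
    qed
  qed
  have dec: "lookup \<alpha> (Suc i) \<le> lookup \<alpha> i" for i
  proof (cases "Suc i < r \<and> 0 < C")
    case True
    have "lookup \<alpha> (Suc i) = (\<Sum>c\<le>C - 1. lookup m (Suc i, c))"
      unfolding la using True by (intro sum.cong) auto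
    also have "\<dots> \<le> (\<Sum>c<C - 1. lookup m (i, c))" using hw_lead[OF f' f(2,3) m, of i "C - 1"] True by simp
    also have "\<dots> \<le> lookup \<alpha> i" unfolding la by (intro sum_mono2) auto
    finally show ?thesis .
  next
    case False
    then show ?thesis using zero[of "Suc i"] C by auto
  qed
  have dec': "lookup \<alpha> j \<le> lookup \<alpha> i" if "i \<le> j" for i j
    using lift_Suc_antimono_le[of "lookup \<alpha>", OF dec that] .
  let ?N = "{i. lookup \<alpha> i \<noteq> 0}"
  have NS: "?N \<subseteq> {..<min n r}"
  proof
    fix i assume "i \<in> ?N"
    then show "i \<in> {..<min n r}" using zero[of i] by (cases "i < n"; cases "i < r") auto
  qed
  then have finN: "finite ?N" by (rule finite_subset) simp
  have dc: "y \<in> ?N" if "x \<in> ?N" "y < x" for x y using dec'[of y x] that by auto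
  define l where "l = card ?N"
  have N: "lookup \<alpha> i \<noteq> 0 \<longleftrightarrow> i < l" for i
  proof -
    have "i \<in> ?N \<longleftrightarrow> i < card ?N" by (rule downclosed_iff[OF finN]) (rule dc)
    then show ?thesis unfolding l_def mem_Collect_eq .
  qed
  define \<mu> where "\<mu> = map (lookup \<alpha>) [0..<l]"
  have "is_partition \<mu>" unfolding is_partition_def
  proof
    show "sorted_wrt (\<ge>) \<mu>" unfolding \<mu>_def sorted_wrt_map
      by (rule sorted_wrt_mono_rel[OF _ sorted_wrt_upt]) (auto intro: dec')
    show "0 \<notin> set \<mu>"
    proof
      assume "0 \<in> set \<mu>"
      then obtain i where "i < l" "lookup \<alpha> i = 0" by (auto simp: \<mu>_def)
      then show False using N[of i] by simp
    qed
  qed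
  moreover have "length \<mu> \<le> min n r"
    unfolding \<mu>_def l_def using card_mono[OF _ NS] by simp
  moreover have "\<alpha> = pwt \<mu>"
  proof (rule poly_mapping_eqI)
    fix i
    show "lookup \<alpha> i = lookup (pwt \<mu>) i" unfolding lookup_pwt using N[of i] by (auto simp: \<mu>_def)
  qed
  ultimately show ?thesis by auto
qed

definition dmon :: "nat \<Rightarrow> nat list \<Rightarrow> monom" where
  "dmon b \<mu> = (\<Sum>j<length \<mu>. single (j, b + j) (\<mu> ! j))"

text \<open>Row raising empties the leading monomial below the diagonal, and the ballot inequalities
  of the columns empty it above. The column degrees then determine the diagonal exponents.\<close>

lemma right_hw_hw_lead:
  assumes f: "f \<in> right_hw r b \<mu>" "weight_hom \<alpha> f" "hw r C f" "lm f m" and C: "b + length \<mu> \<le> C"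
  shows "m = dmon b \<mu>" "\<alpha> = pwt \<mu>"
proof -
  have f': "f \<in> polys_on (box {..<r} {b..<C})" using f(1) C unfolding right_hw_def polys_on_def box_def by fastforce
  note tri = hw_lead_triangular[OF f' f(2,3,4)]
  have adm: "m \<in> Adm r b \<mu> \<alpha>" using right_hw_lead[OF f(1,4,2)] .
  then have mb: "m \<in> box {..<r} {b..<b + length \<mu>}" by (simp add: Adm_def)
  have tri': "t < j \<Longrightarrow> lookup m (t, b + j) = 0" for t j
  proof (induction j arbitrary: t)
    case (Suc j)
    show ?case
    proof (cases "Suc j < length \<mu> \<and> t < r")
      case True
      have "lookup m (t, b + Suc j) \<le> (\<Sum>t'\<le>t. lookup m (t', b + Suc j))" by (rule member_le_sum) auto
      also have "\<dots> \<le> (\<Sum>t'<t. lookup m (t', b + j))" using adm True unfolding Adm_def by blast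
      also have "\<dots> = 0" using Suc by (intro sum.neutral) auto
      finally show ?thesis by simp
    next
      case False
      then show ?thesis by (intro lookup_outside_box[OF mb]) auto
    qed
  qed simp
  have diag: "lookup m (t, b + j) = 0" if "t \<noteq> j" for t j
    using that tri[of "b + j" t] tri'[of t j] by (cases "t < j") auto
  have val: "lookup m (j, b + j) = \<mu> ! j" if "j < length \<mu>" for j
  proof -
    have "\<mu> ! j = (\<Sum>t<r. lookup m (t, b + j))"
      using adm that md_snd_box[OF mb, of "b + j"] by (simp add: Adm_def)
    also have "\<dots> = (\<Sum>t<r. if t = j then lookup m (j, b + j) else 0)"
      using diag by (intro sum.cong) auto
    also have "\<dots> = lookup m (j, b + j)" using lookup_outside_box[OF mb, of j "b + j"] by auto
    finally show ?thesis by simp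
  qed
  show m: "m = dmon b \<mu>"
  proof (rule poly_mapping_eqI)
    fix x :: "nat \<times> nat"
    obtain t c where x: "x = (t, c)" by (cases x)
    have d: "lookup (dmon b \<mu>) (t, c) = (\<Sum>j<length \<mu>. if j = t \<and> b + j = c then \<mu> ! j else 0)"
      by (auto simp: dmon_def lookup_sum lookup_single when_def intro!: sum.cong)
    show "lookup m x = lookup (dmon b \<mu>) x" unfolding x d
    proof (cases "c = b + t \<and> t < length \<mu>")
      case True
      then have "(\<Sum>j<length \<mu>. if j = t \<and> b + j = c then \<mu> ! j else 0) = (\<Sum>j<length \<mu>. if j = t then \<mu> ! t else 0)"
        by (intro sum.cong) auto
      then show "lookup m (t, c) = (\<Sum>j<length \<mu>. if j = t \<and> b + j = c then \<mu> ! j else 0)"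
        using val True by simp
    next
      case False
      have "lookup m (t, c) = 0"
      proof (cases "c \<in> {b..<b + length \<mu>}")
        case True
        then show ?thesis using diag[of t "c - b"] False by auto
      qed (use lookup_outside_box[OF mb] in blast)
      moreover have "(\<Sum>j<length \<mu>. if j = t \<and> b + j = c then \<mu> ! j else 0) = 0"
        using False by (intro sum.neutral) auto
      ultimately show "lookup m (t, c) = (\<Sum>j<length \<mu>. if j = t \<and> b + j = c then \<mu> ! j else 0)" by simp
    qed
  qed
  have "\<alpha> = md fst m" using adm by (simp add: Adm_def)
  then show "\<alpha> = pwt \<mu>" unfolding m by (simp add: dmon_def md_sum pwt_def)
qed

lemma right_hw_finite:
  "right_hw r b \<mu> \<subseteq> polys_on (dbox {..<r} {b..<b + length \<mu>} (\<Sum>j<length \<mu>. \<mu> ! j))"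
proof
  fix f assume f: "f \<in> right_hw r b \<mu>"
  have "m \<in> dbox {..<r} {b..<b + length \<mu>} (\<Sum>j<length \<mu>. \<mu> ! j)" if m: "m \<in> keys f" for m
  proof -
    have mb: "m \<in> box {..<r} {b..<b + length \<mu>}" using f m by (auto simp: right_hw_def polys_on_def)
    have "tdeg m = (\<Sum>j\<in>{b..<b + length \<mu>}. \<Sum>i<r. lookup m (i, j))"
      using mb by (subst tdeg_superset[of "{..<r} \<times> {b..<b + length \<mu>}"], simp, simp add: box_def,
          subst sum.swap) (simp add: sum.cartesian_product)
    also have "\<dots> = (\<Sum>j<length \<mu>. \<Sum>i<r. lookup m (i, b + j))"
      by (rule sum.reindex_bij_witness[of _ "\<lambda>j. b + j" "\<lambda>j. j - b"]) auto
    also have "\<dots> = (\<Sum>j<length \<mu>. \<mu> ! j)"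
      using f m md_snd_box[OF mb] by (intro sum.cong) (auto simp: right_hw_def)
    finally show ?thesis using mb by (simp add: dbox_def)
  qed
  then show "f \<in> polys_on (dbox {..<r} {b..<b + length \<mu>} (\<Sum>j<length \<mu>. \<mu> ! j))" by (auto simp: polys_on_def)
qed

lemma right_hw_nonzero:
  assumes "is_partition \<mu>" "length \<mu> \<le> r" shows "right_hw r b \<mu> \<noteq> {0}"
proof -
  \<comment> \<open>All entries of row i are i; they are below r because \<mu> has at most r
    parts.\<close>
  let ?U = "\<lambda>x. if x \<in> diagram \<mu> then fst x else undefined"
  have "?U \<in> ssyt r \<mu>" unfolding ssyt_def
    using assms by (auto simp: diagram_def intro!: PiE_I split: if_splits)
  then show ?thesis using tpoly[of ?U r \<mu> b] assms lm_nonzero by (auto simp: is_partition_def)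
qed

lemma hw_lin: "hw r C f \<Longrightarrow> hw r C g \<Longrightarrow> hw r C (f - c *\<^sub>p g)"
  by (simp add: hw_def)

lemma hom_lin: "weight_hom \<alpha> f \<Longrightarrow> weight_hom \<alpha> g \<Longrightarrow> weight_hom \<alpha> (f - c *\<^sub>p g)"
  unfolding weight_hom_def by (auto simp: in_keys_iff lookup_minus)

text \<open>Any two nonzero highest weight vectors of pure weight in \<open>right_hw\<close> share
  their leading monomial; the combination that cancels it would need it again as leading monomial,
  so it is 0. Hence the orthogonal complement of the module of \<open>u\<close> contains no nonzero
  highest weight vector and is zero.\<close>

lemma right_hw_irreducible:
  assumes \<mu>: "is_partition \<mu>" "length \<mu> \<le> r" and C: "b + length \<mu> \<le> C"
  obtains u where "u \<in> right_hw r b \<mu>" "u \<noteq> 0" "hw r C u" "weight_hom (pwt \<mu>) u" "right_hw r b \<mu> = gl_span r C u"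
proof -
  have st: "gl_stable r C (right_hw r b \<mu>)" using right_hw_stable C by blast
  let ?S = "dbox {..<r} {b..<b + length \<mu>} (\<Sum>j<length \<mu>. \<mu> ! j)"
  have finS: "finite ?S" by (intro finite_dbox) auto
  have rows: "right_hw r b \<mu> \<subseteq> polys_on (box {..<r} UNIV)" by (auto simp: right_hw_def polys_on_def box_def subset_iff)
  obtain u \<alpha> where u: "u \<in> right_hw r b \<mu>" "u \<noteq> 0" "weight_hom \<alpha> u" "hw r C u"
    by (rule hw_exists[OF st right_hw_finite finS right_hw_nonzero[OF \<mu>] rows])
  obtain m where m: "lm u m" using lm_exists u(2) by blast
  have \<alpha>: "\<alpha> = pwt \<mu>" "m = dmon b \<mu>" using right_hw_hw_lead[OF u(1,3,4) m C] by auto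
  have uniq: "\<exists>c. x = c *\<^sub>p u" if x: "x \<in> right_hw r b \<mu>" "hw r C x" "weight_hom \<beta> x" for x \<beta>
  proof (cases "x = 0")
    case True
    then show ?thesis by (intro exI[of _ 0]) simp
  next
    case False
    then obtain m' where m': "lm x m'" using lm_exists by blast
    have \<beta>: "\<beta> = pwt \<mu>" "m' = dmon b \<mu>" using right_hw_hw_lead[OF x(1,3,2) m' C] by auto
    then obtain c where c: "\<forall>q. lm (x - c *\<^sub>p u) q \<longrightarrow> mless q (dmon b \<mu>)"
      using lm_reduce[of x "dmon b \<mu>" u] m m' \<alpha>(2) by blast
    have "x - c *\<^sub>p u = 0"
    proof (rule ccontr)
      assume "x - c *\<^sub>p u \<noteq> 0"
      then obtain q where q: "lm (x - c *\<^sub>p u) q" using lm_exists by blast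
      have "x - c *\<^sub>p u \<in> right_hw r b \<mu>"
        using x(1) u(1) right_hw_subspace by (simp add: mp.subspace_diff mp.subspace_scale)
      then have "q = dmon b \<mu>"
        using right_hw_hw_lead(1)[OF _ hom_lin hw_lin q C] x u \<alpha> \<beta> by blast
      then show False using c q mless_irrefl by blast
    qed
    then show ?thesis by (intro exI[of _ c]) simp
  qed
  have ubox: "u \<in> polys_on (box {..<r} {..<C})" using u(1) C unfolding right_hw_def polys_on_def box_def by fastforce
  have Tsub: "gl_span r C u \<subseteq> right_hw r b \<mu>" by (rule gl_span_subset[OF st u(1)])
  have Tst: "gl_stable r C (gl_span r C u)" by (rule gl_stable_gl_span[OF u(4,3) ubox])
  have uT: "u \<in> gl_span r C u" unfolding gl_span_def by (rule mp.span_base) (rule lowered.base)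
  have orth0: "orth (right_hw r b \<mu>) (gl_span r C u) = {0}"
  proof (rule ccontr)
    assume ne: "orth (right_hw r b \<mu>) (gl_span r C u) \<noteq> {0}"
    have sub: "orth (right_hw r b \<mu>) (gl_span r C u) \<subseteq> right_hw r b \<mu>" by (auto simp: orth_def)
    obtain x \<beta> where x: "x \<in> orth (right_hw r b \<mu>) (gl_span r C u)" "x \<noteq> 0" "weight_hom \<beta> x" "hw r C x"
      by (rule hw_exists[OF gl_stable_orth[OF st Tst] order_trans[OF sub right_hw_finite] finS ne order_trans[OF sub rows]])
    then obtain c where c: "x = c *\<^sub>p u" using uniq[OF _ x(4,3)] sub by blast
    have "ip x u = 0" using x(1) uT by (auto simp: orth_def)
    then show False using c x(2) by auto
  qed
  have "right_hw r b \<mu> \<subseteq> gl_span r C u"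
  proof
    fix f assume f: "f \<in> right_hw r b \<mu>"
    have Tss: "mp.subspace (gl_span r C u)" by (simp add: gl_span_def)
    obtain a where a: "a \<in> gl_span r C u" "\<And>g. g \<in> gl_span r C u \<Longrightarrow> ip (f - a) g = 0"
      using orth_decomp[where f = f, OF Tss finS order_trans[OF Tsub right_hw_finite]] by metis
    have "f - a \<in> right_hw r b \<mu>" using f a(1) Tsub right_hw_subspace mp.subspace_diff by blast
    then have "f - a \<in> orth (right_hw r b \<mu>) (gl_span r C u)" using a(2) by (simp add: orth_def)
    then have "f - a = 0" unfolding orth0 by simp
    then show "f \<in> gl_span r C u" using a(1) by simp
  qed
  then show ?thesis using that[OF u(1,2,4)] u(3) Tsub \<alpha>(1) by blast
qed

section \<open>Comparison of modules of equal highest weight\<close>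

lemma gl_span_image:
  assumes lin: "Vector_Spaces.linear smul smul h" and comm: "\<And>i k f. h (rowpol C i k f) = rowpol C i k (h f)"
  shows "gl_span r C (h x) = h ` gl_span r C x"
proof -
  interpret h: Vector_Spaces.linear smul smul h by fact
  have "lowered r C (h x) \<subseteq> h ` lowered r C x"
  proof
    fix y assume "y \<in> lowered r C (h x)"
    then show "y \<in> h ` lowered r C x"
    proof induction
      case base
      then show ?case by (intro imageI lowered.base)
    next
      case (lower y k i)
      then obtain z where z: "z \<in> lowered r C x" "y = h z" by blast
      then have "rowpol C i k y = h (rowpol C i k z)" "rowpol C i k z \<in> lowered r C x"
        using lower comm lowered.lower by auto
      then show ?case by simp
    qed
  qed
  moreover have "h y \<in> lowered r C (h x)" if "y \<in> lowered r C x" for y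
    using that by induction (auto simp: comm intro: lowered.base lowered.lower)
  ultimately have "lowered r C (h x) = h ` lowered r C x" by blast
  then show ?thesis unfolding gl_span_def using h.span_image by metis
qed

lemma linear_rest: "Vector_Spaces.linear smul smul (rest P)"
  by unfold_locales auto

lemma rest_rowpol:
  assumes "\<And>m m'. md snd m = md snd m' \<Longrightarrow> P m = P m'"
  shows "rest P (rowpol C i k f) = rowpol C i k (rest P f)"
  unfolding rowpol_def
proof (rule rest_pol)
  fix m m' :: monom and s :: nat
  assume "m + single (k, s) 1 = m' + single (i, s) 1"
  from arg_cong[OF this, of "md snd"] show "P m = P m'" by (intro assms) (simp add: md_add)
qed

text \<open>Row polarizations preserve column degrees, so \<open>rest P\<close> commutes with them
  and its kernel on the module of \<open>x\<close> is stable. The kernel does not contain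
  \<open>x\<close>, hence is 0 by irreducibility, and the projection is an isomorphism that respects
  weights.\<close>

lemma dim_gl_span_rest:
  assumes x: "hw r C x" "weight_hom \<beta> x" "x \<in> polys_on (box {..<r} {..<C})"
    and P: "\<And>m m'. md snd m = md snd m' \<Longrightarrow> P m = P m'" and ne: "rest P x \<noteq> 0"
  shows "mp.dim (wtpart \<alpha> (gl_span r C (rest P x))) = mp.dim (wtpart \<alpha> (gl_span r C x))"
proof -
  let ?h = "rest P"
  let ?S = "dbox {..<r} {..<C} (\<Sum>i<r. lookup \<beta> i)"
  have finS: "finite ?S" by (intro finite_dbox) auto
  have comm: "?h (rowpol C i k f) = rowpol C i k (?h f)" for i k f by (rule rest_rowpol) (rule P)
  have im: "gl_span r C (?h x) = ?h ` gl_span r C x" by (intro gl_span_image linear_rest comm)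
  have wcomm: "?h (wpart \<alpha> f) = wpart \<alpha> (?h f)" for \<alpha> f
    by (simp add: wpart_def rest_rest conj_commute)
  have st: "gl_stable r C (gl_span r C x)" by (rule gl_stable_gl_span[OF x])
  have ker: "f = 0" if f: "f \<in> gl_span r C x" "?h f = 0" for f
  proof (rule ccontr)
    assume "f \<noteq> 0"
    let ?N = "{f \<in> gl_span r C x. ?h f = 0}"
    have ss: "mp.subspace (gl_span r C x)" using st by (simp add: gl_stable_def)
    have "mp.subspace ?N"
      by (rule mp.subspaceI) (simp_all add: mp.subspace_0[OF ss] mp.subspace_add[OF ss] mp.subspace_scale[OF ss])
    then have "gl_stable r C ?N"
      using st unfolding gl_stable_def by (simp add: comm wcomm)
    moreover have "?N \<noteq> {0}" using f \<open>f \<noteq> 0\<close> by blast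
    ultimately have "x \<in> ?N" using gl_span_irreducible[OF x, of ?N] by blast
    then show False using ne by simp
  qed
  have "wtpart \<alpha> (gl_span r C (?h x)) = ?h ` wtpart \<alpha> (gl_span r C x)"
  proof (intro equalityI subsetI)
    fix y assume y: "y \<in> wtpart \<alpha> (gl_span r C (?h x))"
    then obtain z where z: "z \<in> gl_span r C x" "y = ?h z" unfolding im wtpart_def by blast
    have "y = wpart \<alpha> y" using y wpart_hom[of \<alpha> y \<alpha>] by (simp add: wtpart_def)
    then have "y = ?h (wpart \<alpha> z)" unfolding z(2) wcomm .
    moreover have "wpart \<alpha> z \<in> wtpart \<alpha> (gl_span r C x)" using st z(1) by (simp add: wtpart_def gl_stable_def)
    ultimately show "y \<in> ?h ` wtpart \<alpha> (gl_span r C x)" by blast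
  next
    fix y assume "y \<in> ?h ` wtpart \<alpha> (gl_span r C x)"
    then obtain z where z: "z \<in> wtpart \<alpha> (gl_span r C x)" "y = ?h z" by blast
    then show "y \<in> wtpart \<alpha> (gl_span r C (?h x))" unfolding im by (auto simp: wtpart_def weight_hom_def)
  qed
  moreover have "mp.dim (?h ` wtpart \<alpha> (gl_span r C x)) = mp.dim (wtpart \<alpha> (gl_span r C x))"
  proof (rule dim_inj_image[OF _ finS _ linear_rest])
    show "mp.subspace (wtpart \<alpha> (gl_span r C x))" by (intro subspace_wtpart) (simp add: gl_span_def)
    show "wtpart \<alpha> (gl_span r C x) \<subseteq> polys_on ?S" using gl_span_finite[OF x] by (auto simp: wtpart_def)
    show "f = 0" if "f \<in> wtpart \<alpha> (gl_span r C x)" "?h f = 0" for f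
      using ker that by (simp add: wtpart_def)
  qed
  ultimately show ?thesis by simp
qed

lemma hom_zero_const:
  assumes "weight_hom 0 f" "f \<in> polys_on (box {..<r} {..<C})" shows "f = single 0 (lookup f 0)"
proof (rule poly_mapping_eqI)
  fix m
  have "m = 0" if m: "m \<in> keys f"
  proof -
    have "m \<in> box {..<r} {..<C}" "md fst m = 0" using assms m by (auto simp: weight_hom_def polys_on_def)
    then have "tdeg m = 0" using tdeg_box[of m r C] by simp
    then have "lookup m a = 0" for a using lookup_le_tdeg[of m a] by simp
    then show ?thesis by (intro poly_mapping_eqI) simp
  qed
  then show "lookup f m = lookup (single 0 (lookup f 0)) m"
    by (cases "m \<in> keys f") (auto simp: lookup_single when_def in_keys_iff)
qed

text \<open>Two highest weight vectors \<open>v\<close>, \<open>u\<close> of equal weight in disjoint sets of columns are compared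
  through the irreducible module generated by \<open>v + u\<close>.\<close>

lemma dim_gl_span:
  assumes \<mu>: "is_partition \<mu>" "length \<mu> \<le> r" and C: "n + length \<mu> \<le> C"
    and v: "v \<in> polys_on (box {..<r} {..<n})" "v \<noteq> 0" "hw r C v" "weight_hom (pwt \<mu>) v"
  shows "mp.dim (wtpart \<alpha> (gl_span r C v)) = kostka r \<mu> \<alpha>"
proof -
  obtain u where u: "u \<in> right_hw r n \<mu>" "u \<noteq> 0" "hw r C u" "weight_hom (pwt \<mu>) u" "right_hw r n \<mu> = gl_span r C u"
    by (rule right_hw_irreducible[OF \<mu> C])
  have Ku: "mp.dim (wtpart \<alpha> (gl_span r C u)) = kostka r \<mu> \<alpha>"
    using dim_right_hw[of \<mu> \<alpha> r n] \<mu>(1) u(5) by (simp add: is_partition_def)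
  have ub: "u \<in> polys_on (box {..<r} {n..<n + length \<mu>})" using u(1) by (simp add: right_hw_def)
  then have ub': "u \<in> polys_on (box {..<r} {..<C})" using C unfolding polys_on_def box_def by fastforce
  have vb': "v \<in> polys_on (box {..<r} {..<C})" using v(1) C unfolding polys_on_def box_def by fastforce
  show ?thesis
  \<comment> \<open>For the empty partition both vectors are nonzero constants, which column degrees
    cannot separate; they are proportional instead.\<close>
  proof (cases "\<mu> = []")
    case True
    then have "pwt \<mu> = 0" by (simp add: pwt_def)
    then have u0: "u = single 0 (lookup u 0)" and v0: "v = single 0 (lookup v 0)"
      using hom_zero_const[OF _ ub'] hom_zero_const[OF _ vb'] u(4) v(4) by auto
    define c where "c = lookup v 0 / lookup u 0"
    have "lookup u 0 \<noteq> 0" "lookup v 0 \<noteq> 0" using u0 v0 u(2) v(2) by (metis single_zero)+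
    note nz = this
    have c: "c \<noteq> 0" using nz by (simp add: c_def)
    have "c *\<^sub>p u = single 0 (c * lookup u 0)"
      by (subst u0) (auto intro!: poly_mapping_eqI simp: lookup_single when_def)
    then have cu: "v = c *\<^sub>p u" using nz v0 by (simp add: c_def)
    have "gl_span r C v = smul c ` gl_span r C u" unfolding cu
      by (rule gl_span_image) (unfold_locales, auto simp: mp.scale_right_distrib)
    also have "\<dots> = gl_span r C u"
    proof (intro equalityI subsetI)
      fix y assume "y \<in> gl_span r C u"
      then have "(1 / c) *\<^sub>p y \<in> gl_span r C u" by (simp add: gl_span_def mp.span_scale)
      then have "c *\<^sub>p ((1 / c) *\<^sub>p y) \<in> smul c ` gl_span r C u" by (rule imageI)
      then show "y \<in> smul c ` gl_span r C u" using c by simp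
    qed (auto simp: gl_span_def mp.span_scale)
    finally show ?thesis using Ku by simp
  next
    case False
    define x where "x = v + u"
    \<comment> \<open>\<open>P\<close> holds on the monomials of \<open>v\<close> and fails on those
      of \<open>u\<close>, each of which has degree \<mu> ! 0 > 0 in column n. So the two
      complementary projections of \<open>x\<close> are \<open>v\<close> and
      \<open>u\<close>.\<close>
    define P where "P = (\<lambda>m. keys (md snd m) \<subseteq> {..<n})"
    have P: "md snd m = md snd m' \<Longrightarrow> P m = P m'" for m m' by (simp add: P_def)
    have xhw: "hw r C x" using u(3) v(3) by (simp add: x_def hw_def)
    have xhom: "weight_hom (pwt \<mu>) x"
      using u(4) v(4) Poly_Mapping.keys_add[of v u] unfolding x_def weight_hom_def by blast
    have xb: "x \<in> polys_on (box {..<r} {..<C})"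
      using ub' vb' Poly_Mapping.keys_add[of v u] unfolding x_def polys_on_def by blast
    have Pv: "P m" if "m \<in> keys v" for m
    proof -
      have mb: "m \<in> box {..<r} {..<n}" using v(1) that by (auto simp: polys_on_def)
      have "j < n" if j: "j \<in> keys (md snd m)" for j
      proof (rule ccontr)
        assume "\<not> j < n"
        then have "lookup (md snd m) j = 0"
          using md_snd_box[OF mb, of j] lookup_outside_box[OF mb, of _ j] by simp
        then show False using j by (simp add: in_keys_iff)
      qed
      then show ?thesis by (auto simp: P_def)
    qed
    have Pu: "\<not> P m" if "m \<in> keys u" for m
    proof -
      have "0 < length \<mu>" using False by simp
      then have "lookup (md snd m) (n + 0) = \<mu> ! 0" using u(1) that unfolding right_hw_def by blast
      moreover have "\<mu> ! 0 \<noteq> 0" using \<mu>(1) \<open>0 < length \<mu>\<close> unfolding is_partition_def by (metis nth_mem)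
      ultimately have "n \<in> keys (md snd m)" by (simp add: in_keys_iff)
      then show ?thesis by (auto simp: P_def)
    qed
    have rv: "rest P x = v" unfolding x_def using rest_idI[of v P] rest_0I[of u P] Pv Pu by simp
    have ru: "rest (\<lambda>m. \<not> P m) x = u"
      unfolding x_def using rest_0I[of v "\<lambda>m. \<not> P m"] rest_idI[of u "\<lambda>m. \<not> P m"] Pv Pu by simp
    have "mp.dim (wtpart \<alpha> (gl_span r C (rest P x))) = mp.dim (wtpart \<alpha> (gl_span r C x))"
      by (rule dim_gl_span_rest[OF xhw xhom xb]) (erule P, simp add: rv v(2))
    moreover have "mp.dim (wtpart \<alpha> (gl_span r C (rest (\<lambda>m. \<not> P m) x))) = mp.dim (wtpart \<alpha> (gl_span r C x))"
      by (rule dim_gl_span_rest[OF xhw xhom xb]) (drule P, simp, simp add: ru u(2))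
    ultimately show ?thesis using Ku by (simp add: rv ru)
  qed
qed

definition hwpart :: "nat \<Rightarrow> nat \<Rightarrow> nat list \<Rightarrow> mpoly set \<Rightarrow> mpoly set" where
  "hwpart r C \<mu> V = {f \<in> V. weight_hom (pwt \<mu>) f \<and> hw r C f}"

lemma hwpart_wtpart: "hwpart r C \<mu> V = {f \<in> wtpart (pwt \<mu>) V. hw r C f}"
  by (auto simp: hwpart_def wtpart_def)

lemma subspace_hwpart: "mp.subspace V \<Longrightarrow> mp.subspace (hwpart r C \<mu> V)"
proof -
  assume "mp.subspace V"
  then have ss: "mp.subspace (wtpart (pwt \<mu>) V)" by (rule subspace_wtpart)
  show ?thesis unfolding hwpart_wtpart
    by (rule mp.subspaceI)
       (simp_all add: hw_def mp.subspace_0[OF ss] mp.subspace_add[OF ss] mp.subspace_scale[OF ss])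
qed

lemma dim_span_single: "v \<noteq> 0 \<Longrightarrow> mp.dim (mp.span {v}) = 1"
  by (subst mp.dim_span_eq_card_independent) auto

text \<open>Induction on the dimension: split off the module of one highest weight vector and
  continue with its orthogonal complement. At least 2n columns leave n fresh ones for the reference
  module in \<open>dim_gl_span\<close>. The set \<open>M\<close> stays fixed while \<open>V\<close>
  shrinks, since partitions without highest weight vectors contribute 0.\<close>

lemma gl_character:
  assumes C: "n + n \<le> C" and S: "finite S" "S \<subseteq> box {..<r} {..<n}"
    and M: "finite M" "\<And>\<mu>. \<mu> \<in> M \<Longrightarrow> is_partition \<mu>"
    and V: "gl_stable r C V" "V \<subseteq> polys_on S"
    and MV: "\<And>\<mu>. is_partition \<mu> \<Longrightarrow> length \<mu> \<le> n \<Longrightarrow> hwpart r C \<mu> V \<noteq> {0} \<Longrightarrow> \<mu> \<in> M"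
  shows "mp.dim (wtpart \<alpha> V) = (\<Sum>\<mu>\<in>M. mp.dim (hwpart r C \<mu> V) * kostka r \<mu> \<alpha>)"
  using V MV
proof (induction "mp.dim V" arbitrary: V rule: less_induct)
  case less
  note st = less.prems(1) and VS = less.prems(2) and MV = less.prems(3)
  have ss: "mp.subspace V" using st by (simp add: gl_stable_def)
  show ?case
  proof (cases "V = {0}")
    case True
    have 1: "wtpart \<alpha> V = {0}" using True by (auto simp: wtpart_def weight_hom_def)
    have 2: "hwpart r C \<mu> V = {0}" for \<mu> using True by (auto simp: hwpart_def weight_hom_def hw_def)
    show ?thesis unfolding 1 2 by simp
  next
    case False
    have PSn: "polys_on S \<subseteq> polys_on (box {..<r} {..<n})" using S(2) by (auto simp: polys_on_def)
    have PSr: "polys_on S \<subseteq> polys_on (box {..<r} UNIV)" using S(2) unfolding polys_on_def box_def by fastforce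
    obtain v \<beta> where v: "v \<in> V" "v \<noteq> 0" "weight_hom \<beta> v" "hw r C v"
      by (rule hw_exists[OF st VS S(1) False order_trans[OF VS PSr]])
    have vb: "v \<in> polys_on (box {..<r} {..<n})" using v(1) VS PSn by blast
    have vb': "v \<in> polys_on (box {..<r} {..<C})" using vb C unfolding polys_on_def box_def by fastforce
    obtain \<nu> where \<nu>: "is_partition \<nu>" "length \<nu> \<le> n" "length \<nu> \<le> r" "\<beta> = pwt \<nu>"
      using hw_weight_partition[OF vb v(3,4,2)] C by auto
    have "v \<in> hwpart r C \<nu> V" using v \<nu> by (simp add: hwpart_def)
    then have \<nu>M: "\<nu> \<in> M" using MV[OF \<nu>(1,2)] v(2) by blast
    define B where "B = gl_span r C v"
    define V' where "V' = orth V B"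
    have stB: "gl_stable r C B" unfolding B_def by (rule gl_stable_gl_span[OF v(4,3) vb'])
    have ssB: "mp.subspace B" using stB by (simp add: gl_stable_def)
    have BV: "B \<subseteq> V" unfolding B_def by (rule gl_span_subset[OF st v(1)])
    have st': "gl_stable r C V'" unfolding V'_def by (rule gl_stable_orth[OF st stB])
    have ss': "mp.subspace V'" using st' by (simp add: gl_stable_def)
    have V'V: "V' \<subseteq> V" by (auto simp: V'_def orth_def)
    have vB: "v \<in> B" unfolding B_def gl_span_def by (rule mp.span_base) (rule lowered.base)
    have int: "x = 0" if "x \<in> B" "x \<in> V'" for x
      using that ip_self_eq_0[of x] by (auto simp: V'_def orth_def)
    have decomp: "\<exists>a\<in>B. f - a \<in> V'" if f: "f \<in> V" for f
    proof -
      obtain a where a: "a \<in> B" "\<And>g. g \<in> B \<Longrightarrow> ip (f - a) g = 0"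
        using orth_decomp[where f = f, OF ssB S(1) order_trans[OF BV VS]] by metis
      have "f - a \<in> V" using f a(1) BV ss mp.subspace_diff by blast
      then show ?thesis using a by (auto simp: V'_def orth_def)
    qed
    have wdecomp: "\<exists>a\<in>wtpart \<gamma> B. \<exists>b\<in>wtpart \<gamma> V'. f = a + b" if f: "f \<in> wtpart \<gamma> V" for f \<gamma>
    proof -
      have fV: "f \<in> V" "weight_hom \<gamma> f" using f by (auto simp: wtpart_def)
      obtain a where a: "a \<in> B" "f - a \<in> V'" using decomp[OF fV(1)] by blast
      have "f = wpart \<gamma> f" using wpart_hom[OF fV(2), of \<gamma>] by simp
      also have "\<dots> = wpart \<gamma> a + wpart \<gamma> (f - a)" by (simp flip: wpart_add)
      finally have "f = wpart \<gamma> a + wpart \<gamma> (f - a)" .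
      moreover have "wpart \<gamma> a \<in> wtpart \<gamma> B" "wpart \<gamma> (f - a) \<in> wtpart \<gamma> V'"
        using a stB st' by (auto simp: wtpart_def gl_stable_def)
      ultimately show ?thesis by blast
    qed
    have hdecomp: "\<exists>a\<in>hwpart r C \<mu> B. \<exists>b\<in>hwpart r C \<mu> V'. f = a + b" if f: "f \<in> hwpart r C \<mu> V" for f \<mu>
    proof -
      obtain a b where ab: "a \<in> wtpart (pwt \<mu>) B" "b \<in> wtpart (pwt \<mu>) V'" "f = a + b"
        using wdecomp[of f "pwt \<mu>"] f by (auto simp: hwpart_wtpart)
      have aB: "a \<in> B" "b \<in> V'" using ab by (auto simp: wtpart_def)
      \<comment> \<open>The two raised components are negatives of each other, so each lies in both
        \<open>B\<close> and \<open>V'\<close>, which meet only in 0.\<close>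
      have "rowpol C i k a = 0 \<and> rowpol C i k b = 0" if ik: "i < k" "k < r" for i k
      proof -
        have "rowpol C i k f = 0" using f ik by (simp add: hwpart_def hw_def)
        then have eq: "rowpol C i k a = (-1) *\<^sub>p rowpol C i k b" using ab(3) by (simp add: add_eq_0_iff2)
        have "i < r" using ik by simp
        have "rowpol C i k a \<in> B" using stB aB(1) ik \<open>i < r\<close> by (simp add: gl_stable_def)
        moreover have "rowpol C i k b \<in> V'" using st' aB(2) ik \<open>i < r\<close> by (simp add: gl_stable_def)
        then have "rowpol C i k a \<in> V'" unfolding eq using ss' by (rule mp.subspace_scale[rotated])
        ultimately have "rowpol C i k a = 0" using int by blast
        then show ?thesis using eq by simp
      qed
      then have "hw r C a" "hw r C b" by (auto simp: hw_def)
      then show ?thesis using ab by (auto simp: hwpart_wtpart)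
    qed
    have dimw: "mp.dim (wtpart \<alpha> V) = mp.dim (wtpart \<alpha> B) + mp.dim (wtpart \<alpha> V')"
    proof (rule dim_direct_sum[OF subspace_wtpart[OF ssB] subspace_wtpart[OF ss'] S(1)])
      show "wtpart \<alpha> B \<subseteq> polys_on S" "wtpart \<alpha> V' \<subseteq> polys_on S" using BV V'V VS by (auto simp: wtpart_def)
      show "wtpart \<alpha> B \<inter> wtpart \<alpha> V' = {0}"
        using int mp.subspace_0[OF subspace_wtpart[OF ssB]] mp.subspace_0[OF subspace_wtpart[OF ss']]
        by (auto simp: wtpart_def)
      show "wtpart \<alpha> V = {a + b |a b. a \<in> wtpart \<alpha> B \<and> b \<in> wtpart \<alpha> V'}"
      proof (intro equalityI subsetI)
        fix f assume "f \<in> {a + b |a b. a \<in> wtpart \<alpha> B \<and> b \<in> wtpart \<alpha> V'}"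
        then obtain a b where ab: "f = a + b" "a \<in> wtpart \<alpha> B" "b \<in> wtpart \<alpha> V'" by blast
        then have "a \<in> wtpart \<alpha> V" "b \<in> wtpart \<alpha> V" using BV V'V by (auto simp: wtpart_def)
        then show "f \<in> wtpart \<alpha> V" unfolding ab(1) by (rule mp.subspace_add[OF subspace_wtpart[OF ss]])
      qed (use wdecomp in blast)
    qed
    have dimh: "mp.dim (hwpart r C \<mu> V) = mp.dim (hwpart r C \<mu> B) + mp.dim (hwpart r C \<mu> V')" for \<mu>
    proof (rule dim_direct_sum[OF subspace_hwpart[OF ssB] subspace_hwpart[OF ss'] S(1)])
      show "hwpart r C \<mu> B \<subseteq> polys_on S" "hwpart r C \<mu> V' \<subseteq> polys_on S" using BV V'V VS by (auto simp: hwpart_def)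
      show "hwpart r C \<mu> B \<inter> hwpart r C \<mu> V' = {0}"
        using int mp.subspace_0[OF subspace_hwpart[OF ssB]] mp.subspace_0[OF subspace_hwpart[OF ss']]
        by (auto simp: hwpart_def)
      show "hwpart r C \<mu> V = {a + b |a b. a \<in> hwpart r C \<mu> B \<and> b \<in> hwpart r C \<mu> V'}"
      proof (intro equalityI subsetI)
        fix f assume "f \<in> {a + b |a b. a \<in> hwpart r C \<mu> B \<and> b \<in> hwpart r C \<mu> V'}"
        then obtain a b where ab: "f = a + b" "a \<in> hwpart r C \<mu> B" "b \<in> hwpart r C \<mu> V'" by blast
        then have "a \<in> hwpart r C \<mu> V" "b \<in> hwpart r C \<mu> V" using BV V'V by (auto simp: hwpart_def)
        then show "f \<in> hwpart r C \<mu> V" unfolding ab(1) by (rule mp.subspace_add[OF subspace_hwpart[OF ss]])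
      qed (use hdecomp in blast)
    qed
    have hB: "mp.dim (hwpart r C \<mu> B) = (if \<mu> = \<nu> then 1 else 0)" if "\<mu> \<in> M" for \<mu>
    proof (cases "\<mu> = \<nu>")
      case True
      have "hwpart r C \<mu> B = mp.span {v}"
      proof (intro equalityI subsetI)
        fix x assume "x \<in> hwpart r C \<mu> B"
        then obtain c where "x = c *\<^sub>p v" using gl_span_hw[OF v(4,3) vb', of x] by (auto simp: hwpart_def B_def)
        then show "x \<in> mp.span {v}" by (simp add: mp.span_scale mp.span_base)
      next
        fix x assume "x \<in> mp.span {v}"
        moreover have "mp.span {v} \<subseteq> hwpart r C \<mu> B"
          using vB v(3,4) True \<nu>(4) by (intro mp.span_minimal subspace_hwpart ssB) (simp add: hwpart_def)
        ultimately show "x \<in> hwpart r C \<mu> B" by blast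
      qed
      then show ?thesis using dim_span_single[OF v(2)] True by simp
    next
      case False
      have "x = 0" if x: "x \<in> hwpart r C \<mu> B" for x
      proof (rule ccontr)
        assume "x \<noteq> 0"
        obtain c where c: "x = c *\<^sub>p v" using x gl_span_hw[OF v(4,3) vb', of x] by (auto simp: hwpart_def B_def)
        obtain m where m: "m \<in> keys x" using \<open>x \<noteq> 0\<close> by (metis equals0I keys_eq_empty)
        then have "m \<in> keys v" unfolding c by (auto simp: in_keys_iff)
        then have "pwt \<mu> = pwt \<nu>" using x m v(3) \<nu>(4) by (auto simp: hwpart_def weight_hom_def)
        then show False using False pwt_inj M(2)[OF \<open>\<mu> \<in> M\<close>] \<nu>(1) by blast
      qed
      then have "hwpart r C \<mu> B = {0}" using mp.subspace_0[OF subspace_hwpart[OF ssB]] by blast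
      then show ?thesis using False by simp
    qed
    have dimV: "mp.dim V = mp.dim B + mp.dim V'"
    proof (rule dim_direct_sum[OF ssB ss' S(1)])
      show "B \<subseteq> polys_on S" "V' \<subseteq> polys_on S" using BV V'V VS by auto
      show "B \<inter> V' = {0}" using int mp.subspace_0[OF ssB] mp.subspace_0[OF ss'] by blast
      show "V = {a + b |a b. a \<in> B \<and> b \<in> V'}"
      proof (intro equalityI subsetI)
        fix f assume "f \<in> V"
        then obtain a where "a \<in> B" "f - a \<in> V'" using decomp by blast
        moreover have "f = a + (f - a)" by simp
        ultimately show "f \<in> {a + b |a b. a \<in> B \<and> b \<in> V'}" by blast
      next
        fix f assume "f \<in> {a + b |a b. a \<in> B \<and> b \<in> V'}"
        then show "f \<in> V" using BV V'V mp.subspace_add[OF ss] by blast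
      qed
    qed
    have "mp.dim B \<noteq> 0" using dim_eq_0D[OF ssB S(1) order_trans[OF BV VS]] vB v(2) by blast
    then have lt: "mp.dim V' < mp.dim V" using dimV by simp
    have MV': "\<mu> \<in> M" if "is_partition \<mu>" "length \<mu> \<le> n" "hwpart r C \<mu> V' \<noteq> {0}" for \<mu>
    proof -
      have "0 \<in> hwpart r C \<mu> V'" "0 \<in> hwpart r C \<mu> V"
        using mp.subspace_0[OF subspace_hwpart[OF ss']] mp.subspace_0[OF subspace_hwpart[OF ss]] by auto
      moreover have "hwpart r C \<mu> V' \<subseteq> hwpart r C \<mu> V" using V'V by (auto simp: hwpart_def)
      ultimately have "hwpart r C \<mu> V \<noteq> {0}" using that(3) by blast
      then show ?thesis using MV that by blast
    qed
    have IH: "mp.dim (wtpart \<alpha> V') = (\<Sum>\<mu>\<in>M. mp.dim (hwpart r C \<mu> V') * kostka r \<mu> \<alpha>)"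
      by (rule less.hyps[OF lt st' order_trans[OF V'V VS] MV'])
    have "mp.dim (wtpart \<alpha> B) = kostka r \<nu> \<alpha>"
      unfolding B_def using \<nu> C v by (intro dim_gl_span[OF _ _ _ vb]) auto
    also have "\<dots> = (\<Sum>\<mu>\<in>M. (if \<mu> = \<nu> then 1 else 0) * kostka r \<mu> \<alpha>)"
      using \<nu>M M(1) by (simp add: if_distrib[where f = "\<lambda>x. x * _"] cong: if_cong)
    also have "\<dots> = (\<Sum>\<mu>\<in>M. mp.dim (hwpart r C \<mu> B) * kostka r \<mu> \<alpha>)"
      by (intro sum.cong) (simp_all add: hB)
    finally show ?thesis unfolding dimw dimh IH by (simp add: sum.distrib algebra_simps)
  qed
qed

section \<open>Invariants of the group\<close>

definition cperm :: "(nat \<Rightarrow> nat) \<Rightarrow> monom \<Rightarrow> monom" where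
  "cperm \<pi> m = Poly_Mapping.map_key (map_prod id \<pi>) m"

lemma lookup_cperm:
  assumes "\<pi> permutes S" shows "lookup (cperm \<pi> m) (i, j) = lookup m (i, \<pi> j)"
proof -
  have inj: "inj (map_prod id \<pi> :: nat \<times> nat \<Rightarrow> nat \<times> nat)"
    using permutes_inj[OF assms] by (intro prod.inj_map) auto
  have "lookup (cperm \<pi> m) x = lookup m (map_prod id \<pi> x)" for x
    unfolding cperm_def using Poly_Mapping.map_key.rep_eq[OF inj, of m] by simp
  then show ?thesis by simp
qed

lemma cperm_eq_iff:
  assumes "\<pi> permutes S" shows "cperm \<pi> m = cperm \<pi> m' \<longleftrightarrow> m = m'"
proof
  assume eq: "cperm \<pi> m = cperm \<pi> m'"
  show "m = m'"
  proof (rule poly_mapping_eqI)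
    fix x :: "nat \<times> nat"
    obtain i j where x: "x = (i, j)" by (cases x)
    have "lookup m (i, \<pi> (inv_into UNIV \<pi> j)) = lookup m' (i, \<pi> (inv_into UNIV \<pi> j))"
      using lookup_cperm[OF assms, of _ i "inv_into UNIV \<pi> j"] eq by metis
    then show "lookup m x = lookup m' x" using permutes_inverses[OF assms] x by simp
  qed
qed simp

lemma cperm_box:
  assumes "\<pi> permutes {..<n}" shows "cperm \<pi> m \<in> box I {..<n} \<longleftrightarrow> m \<in> box I {..<n}"
proof -
  have *: "(i, j) \<in> keys (cperm \<pi> m) \<longleftrightarrow> (i, \<pi> j) \<in> keys m" for i j
    by (simp add: in_keys_iff lookup_cperm[OF assms])
  have img: "\<pi> j < n \<longleftrightarrow> j < n" for j using permutes_in_image[OF assms, of j] by simp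
  have inv: "\<pi> (inv_into UNIV \<pi> j) = j" for j using permutes_inverses[OF assms] by simp
  show ?thesis
  proof
    assume L: "cperm \<pi> m \<in> box I {..<n}"
    have "i \<in> I \<and> j < n" if "(i, j) \<in> keys m" for i j
    proof -
      have "(i, inv_into UNIV \<pi> j) \<in> keys (cperm \<pi> m)" using that *[of i "inv_into UNIV \<pi> j"] inv by simp
      then have "i \<in> I \<and> inv_into UNIV \<pi> j < n" using L unfolding box_def by blast
      then show ?thesis using img[of "inv_into UNIV \<pi> j"] inv by simp
    qed
    then show "m \<in> box I {..<n}" unfolding box_def by auto
  next
    assume L: "m \<in> box I {..<n}"
    have "i \<in> I \<and> j < n" if "(i, j) \<in> keys (cperm \<pi> m)" for i j
    proof -
      have "(i, \<pi> j) \<in> keys m" using that * by simp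
      then have "i \<in> I \<and> \<pi> j < n" using L unfolding box_def by blast
      then show ?thesis using img by simp
    qed
    then show "cperm \<pi> m \<in> box I {..<n}" unfolding box_def by auto
  qed
qed

lemma cperm_md_fst:
  assumes "\<pi> permutes {..<n}" "m \<in> box I {..<n}"
  shows "md fst (cperm \<pi> m) = md fst m"
proof (rule poly_mapping_eqI)
  fix i
  have "lookup (md fst (cperm \<pi> m)) i = (\<Sum>j<n. lookup m (i, \<pi> j))"
    using md_fst_box[of "cperm \<pi> m" I n i] cperm_box[OF assms(1)] assms(2) lookup_cperm[OF assms(1)] by simp
  also have "\<dots> = (\<Sum>j<n. lookup m (i, j))"
    using sum.permute[OF assms(1), of "\<lambda>j. lookup m (i, j)"] by (simp add: comp_def)
  finally show "lookup (md fst (cperm \<pi> m)) i = lookup (md fst m) i" using md_fst_box[OF assms(2)] by simp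
qed

lemma X_power: "X a ^ k = single (single a k) 1"
  by (induction k) (simp_all add: X_def mult_single single_add[symmetric] flip: single_one)

lemma smul_power: "(c *\<^sub>p f) ^ k = (c ^ k) *\<^sub>p (f ^ k)"
  by (induction k) simp_all

lemma prod_smul: "finite I \<Longrightarrow> (\<Prod>i\<in>I. c i *\<^sub>p f i) = (\<Prod>i\<in>I. c i) *\<^sub>p (\<Prod>i\<in>I. f i)"
  by (induction I rule: finite_induct) simp_all

lemma prod_single: "finite I \<Longrightarrow> (\<Prod>i\<in>I. single (a i) (1::complex)) = single (\<Sum>i\<in>I. a i :: monom) 1"
  by (induction I rule: finite_induct) (simp_all add: mult_single)

definition colchar :: "nat \<Rightarrow> (nat \<Rightarrow> complex) \<Rightarrow> monom \<Rightarrow> complex" where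
  "colchar n c m = (\<Prod>j<n. c j ^ lookup (md snd m) j)"

text \<open>The substitution sends the variable (i, j) to c j times the variable (i, \<kappa> j), so
  a monomial becomes a scalar times its transport under \<kappa>. The coefficient at
  \<open>m\<close> comes from the unique preimage \<open>cperm \<kappa> m\<close>.\<close>

lemma lookup_act:
  assumes \<kappa>: "\<kappa> permutes {..<n}"
    and w: "\<And>k j. k < n \<Longrightarrow> j < n \<Longrightarrow> w $$ (k, j) = (if k = \<kappa> j then c j else 0)"
    and f: "f \<in> polys_on (box {..<r} {..<n})"
  shows "lookup (act n w f) m = colchar n c (cperm \<kappa> m) * lookup f (cperm \<kappa> m)"
proof -
  have \<sigma>: "(\<Sum>k<n. Var i k * Const (w $$ (k, j))) = c j *\<^sub>p X (i, \<kappa> j)" if j: "j < n" for i j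
  proof -
    have kj: "\<kappa> j < n" using permutes_in_image[OF \<kappa>, of j] j by simp
    have "(\<Sum>k<n. Var i k * Const (w $$ (k, j))) = (\<Sum>k<n. if k = \<kappa> j then c j *\<^sub>p X (i, \<kappa> j) else 0)"
      using j by (intro sum.cong) (auto simp: w Var_def X_def smul_def Const_def mult.commute)
    then show ?thesis using kj by simp
  qed
  define km where "km = (\<lambda>m. \<Sum>a\<in>keys m. single (fst a, \<kappa> (snd a)) (lookup m a) :: monom)"
  have km: "cperm \<kappa> (km q) = q" for q
  proof (rule poly_mapping_eqI)
    fix x :: "nat \<times> nat"
    obtain i j where x: "x = (i, j)" by (cases x)
    have inj: "\<kappa> a = \<kappa> b \<longleftrightarrow> a = b" for a b using permutes_inj[OF \<kappa>] by (auto dest: injD)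
    have "lookup (cperm \<kappa> (km q)) x = (\<Sum>a\<in>keys q. if a = (i, j) then lookup q a else 0)"
      unfolding x lookup_cperm[OF \<kappa>] km_def lookup_sum
      by (intro sum.cong) (auto simp: lookup_single when_def inj)
    also have "\<dots> = lookup q x" unfolding x by (simp add: in_keys_iff)
    finally show "lookup (cperm \<kappa> (km q)) x = lookup q x" .
  qed
  have mon_image: "(\<Prod>(i, j)\<in>keys q. (\<Sum>k<n. Var i k * Const (w $$ (k, j))) ^ lookup q (i, j)) =
      colchar n c q *\<^sub>p single (km q) 1" if q: "q \<in> keys f" for q
  proof -
    have qb: "q \<in> box {..<r} {..<n}" using f q by (auto simp: polys_on_def)
    have "(\<Prod>(i, j)\<in>keys q. (\<Sum>k<n. Var i k * Const (w $$ (k, j))) ^ lookup q (i, j)) =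
      (\<Prod>a\<in>keys q. (c (snd a) ^ lookup q a) *\<^sub>p single (single (fst a, \<kappa> (snd a)) (lookup q a)) 1)"
    proof (rule prod.cong)
      fix a assume a: "a \<in> keys q"
      obtain i j where ij: "a = (i, j)" by (cases a)
      have "j < n" using qb a ij unfolding box_def by blast
      then show "(case a of (i, j) \<Rightarrow> (\<Sum>k<n. Var i k * Const (w $$ (k, j))) ^ lookup q (i, j)) =
        (c (snd a) ^ lookup q a) *\<^sub>p single (single (fst a, \<kappa> (snd a)) (lookup q a)) 1"
        by (simp add: ij \<sigma> smul_power X_power)
    qed simp
    also have "\<dots> = (\<Prod>a\<in>keys q. c (snd a) ^ lookup q a) *\<^sub>p single (km q) 1"
      by (simp add: prod_smul prod_single km_def)
    also have "(\<Prod>a\<in>keys q. c (snd a) ^ lookup q a) = (\<Prod>a\<in>{..<r} \<times> {..<n}. c (snd a) ^ lookup q a)"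
      using qb by (intro prod.mono_neutral_left) (auto simp: box_def in_keys_iff)
    also have "\<dots> = (\<Prod>i<r. \<Prod>j<n. c j ^ lookup q (i, j))"
      by (simp add: prod.cartesian_product case_prod_unfold)
    also have "\<dots> = (\<Prod>j<n. \<Prod>i<r. c j ^ lookup q (i, j))" by (rule prod.swap)
    also have "\<dots> = colchar n c q"
      by (simp add: colchar_def md_snd_box[OF qb] power_sum)
    finally show ?thesis .
  qed
  have "act n w f = (\<Sum>q\<in>keys f. (lookup f q * colchar n c q) *\<^sub>p single (km q) 1)"
    unfolding act_def subst_def by (intro sum.cong) (auto simp: mon_image smul_def[symmetric])
  then have "lookup (act n w f) m = (\<Sum>q\<in>keys f. if km q = m then lookup f q * colchar n c q else 0)"
    by (simp add: lookup_sum lookup_single when_def if_distrib cong: if_cong)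
  also have "\<dots> = (\<Sum>q\<in>keys f. if q = cperm \<kappa> m then lookup f (cperm \<kappa> m) * colchar n c (cperm \<kappa> m) else 0)"
  proof (rule sum.cong)
    fix q
    have "km q = m \<longleftrightarrow> q = cperm \<kappa> m" using km[of q] cperm_eq_iff[OF \<kappa>, of "km q" m] by auto
    then show "(if km q = m then lookup f q * colchar n c q else 0)
      = (if q = cperm \<kappa> m then lookup f (cperm \<kappa> m) * colchar n c (cperm \<kappa> m) else 0)" by auto
  qed simp
  also have "\<dots> = colchar n c (cperm \<kappa> m) * lookup f (cperm \<kappa> m)"
    by (simp add: in_keys_iff)
  finally show ?thesis .
qed

lemma G_monomial:
  assumes "w \<in> G p 1 n"
  obtains \<kappa> c where "\<kappa> permutes {..<n}" "\<And>j. j < n \<Longrightarrow> c j ^ p = 1"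
    "\<And>k j. k < n \<Longrightarrow> j < n \<Longrightarrow> w $$ (k, j) = (if k = \<kappa> j then c j else 0)"
proof -
  have row: "\<exists>!j. j < n \<and> w $$ (i, j) \<noteq> 0" if "i < n" for i
    using assms that by (auto simp: G_def monomial_mat_def)
  have col: "\<exists>!i. i < n \<and> w $$ (i, j) \<noteq> 0" if "j < n" for j
    using assms that by (auto simp: G_def monomial_mat_def)
  define \<kappa> where "\<kappa> = (\<lambda>j. if j < n then (THE i. i < n \<and> w $$ (i, j) \<noteq> 0) else j)"
  define c where "c = (\<lambda>j. w $$ (\<kappa> j, j))"
  have \<kappa>: "\<kappa> j < n \<and> w $$ (\<kappa> j, j) \<noteq> 0" if "j < n" for j
    using theI'[OF col[OF that]] that by (simp add: \<kappa>_def)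
  have uniq: "k = \<kappa> j" if "k < n" "j < n" "w $$ (k, j) \<noteq> 0" for k j
    using col[OF that(2)] \<kappa>[OF that(2)] that by blast
  have "inj_on \<kappa> {..<n}"
  proof (rule inj_onI)
    fix a b assume ab: "a \<in> {..<n}" "b \<in> {..<n}" "\<kappa> a = \<kappa> b"
    then show "a = b" using row[of "\<kappa> a"] \<kappa>[of a] \<kappa>[of b] by (metis lessThan_iff)
  qed
  then have bij: "bij_betw \<kappa> {..<n} {..<n}"
    using \<kappa> by (intro bij_betw_imageI endo_inj_surj) auto
  have "\<kappa> permutes {..<n}"
    by (rule bij_imp_permutes[OF bij]) (simp add: \<kappa>_def)
  moreover have "c j ^ p = 1" if "j < n" for j
    using assms \<kappa>[OF that] that by (auto simp: G_def nonzero_positions_def c_def)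
  moreover have "w $$ (k, j) = (if k = \<kappa> j then c j else 0)" if "k < n" "j < n" for k j
    using uniq[OF that] by (auto simp: c_def)
  ultimately show ?thesis using that by blast
qed

lemma G_memI:
  assumes \<kappa>: "\<kappa> permutes {..<n}" and c: "\<And>j. j < n \<Longrightarrow> c j ^ p = 1" and p: "p \<ge> 1"
  shows "mat n n (\<lambda>(k, j). if k = \<kappa> j then c j else 0) \<in> G p 1 n"
proof -
  let ?w = "mat n n (\<lambda>(k, j). if k = \<kappa> j then c j else 0)"
  have nz: "c j \<noteq> 0" if "j < n" for j using c[OF that] p by (auto simp: zero_power)
  have e: "?w $$ (k, j) \<noteq> 0 \<longleftrightarrow> k = \<kappa> j" if "k < n" "j < n" for k j using that nz by simp
  have kn: "\<kappa> j < n" if "j < n" for j using permutes_in_image[OF \<kappa>, of j] that by simp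
  let ?i = "inv_into UNIV \<kappa>"
  have ki: "?i i < n" if "i < n" for i using permutes_in_image[OF permutes_inv[OF \<kappa>], of i] that by simp
  have inv: "\<kappa> (?i i) = i" "?i (\<kappa> i) = i" for i using permutes_inverses[OF \<kappa>] by auto
  have "\<exists>!j. j < n \<and> ?w $$ (i, j) \<noteq> 0" if i: "i < n" for i
  proof (rule ex1I[of _ "?i i"])
    show "?i i < n \<and> ?w $$ (i, ?i i) \<noteq> 0" using e[OF i ki[OF i]] ki[OF i] inv(1)[of i] by simp
    show "j = ?i i" if "j < n \<and> ?w $$ (i, j) \<noteq> 0" for j
      using e[OF i, of j] that inv(2)[of j] by simp
  qed
  moreover have "\<exists>!i. i < n \<and> ?w $$ (i, j) \<noteq> 0" if j: "j < n" for j
    by (rule ex1I[of _ "\<kappa> j"]) (use e[OF _ j] kn[OF j] in blast)+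
  ultimately have mono: "monomial_mat n ?w" by (simp add: monomial_mat_def)
  have pw: "(?w $$ ij) ^ p = 1" if "ij \<in> nonzero_positions n ?w" for ij
    using that c by (auto simp: nonzero_positions_def split: if_splits)
  then have "(\<Prod>ij\<in>nonzero_positions n ?w. ?w $$ ij) ^ p = 1"
    by (simp add: prod_power_distrib)
  then show ?thesis using mono pw by (simp add: G_def)
qed

text \<open>A description without matrices of the invariants with zero constant term
  (\<open>pos_invariants_eq\<close>), from which stability under row polarizations can be read
  off.\<close>

definition pinv :: "nat \<Rightarrow> nat \<Rightarrow> nat \<Rightarrow> mpoly set" where
  "pinv p r n = {f \<in> polys_on (box {..<r} {..<n}). lookup f 0 = 0 \<and>
     (\<forall>\<pi>. \<pi> permutes {..<n} \<longrightarrow> (\<forall>m. lookup f (cperm \<pi> m) = lookup f m)) \<and>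
     (\<forall>m\<in>keys f. \<forall>j<n. p dvd lookup (md snd m) j)}"

lemma carrier_poly_ring: "carrier (poly_ring r n) = polys_on (box {..<r} {..<n})"
  by (auto simp: poly_ring_def polys_on_def box_def)

lemma primitive_root: fixes p k :: nat assumes "p \<ge> 1" shows "cis (2 * pi / p) ^ k = 1 \<longleftrightarrow> p dvd k"
proof
  assume "cis (2 * pi / p) ^ k = 1"
  then have "cis (real k * (2 * pi / p)) = 1" by (simp add: Complex.DeMoivre)
  then have "cos (real k * (2 * pi / p)) = 1" by (simp add: complex_eq_iff)
  then obtain x :: int where "real k * (2 * pi / p) = of_int x * 2 * pi" by (auto simp: cos_one_2pi_int)
  then have "real k = of_int x * real p" using assms by (simp add: field_simps)
  then have "int k = x * int p" by (metis of_int_eq_iff of_int_mult of_int_of_nat_eq)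
  then have "int p dvd int k" by simp
  then show "p dvd k" by simp
next
  assume "p dvd k"
  then obtain q where q: "k = p * q" by blast
  have "cis (2 * pi / p) ^ p = 1" using assms by (simp add: Complex.DeMoivre)
  then show "cis (2 * pi / p) ^ k = 1" unfolding q power_mult by simp
qed

text \<open>Permutation matrices force symmetry in the columns, and a diagonal matrix with one
  primitive p-th root of unity and otherwise 1 forces p to divide a column degree. Conversely every
  group element permutes the columns and multiplies coefficients by p-th roots of unity raised to
  column degrees.\<close>

lemma pos_invariants_eq:
  assumes p: "p \<ge> 1"
  shows "pos_invariants (G p 1 n) r n = pinv p r n"
proof (intro equalityI subsetI)
  fix f assume f: "f \<in> pos_invariants (G p 1 n) r n"
  then have fb: "f \<in> polys_on (box {..<r} {..<n})" and f0: "lookup f 0 = 0"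
    and inv: "\<And>w. w \<in> G p 1 n \<Longrightarrow> act n w f = f"
    by (auto simp: pos_invariants_def carrier_poly_ring)
  have "lookup f (cperm \<pi> m) = lookup f m" if \<pi>: "\<pi> permutes {..<n}" for \<pi> m
  proof -
    let ?w = "mat n n (\<lambda>(k, j). if k = \<pi> j then 1 else 0) :: complex mat"
    have "?w \<in> G p 1 n" using G_memI[OF \<pi>, of "\<lambda>_. 1" p] p by simp
    then have "lookup f m = lookup (act n ?w f) m" using inv by simp
    also have "\<dots> = colchar n (\<lambda>_. 1) (cperm \<pi> m) * lookup f (cperm \<pi> m)"
      by (rule lookup_act[OF \<pi> _ fb]) simp
    finally show ?thesis by (simp add: colchar_def)
  qed
  moreover have "p dvd lookup (md snd m) j" if m: "m \<in> keys f" and j: "j < n" for m j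
  proof -
    let ?z = "cis (2 * pi / p)"
    let ?c = "\<lambda>k. if k = j then ?z else 1"
    let ?w = "mat n n (\<lambda>(k, l). if k = id l then ?c l else 0) :: complex mat"
    have z: "?z ^ p = 1" using primitive_root[OF p, of p] by simp
    have "?w \<in> G p 1 n" using z p by (intro G_memI permutes_id) auto
    then have "lookup f m = lookup (act n ?w f) m" using inv by simp
    also have "\<dots> = colchar n ?c (cperm id m) * lookup f (cperm id m)"
      by (rule lookup_act[OF permutes_id _ fb]) simp
    also have "cperm id m = m"
    proof (rule poly_mapping_eqI)
      fix x :: "nat \<times> nat"
      show "lookup (cperm id m) x = lookup m x" by (cases x) (simp add: lookup_cperm[OF permutes_id])
    qed
    finally have "colchar n ?c m = 1" using m by (simp add: in_keys_iff)
    moreover have "colchar n ?c m = (\<Prod>k<n. if k = j then ?z ^ lookup (md snd m) j else 1)"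
      unfolding colchar_def by (intro prod.cong) auto
    ultimately have "?z ^ lookup (md snd m) j = 1" using j by simp
    then show ?thesis using primitive_root[OF p] by simp
  qed
  ultimately show "f \<in> pinv p r n" using fb f0 by (simp add: pinv_def)
next
  fix f assume f: "f \<in> pinv p r n"
  then have fb: "f \<in> polys_on (box {..<r} {..<n})" by (simp add: pinv_def)
  have "act n w f = f" if w: "w \<in> G p 1 n" for w
  proof (rule poly_mapping_eqI)
    fix m
    obtain \<kappa> c where \<kappa>: "\<kappa> permutes {..<n}" and c: "\<And>j. j < n \<Longrightarrow> c j ^ p = 1"
      and wk: "\<And>k j. k < n \<Longrightarrow> j < n \<Longrightarrow> w $$ (k, j) = (if k = \<kappa> j then c j else 0)"
      by (rule G_monomial[OF w]) blast
    have "lookup (act n w f) m = colchar n c (cperm \<kappa> m) * lookup f (cperm \<kappa> m)"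
      by (rule lookup_act[OF \<kappa> wk fb])
    also have "\<dots> = lookup f (cperm \<kappa> m)"
    proof (cases "cperm \<kappa> m \<in> keys f")
      case True
      have "c j ^ lookup (md snd (cperm \<kappa> m)) j = 1" if j: "j < n" for j
      proof -
        have "p dvd lookup (md snd (cperm \<kappa> m)) j" using f True j by (simp add: pinv_def)
        then obtain q where "lookup (md snd (cperm \<kappa> m)) j = p * q" by blast
        then show ?thesis using c[OF j] by (simp add: power_mult)
      qed
      then show ?thesis by (simp add: colchar_def)
    qed (simp add: in_keys_iff)
    also have "\<dots> = lookup f m" using f \<kappa> by (simp add: pinv_def)
    finally show "lookup (act n w f) m = lookup f m" .
  qed
  then show "f \<in> pos_invariants (G p 1 n) r n"
    using f by (simp add: pos_invariants_def carrier_poly_ring pinv_def)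
qed

section \<open>The coinvariant ideal and its orthogonal complement\<close>

abbreviation mpolys :: "nat \<Rightarrow> nat \<Rightarrow> mpoly set" where
  "mpolys r n \<equiv> polys_on (box {..<r} {..<n})"

lemma box_add_iff: "m + m' \<in> box I J \<longleftrightarrow> m \<in> box I J \<and> m' \<in> box I J"
proof -
  have "keys (m + m') = keys m \<union> keys m'" for m m' :: monom
    by (auto simp: in_keys_iff lookup_add)
  then show ?thesis by (auto simp: box_def)
qed

lemma mpolys_mult: "f \<in> polys_on (box I J) \<Longrightarrow> g \<in> polys_on (box I J) \<Longrightarrow> f * g \<in> polys_on (box I J)"
proof -
  assume fg: "f \<in> polys_on (box I J)" "g \<in> polys_on (box I J)"
  show ?thesis unfolding polys_on_def
  proof (intro CollectI subsetI)
    fix m assume "m \<in> keys (f * g)"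
    then obtain a b where "m = a + b" "a \<in> keys f" "b \<in> keys g" using subsetD[OF keys_mult] by blast
    then show "m \<in> box I J" using fg by (auto simp: polys_on_def box_add_iff)
  qed
qed

lemma mpolys_single: "m \<in> box I J \<Longrightarrow> single m c \<in> polys_on (box I J)"
  by (auto simp: polys_on_def)

lemma mpolys_one: "1 \<in> polys_on (box I J)"
  by (auto simp: polys_on_def box_def)

lemma polys_on_add: "f \<in> polys_on S \<Longrightarrow> g \<in> polys_on S \<Longrightarrow> f + g \<in> polys_on S"
  using subspace_polys_on by (rule mp.subspace_add)

lemma polys_on_zero: "0 \<in> polys_on S"
  by (simp add: polys_on_def)

lemma polys_on_uminus: "f \<in> polys_on S \<Longrightarrow> - f \<in> polys_on S"
  using subspace_polys_on by (rule mp.subspace_neg)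

lemma poly_ring_simps:
  "carrier (poly_ring r n) = mpolys r n"
  "x \<oplus>\<^bsub>poly_ring r n\<^esub> y = x + y" "x \<otimes>\<^bsub>poly_ring r n\<^esub> y = x * y"
  "\<zero>\<^bsub>poly_ring r n\<^esub> = 0" "\<one>\<^bsub>poly_ring r n\<^esub> = 1"
  by (simp_all add: carrier_poly_ring) (simp_all add: poly_ring_def)

lemma cring_poly_ring: "cring (poly_ring r n)"
proof (rule cringI)
  show "abelian_group (poly_ring r n)"
  proof (rule abelian_groupI)
    fix x assume "x \<in> carrier (poly_ring r n)"
    then show "\<exists>y\<in>carrier (poly_ring r n). y \<oplus>\<^bsub>poly_ring r n\<^esub> x = \<zero>\<^bsub>poly_ring r n\<^esub>"
      by (intro bexI[of _ "- x"]) (auto simp: poly_ring_simps polys_on_uminus)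
  qed (auto simp: poly_ring_simps polys_on_add polys_on_zero algebra_simps)
  show "Group.comm_monoid (poly_ring r n)"
    by (rule comm_monoidI) (auto simp: poly_ring_simps mpolys_mult mpolys_one algebra_simps)
qed (auto simp: poly_ring_simps algebra_simps)

lemma poly_ring_a_inv:
  assumes "x \<in> mpolys r n" shows "\<ominus>\<^bsub>poly_ring r n\<^esub> x = - x"
proof -
  interpret cring "poly_ring r n" by (rule cring_poly_ring)
  show ?thesis using assms by (intro minus_equality) (auto simp: poly_ring_simps polys_on_uminus)
qed

text \<open>The span of the products is closed under multiplication since the ring is commutative;
  conversely an ideal is a subspace because constants belong to the ring. The resulting form admits
  induction over linear combinations.\<close>

lemma genideal_poly_ring:
  assumes S: "S \<subseteq> mpolys r n"
  shows "genideal (poly_ring r n) S = mp.span {g * h | g h. g \<in> S \<and> h \<in> mpolys r n}"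
proof
  interpret R: cring "poly_ring r n" by (rule cring_poly_ring)
  let ?B = "{g * h | g h. g \<in> S \<and> h \<in> mpolys r n}"
  have B: "?B \<subseteq> mpolys r n" using S by (auto intro: mpolys_mult)
  have sub: "mp.span ?B \<subseteq> mpolys r n" using B subspace_polys_on by (rule mp.span_minimal)
  have mult: "x * f \<in> mp.span ?B" if x: "x \<in> mpolys r n" and "f \<in> mp.span ?B" for x f
    using that(2)
  proof (induction rule: mp.span_induct_alt)
    case (step c a b)
    obtain g h where gh: "a = g * h" "g \<in> S" "h \<in> mpolys r n" using step(1) by blast
    then have "x * a = g * (x * h)" by (simp add: ac_simps)
    then have "x * a \<in> ?B" using gh x mpolys_mult by blast
    then have "x * a \<in> mp.span ?B" by (rule mp.span_base)
    then have "c *\<^sub>p (x * a) + x * b \<in> mp.span ?B"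
      by (intro mp.span_add[OF mp.span_scale step(2)])
    then show ?case by (simp add: distrib_left)
  qed (simp add: mp.span_zero)
  have "ideal (mp.span ?B) (poly_ring r n)"
  proof (rule idealI)
    show "ring (poly_ring r n)" by (rule R.ring_axioms)
    show "subgroup (mp.span ?B) (add_monoid (poly_ring r n))"
    proof (rule subgroup.intro)
      show "mp.span ?B \<subseteq> carrier (add_monoid (poly_ring r n))" using sub by (simp add: poly_ring_simps)
      show "inv\<^bsub>add_monoid (poly_ring r n)\<^esub> x \<in> mp.span ?B" if "x \<in> mp.span ?B" for x
        using that sub poly_ring_a_inv[of x r n] mp.span_neg[OF that] by (auto simp: a_inv_def)
    qed (auto simp: poly_ring_simps mp.span_add mp.span_zero)
    show "x \<otimes>\<^bsub>poly_ring r n\<^esub> a \<in> mp.span ?B" if "a \<in> mp.span ?B" "x \<in> carrier (poly_ring r n)" for a x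
      using mult that by (simp add: poly_ring_simps)
    show "a \<otimes>\<^bsub>poly_ring r n\<^esub> x \<in> mp.span ?B" if "a \<in> mp.span ?B" "x \<in> carrier (poly_ring r n)" for a x
      using mult that by (simp add: poly_ring_simps mult.commute[of a x])
  qed
  moreover have "S \<subseteq> mp.span ?B"
  proof
    fix g assume "g \<in> S"
    then have "g * 1 \<in> ?B" using mpolys_one by blast
    then have "g * 1 \<in> mp.span ?B" by (rule mp.span_base)
    then show "g \<in> mp.span ?B" by simp
  qed
  ultimately show "genideal (poly_ring r n) S \<subseteq> mp.span ?B" by (rule R.genideal_minimal)
  have id: "ideal (genideal (poly_ring r n) S) (poly_ring r n)"
    using S by (intro R.genideal_ideal) (simp add: poly_ring_simps)
  interpret I: ideal "genideal (poly_ring r n) S" "poly_ring r n" by (rule id)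
  have S_in: "S \<subseteq> genideal (poly_ring r n) S"
    using S by (intro R.genideal_self) (simp add: poly_ring_simps)
  have add: "a + b \<in> genideal (poly_ring r n) S"
    if "a \<in> genideal (poly_ring r n) S" "b \<in> genideal (poly_ring r n) S" for a b
    using I.a_closed[OF that] by (simp add: poly_ring_simps)
  have mul: "a * x \<in> genideal (poly_ring r n) S"
    if "a \<in> genideal (poly_ring r n) S" "x \<in> mpolys r n" for a x
    using I.I_r_closed[of a x] that by (simp add: poly_ring_simps)
  have "mp.subspace (genideal (poly_ring r n) S)"
  proof (rule mp.subspaceI)
    show "0 \<in> genideal (poly_ring r n) S" using I.zero_closed by (simp add: poly_ring_simps)
    fix c f assume f: "f \<in> genideal (poly_ring r n) S"
    have "f * Const c \<in> genideal (poly_ring r n) S"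
      using f by (intro mul) (auto simp: Const_def polys_on_def box_def)
    then show "c *\<^sub>p f \<in> genideal (poly_ring r n) S" by (simp add: smul_def mult.commute)
  qed (rule add)
  moreover have "?B \<subseteq> genideal (poly_ring r n) S" using S_in mul by blast
  ultimately show "mp.span ?B \<subseteq> genideal (poly_ring r n) S" by (intro mp.span_minimal)
qed

section \<open>Stability of the ideal under row polarizations and weight components\<close>

definition inv_ideal :: "nat \<Rightarrow> nat \<Rightarrow> nat \<Rightarrow> mpoly set" where
  "inv_ideal p r n = mp.span {g * h | g h. g \<in> pinv p r n \<and> h \<in> mpolys r n}"

lemma coinv_ideal_eq:
  assumes "p \<ge> 1" shows "coinv_ideal (G p 1 n) r n = inv_ideal p r n"
  unfolding coinv_ideal_def inv_ideal_def pos_invariants_eq[OF assms]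
  by (rule genideal_poly_ring) (auto simp: pinv_def)

lemma inv_ideal_subset: "inv_ideal p r n \<subseteq> mpolys r n"
  unfolding inv_ideal_def by (rule mp.span_minimal) (auto intro: mpolys_mult subspace_polys_on simp: pinv_def)

lemma subspace_inv_ideal: "mp.subspace (inv_ideal p r n)"
  by (simp add: inv_ideal_def)

lemma inv_ideal_base: "g \<in> pinv p r n \<Longrightarrow> h \<in> mpolys r n \<Longrightarrow> g * h \<in> inv_ideal p r n"
  unfolding inv_ideal_def by (intro mp.span_base) blast

lemma inv_ideal_mult: assumes "f \<in> inv_ideal p r n" "x \<in> mpolys r n" shows "f * x \<in> inv_ideal p r n"
  using assms(1) unfolding inv_ideal_def
proof (induction rule: mp.span_induct_alt)
  case (step c a b)
  obtain g h where gh: "a = g * h" "g \<in> pinv p r n" "h \<in> mpolys r n" using step(1) by blast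
  then have "g * (h * x) \<in> inv_ideal p r n" using assms(2) by (intro inv_ideal_base mpolys_mult)
  then show ?case using step(2) gh
    by (auto simp: distrib_right mult.assoc inv_ideal_def intro!: mp.span_add mp.span_scale)
qed (simp add: mp.span_zero)

lemma rowpol_mpolys:
  assumes "f \<in> mpolys r n" "i < r" shows "rowpol C i k f \<in> mpolys r n"
  unfolding polys_on_def
proof (intro CollectI subsetI)
  fix m assume "m \<in> keys (rowpol C i k f)"
  then obtain j m' where j: "m' \<in> keys f" "m + single (k, j) 1 = m' + single (i, j) 1" "lookup m' (k, j) > 0"
    by (rule keys_rowpol) blast
  have m'b: "m' \<in> box {..<r} {..<n}" using assms(1) j(1) by (auto simp: polys_on_def)
  have "(k, j) \<in> keys m'" using j(3) by (simp add: in_keys_iff)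
  then have "j < n" using m'b unfolding box_def by blast
  then show "m \<in> box {..<r} {..<n}" using box_move[OF m'b j(2)] assms(2) by simp
qed

text \<open>A column permutation merely reorders the summands of \<open>rowpol\<close>; as n \<le>
  C, it also permutes the C columns of that sum.\<close>

lemma lookup_rowpol_cperm:
  assumes \<pi>: "\<pi> permutes {..<n}" and C: "n \<le> C"
    and f: "\<And>m. lookup f (cperm \<pi> m) = lookup f m"
  shows "lookup (rowpol C i k f) (cperm \<pi> m) = lookup (rowpol C i k f) m"
proof -
  have \<pi>C: "\<pi> permutes {..<C}" using \<pi> C by (intro permutes_subset[OF \<pi>]) auto
  have inj: "\<pi> a = \<pi> b \<longleftrightarrow> a = b" for a b using permutes_inj[OF \<pi>] by (auto dest: injD)
  have step: "lookup (xd (i, j) (k, j) f) (cperm \<pi> m) = lookup (xd (i, \<pi> j) (k, \<pi> j) f) m" for j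
  proof -
    have eq: "cperm \<pi> m - single (i, j) 1 + single (k, j) 1 = cperm \<pi> (m - single (i, \<pi> j) 1 + single (k, \<pi> j) 1)"
    proof (rule poly_mapping_eqI)
      fix x :: "nat \<times> nat"
      obtain a b where x: "x = (a, b)" by (cases x)
      show "lookup (cperm \<pi> m - single (i, j) 1 + single (k, j) 1) x
        = lookup (cperm \<pi> (m - single (i, \<pi> j) 1 + single (k, \<pi> j) 1)) x"
        unfolding x by (simp add: lookup_cperm[OF \<pi>] lookup_add lookup_minus lookup_single when_def inj)
    qed
    have "lookup f (cperm \<pi> m - single (i, j) 1 + single (k, j) 1) = lookup f (m - single (i, \<pi> j) 1 + single (k, \<pi> j) 1)"
      unfolding eq f ..
    moreover have "lookup (cperm \<pi> m - single (i, j) 1) (k, j) = lookup (m - single (i, \<pi> j) 1) (k, \<pi> j)"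
      by (simp add: lookup_cperm[OF \<pi>] lookup_minus lookup_single when_def)
    ultimately show ?thesis unfolding lookup_xd lookup_cperm[OF \<pi>] by simp
  qed
  have "lookup (rowpol C i k f) (cperm \<pi> m) = (\<Sum>j<C. lookup (xd (i, \<pi> j) (k, \<pi> j) f) m)"
    by (simp add: rowpol_def pol_def lookup_sum step)
  also have "\<dots> = (\<Sum>j<C. lookup (xd (i, j) (k, j) f) m)"
    using sum.permute[OF \<pi>C, of "\<lambda>j. lookup (xd (i, j) (k, j) f) m"] by (simp add: comp_def)
  finally show ?thesis by (simp add: rowpol_def pol_def lookup_sum)
qed

lemma rowpol_pinv:
  assumes f: "f \<in> pinv p r n" and i: "i < r" and C: "n \<le> C"
  shows "rowpol C i k f \<in> pinv p r n"
proof -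
  have "0 \<notin> keys (rowpol C i k f)"
  proof
    assume "0 \<in> keys (rowpol C i k f)"
    from keys_pol[OF this[unfolded rowpol_def]] show False by simp
  qed
  then have "lookup (rowpol C i k f) 0 = 0" by (simp add: in_keys_iff)
  moreover have "rowpol C i k f \<in> mpolys r n" using f i by (intro rowpol_mpolys) (auto simp: pinv_def)
  moreover have "lookup (rowpol C i k f) (cperm \<pi> m) = lookup (rowpol C i k f) m" if "\<pi> permutes {..<n}" for \<pi> m
    using f that by (intro lookup_rowpol_cperm[OF that C]) (simp add: pinv_def)
  moreover have "p dvd lookup (md snd m) j" if m: "m \<in> keys (rowpol C i k f)" and j: "j < n" for m j
  proof -
    obtain q m' where q: "m' \<in> keys f" "m + single (k, q) 1 = m' + single (i, q) 1"
      using m by (rule keys_rowpol) blast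
    have "md snd m = md snd m'" using arg_cong[OF q(2), of "md snd"] by (simp add: md_add)
    then show ?thesis using f q(1) j by (simp add: pinv_def)
  qed
  ultimately show ?thesis by (simp add: pinv_def)
qed

lemma wpart_pinv: assumes f: "f \<in> pinv p r n" shows "wpart \<alpha> f \<in> pinv p r n"
proof -
  have fb: "f \<in> mpolys r n" using f by (simp add: pinv_def)
  have "lookup (wpart \<alpha> f) (cperm \<pi> m) = lookup (wpart \<alpha> f) m" if \<pi>: "\<pi> permutes {..<n}" for \<pi> m
  proof (cases "m \<in> box {..<r} {..<n}")
    case True
    then show ?thesis using f \<pi> cperm_md_fst[OF \<pi> True] by (simp add: wpart_def lookup_rest pinv_def)
  next
    case False
    then have "m \<notin> keys f" "cperm \<pi> m \<notin> keys f" using fb cperm_box[OF \<pi>] by (auto simp: polys_on_def)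
    then show ?thesis by (simp add: wpart_def lookup_rest in_keys_iff)
  qed
  then show ?thesis using f by (auto simp: pinv_def wpart_def polys_on_def lookup_rest)
qed

lemma sum_wpart: "f = (\<Sum>\<beta>\<in>md fst ` keys f. wpart \<beta> f)"
proof (rule poly_mapping_eqI)
  fix m
  have "lookup (\<Sum>\<beta>\<in>md fst ` keys f. wpart \<beta> f) m
      = (\<Sum>\<beta>\<in>md fst ` keys f. if md fst m = \<beta> then lookup f m else 0)"
    by (simp add: lookup_sum wpart_def lookup_rest)
  also have "\<dots> = lookup f m" by (auto simp: in_keys_iff image_iff)
  finally show "lookup f m = lookup (\<Sum>\<beta>\<in>md fst ` keys f. wpart \<beta> f) m" by simp
qed

text \<open>Weight components of invariants are invariants (\<open>wpart_pinv\<close>). A generator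
  of the span expands into products of such a component with a monomial; each product is homogeneous
  and is therefore kept or killed as a whole.\<close>

lemma wpart_inv_ideal: assumes "f \<in> inv_ideal p r n" shows "wpart \<alpha> f \<in> inv_ideal p r n"
  using assms unfolding inv_ideal_def
proof (induction rule: mp.span_induct_alt)
  case (step c a b)
  obtain g h where gh: "a = g * h" "g \<in> pinv p r n" "h \<in> mpolys r n" using step(1) by blast
  have key: "wpart \<alpha> (wpart \<beta> g * single m (lookup h m)) \<in> inv_ideal p r n" if m: "m \<in> keys h" for \<beta> m
  proof -
    let ?t = "wpart \<beta> g * single m (lookup h m)"
    have "weight_hom (\<beta> + md fst m) ?t" unfolding weight_hom_def
    proof
      fix q assume "q \<in> keys ?t"
      then obtain x y where "q = x + y" "x \<in> keys (wpart \<beta> g)" "y \<in> keys (single m (lookup h m))"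
        using subsetD[OF keys_mult] by blast
      then show "md fst q = \<beta> + md fst m" by (auto simp: md_add wpart_def split: if_splits)
    qed
    then have "wpart \<alpha> ?t = (if \<alpha> = \<beta> + md fst m then ?t else 0)" by (rule wpart_hom)
    moreover have "m \<in> box {..<r} {..<n}" using gh(3) m by (auto simp: polys_on_def)
    then have "?t \<in> inv_ideal p r n" using gh(2) by (intro inv_ideal_base wpart_pinv mpolys_single)
    ultimately show ?thesis using subspace_inv_ideal by (simp add: mp.subspace_0)
  qed
  have "a = (\<Sum>\<beta>\<in>md fst ` keys g. wpart \<beta> g) * (\<Sum>m\<in>keys h. single m (lookup h m))"
    unfolding gh(1) using sum_wpart[of g] poly_mapping_sum_single[of h] by simp
  also have "\<dots> = (\<Sum>\<beta>\<in>md fst ` keys g. \<Sum>m\<in>keys h. wpart \<beta> g * single m (lookup h m))"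
    by (rule sum_product)
  finally have "wpart \<alpha> a = (\<Sum>\<beta>\<in>md fst ` keys g. \<Sum>m\<in>keys h. wpart \<alpha> (wpart \<beta> g * single m (lookup h m)))"
    by (simp add: wpart_def rest_sum)
  also have "\<dots> \<in> inv_ideal p r n" using key by (intro mp.subspace_sum[OF subspace_inv_ideal])
  finally show ?case using step(2) by (simp add: inv_ideal_def mp.span_add mp.span_scale)
qed (simp add: mp.span_zero)

lemma rowpol_inv_ideal: assumes "f \<in> inv_ideal p r n" "i < r" "n \<le> C" shows "rowpol C i k f \<in> inv_ideal p r n"
  using assms(1) unfolding inv_ideal_def
proof (induction rule: mp.span_induct_alt)
  case (step c a b)
  obtain g h where gh: "a = g * h" "g \<in> pinv p r n" "h \<in> mpolys r n" using step(1) by blast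
  have "rowpol C i k g * h \<in> inv_ideal p r n" "g * rowpol C i k h \<in> inv_ideal p r n"
    using gh assms by (auto intro!: inv_ideal_base rowpol_pinv rowpol_mpolys)
  then have "rowpol C i k a \<in> inv_ideal p r n" unfolding gh(1) rowpol_mult by (rule mp.subspace_add[OF subspace_inv_ideal])
  then show ?case using step(2) by (simp add: inv_ideal_def mp.span_add mp.span_scale)
qed (simp add: mp.span_zero)

lemma gl_stable_inv_ideal: "n \<le> C \<Longrightarrow> gl_stable r C (inv_ideal p r n)"
  unfolding gl_stable_def using subspace_inv_ideal rowpol_inv_ideal wpart_inv_ideal by blast

lemma gl_stable_mpolys: "gl_stable r C (mpolys r n)"
  unfolding gl_stable_def using subspace_polys_on rowpol_mpolys by (auto simp: wpart_def polys_on_def)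

definition harmonics :: "nat \<Rightarrow> nat \<Rightarrow> nat \<Rightarrow> mpoly set" where
  "harmonics p r n = orth (mpolys r n) (inv_ideal p r n)"

lemma gl_stable_harmonics: "n \<le> C \<Longrightarrow> gl_stable r C (harmonics p r n)"
  unfolding harmonics_def by (intro gl_stable_orth gl_stable_mpolys gl_stable_inv_ideal)

section \<open>Comparison of the harmonics for different numbers of rows\<close>

lemma rest_mult:
  assumes "\<And>m m'. P (m + m') \<longleftrightarrow> P m \<and> P m'"
  shows "rest P (f * g) = rest P f * rest P g"
proof (induction f rule: mpoly_induct)
  case (single a c)
  show ?case
  proof (induction g rule: mpoly_induct)
    case (single b d)
    have rs: "rest P (single a c) = (if P a then single a c else 0)" for a c
      by (rule poly_mapping_eqI) (auto simp: lookup_rest lookup_single when_def)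
    show ?case by (simp add: mult_single rs assms)
  qed (auto simp: algebra_simps)
qed (auto simp: algebra_simps)

lemma box_mono: "r \<le> r' \<Longrightarrow> box {..<r} Q \<subseteq> box {..<r'} Q"
  unfolding box_def by fastforce

lemma pinv_mono: assumes "r \<le> r'" shows "pinv p r n \<subseteq> pinv p r' n"
  unfolding pinv_def polys_on_def using box_mono[OF assms] by blast

lemma inv_ideal_mono: assumes "r \<le> r'" shows "inv_ideal p r n \<subseteq> inv_ideal p r' n"
  unfolding inv_ideal_def
proof (rule mp.span_mono, safe)
  fix g h assume "g \<in> pinv p r n" "h \<in> mpolys r n"
  moreover have "mpolys r n \<subseteq> mpolys r' n" unfolding polys_on_def using box_mono[OF assms] by blast
  ultimately show "\<exists>g' h'. g * h = g' * h' \<and> g' \<in> pinv p r' n \<and> h' \<in> mpolys r' n"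
    using pinv_mono[OF assms] by blast
qed

text \<open>Setting the variables of the rows from r on to 0 is multiplicative
  (\<open>rest_mult\<close>) and maps invariants for r' rows to invariants for r rows.\<close>

lemma rest_box_inv_ideal:
  assumes "r \<le> r'" "f \<in> inv_ideal p r' n" shows "rest (\<lambda>m. m \<in> box {..<r} {..<n}) f \<in> inv_ideal p r n"
  using assms(2) unfolding inv_ideal_def
proof (induction rule: mp.span_induct_alt)
  case (step c a b)
  let ?P = "\<lambda>m. m \<in> box {..<r} {..<n}"
  obtain g h where gh: "a = g * h" "g \<in> pinv p r' n" "h \<in> mpolys r' n" using step(1) by blast
  have "rest ?P g \<in> pinv p r n"
    using gh(2) cperm_box by (auto simp: pinv_def polys_on_def lookup_rest)
  then have "rest ?P g * rest ?P h \<in> inv_ideal p r n" by (intro inv_ideal_base) (auto simp: polys_on_def)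
  then have "rest ?P a \<in> inv_ideal p r n" unfolding gh(1) using rest_mult[of ?P g h] by (simp add: box_add_iff)
  then show ?case using step(2) by (simp add: inv_ideal_def mp.span_add mp.span_scale)
qed (simp add: mp.span_zero)

text \<open>A polynomial in r rows pairs with an element of the larger ideal only through the
  restriction of that element to r rows, which lies in the smaller ideal.\<close>

lemma harmonics_mono_iff:
  assumes r: "r \<le> r'" and f: "f \<in> mpolys r n" shows "f \<in> harmonics p r' n \<longleftrightarrow> f \<in> harmonics p r n"
proof -
  have f': "f \<in> mpolys r' n" using f box_mono[OF r] unfolding polys_on_def by blast
  have "ip f g = 0" if H: "f \<in> harmonics p r n" and g: "g \<in> inv_ideal p r' n" for g
  proof -
    let ?P = "\<lambda>m. m \<in> box {..<r} {..<n}"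
    have "rest ?P f = f" using f by (intro rest_idI) (auto simp: polys_on_def)
    then have "ip f g = ip f (rest ?P g)" using ip_rest[of ?P f g] by simp
    then show ?thesis using rest_box_inv_ideal[OF r g] H by (simp add: harmonics_def orth_def)
  qed
  then show ?thesis using f f' inv_ideal_mono[OF r, of p n] by (auto simp: harmonics_def orth_def)
qed

section \<open>The degree bound\<close>

text \<open>\<open>hpoly p k l\<close> is the complete homogeneous polynomial of degree \<open>k\<close> in the \<open>p\<close>-th powers of the first \<open>l\<close>
  variables of row 0.\<close>

definition hmons :: "nat \<Rightarrow> nat \<Rightarrow> nat \<Rightarrow> monom set" where
  "hmons p k l = {m \<in> box {0} {..<l}. (\<forall>j. p dvd lookup m (0, j)) \<and> tdeg m = p * k}"

definition hpoly :: "nat \<Rightarrow> nat \<Rightarrow> nat \<Rightarrow> mpoly" where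
  "hpoly p k l = (\<Sum>m\<in>hmons p k l. single m 1)"

lemma finite_hmons: "finite (hmons p k l)"
  by (rule finite_subset[OF _ finite_dbox[of "{0}" "{..<l}" "p * k"]]) (auto simp: hmons_def dbox_def)

lemma lookup_hpoly: "lookup (hpoly p k l) m = (if m \<in> hmons p k l then 1 else 0)"
  using finite_hmons by (auto simp: hpoly_def lookup_sum lookup_single when_def)

lemma keys_hpoly: "keys (hpoly p k l) = hmons p k l"
  by (auto simp: in_keys_iff lookup_hpoly split: if_splits)

lemma tdeg_rectangle:
  assumes "m \<in> box I Q" "finite I" "finite Q"
  shows "tdeg m = (\<Sum>i\<in>I. \<Sum>j\<in>Q. lookup m (i, j))"
  using assms by (subst tdeg_superset[of "I \<times> Q"]) (auto simp: box_def sum.cartesian_product')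

lemma tdeg_row0: "m \<in> box {0} {..<l} \<Longrightarrow> tdeg m = (\<Sum>j<l. lookup m (0, j))"
  using tdeg_rectangle[of m "{0}" "{..<l}"] by simp

lemma hpoly_pinv:
  assumes "p \<ge> 1" "k \<ge> 1" "r \<ge> 1" shows "hpoly p k n \<in> pinv p r n"
proof -
  have 1: "m \<in> box {..<r} {..<n}" if "m \<in> hmons p k n" for m
    using that assms(3) unfolding hmons_def box_def by fastforce
  have 2: "lookup (hpoly p k n) 0 = 0"
    using assms by (simp add: lookup_hpoly hmons_def tdeg_def)
  have 3: "cperm \<pi> m \<in> hmons p k n \<longleftrightarrow> m \<in> hmons p k n" if \<pi>: "\<pi> permutes {..<n}" for \<pi> m
  proof -
    have inv: "\<pi> (inv_into UNIV \<pi> j) = j" for j using permutes_inverses[OF \<pi>] by simp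
    have "(\<forall>j. p dvd lookup m (0, \<pi> j)) \<longleftrightarrow> (\<forall>j. p dvd lookup m (0, j))" by (metis inv)
    moreover have "tdeg (cperm \<pi> m) = tdeg m" if m: "m \<in> box {0} {..<n}"
    proof -
      have "tdeg (cperm \<pi> m) = (\<Sum>j<n. lookup m (0, \<pi> j))"
        using tdeg_row0[of "cperm \<pi> m" n] cperm_box[OF \<pi>] m lookup_cperm[OF \<pi>] by simp
      also have "\<dots> = (\<Sum>j<n. lookup m (0, j))"
        using sum.permute[OF \<pi>, of "\<lambda>j. lookup m (0, j)"] by (simp add: comp_def)
      finally show ?thesis using tdeg_row0[OF m] by simp
    qed
    ultimately show ?thesis by (auto simp: hmons_def cperm_box[OF \<pi>] lookup_cperm[OF \<pi>])
  qed
  have 4: "p dvd lookup (md snd m) j" if m: "m \<in> hmons p k n" for m j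
  proof -
    have "lookup (md snd m) j = (\<Sum>i\<in>{0}. lookup m (i, j))"
      using m by (intro lookup_md_snd) (auto simp: hmons_def box_def)
    then show ?thesis using m by (simp add: hmons_def)
  qed
  have "keys (hpoly p k n) \<subseteq> box {..<r} {..<n}" unfolding keys_hpoly using 1 by blast
  moreover have "p dvd lookup (md snd m) j" if "m \<in> keys (hpoly p k n)" for m j
    using 4 that by (simp add: keys_hpoly)
  ultimately show ?thesis using 2 3 by (simp add: pinv_def polys_on_def lookup_hpoly)
qed

text \<open>Split the monomials according to whether the variable (0, l) occurs; its exponent is a
  multiple of p, so if it occurs at all, its p-th power can be taken out.\<close>

lemma hpoly_rec:
  assumes "k \<ge> 1" "p \<ge> 1"
  shows "hpoly p k (Suc l) = hpoly p k l + single (single (0, l) p) 1 * hpoly p (k - 1) (Suc l)"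
proof (rule poly_mapping_eqI)
  fix m :: monom
  let ?e = "single (0, l) p :: monom"
  show "lookup (hpoly p k (Suc l)) m = lookup (hpoly p k l + single ?e 1 * hpoly p (k - 1) (Suc l)) m"
  proof (cases "p \<le> lookup m (0, l)")
    case True
    define m' where "m' = m - ?e"
    have m: "m = ?e + m'" unfolding m'_def using True
      by (intro poly_mapping_eqI) (auto simp: lookup_add lookup_minus lookup_single when_def)
    have "lookup (single ?e 1 * hpoly p (k - 1) (Suc l)) m = lookup (hpoly p (k - 1) (Suc l)) m'"
      unfolding m using lookup_single_mult[of ?e 1 "hpoly p (k - 1) (Suc l)" m'] by simp
    moreover have "m \<notin> hmons p k l"
      using True assms(2) lookup_outside_box[of m "{0}" "{..<l}" 0 l] by (auto simp: hmons_def)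
    moreover have "m \<in> hmons p k (Suc l) \<longleftrightarrow> m' \<in> hmons p (k - 1) (Suc l)"
    proof -
      have "m \<in> box {0} {..<Suc l} \<longleftrightarrow> m' \<in> box {0} {..<Suc l}"
        unfolding m box_add_iff by (auto simp: box_def)
      moreover have "(\<forall>j. p dvd lookup m (0, j)) \<longleftrightarrow> (\<forall>j. p dvd lookup m' (0, j))"
        unfolding m by (auto simp: lookup_add lookup_single when_def)
      moreover have "tdeg m = p * k \<longleftrightarrow> tdeg m' = p * (k - 1)"
        unfolding m using assms(1) by (cases k) (auto simp: tdeg_add)
      ultimately show ?thesis by (simp add: hmons_def)
    qed
    ultimately show ?thesis by (simp add: lookup_hpoly lookup_add)
  next
    case False
    have "m \<notin> keys (single ?e 1 * hpoly p (k - 1) (Suc l))"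
    proof
      assume "m \<in> keys (single ?e 1 * hpoly p (k - 1) (Suc l))"
      then obtain m' where "m = ?e + m'" using keys_single_mult by blast
      then show False using False by (simp add: lookup_add)
    qed
    then have "lookup (single ?e 1 * hpoly p (k - 1) (Suc l)) m = 0" by (simp add: in_keys_iff)
    moreover have "m \<in> hmons p k (Suc l) \<longleftrightarrow> m \<in> hmons p k l"
    proof
      assume m: "m \<in> hmons p k (Suc l)"
      then have "p dvd lookup m (0, l)" by (simp add: hmons_def)
      then have "lookup m (0, l) = 0" using False by (auto dest: dvd_imp_le)
      then have "(0, l) \<notin> keys m" by (simp add: in_keys_iff)
      then have "m \<in> box {0} {..<l}" using m by (auto simp: hmons_def box_def less_Suc_eq)
      then show "m \<in> hmons p k l" using m by (simp add: hmons_def)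
    qed (auto simp: hmons_def box_def)
    ultimately show ?thesis by (simp add: lookup_hpoly lookup_add)
  qed
qed

text \<open>For l = n the polynomial is an invariant. Solving \<open>hpoly_rec\<close> for the
  polynomial in fewer variables removes one variable at the cost of one degree, whence k \<ge> n - l
  + 1.\<close>

lemma hpoly_inv_ideal:
  assumes p: "p \<ge> 1" and r: "r \<ge> 1"
  shows "l + d = n \<Longrightarrow> k \<ge> d + 1 \<Longrightarrow> hpoly p k l \<in> inv_ideal p r n"
proof (induction d arbitrary: l k)
  case 0
  then have "hpoly p k l \<in> pinv p r n" using hpoly_pinv[OF p _ r] by simp
  then have "hpoly p k l * 1 \<in> inv_ideal p r n" by (intro inv_ideal_base mpolys_one)
  then show ?case by simp
next
  case (Suc d)
  have 1: "hpoly p k (Suc l) \<in> inv_ideal p r n" using Suc by (intro Suc.IH) auto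
  have "hpoly p (k - 1) (Suc l) \<in> inv_ideal p r n" using Suc by (intro Suc.IH) auto
  moreover have "single (single (0, l) p) 1 \<in> mpolys r n"
    using Suc.prems r by (intro mpolys_single) (auto simp: box_def)
  ultimately have "hpoly p (k - 1) (Suc l) * single (single (0, l) p) 1 \<in> inv_ideal p r n" by (rule inv_ideal_mult)
  then have "hpoly p k (Suc l) - hpoly p (k - 1) (Suc l) * single (single (0, l) p) 1 \<in> inv_ideal p r n"
    using 1 by (intro mp.subspace_diff[OF subspace_inv_ideal])
  moreover have "hpoly p k l = hpoly p k (Suc l) - hpoly p (k - 1) (Suc l) * single (single (0, l) p) 1"
    using hpoly_rec[of k p l] Suc.prems p by (simp add: mult.commute)
  ultimately show ?case by simp
qed

text \<open>\<open>wsum\<close>, applied to the column degrees, decreases under the rewriting of monomials modulo the ideal.\<close>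

definition tsum :: "(nat \<Rightarrow>\<^sub>0 nat) \<Rightarrow> nat" where "tsum \<delta> = (\<Sum>j\<in>keys \<delta>. lookup \<delta> j)"
definition wsum :: "(nat \<Rightarrow>\<^sub>0 nat) \<Rightarrow> nat" where "wsum \<delta> = (\<Sum>j\<in>keys \<delta>. j * lookup \<delta> j)"

lemma tsum_superset: "finite S \<Longrightarrow> keys \<delta> \<subseteq> S \<Longrightarrow> tsum \<delta> = (\<Sum>j\<in>S. lookup \<delta> j)"
  unfolding tsum_def by (intro sum.mono_neutral_left) (auto simp: in_keys_iff)

lemma wsum_superset: "finite S \<Longrightarrow> keys \<delta> \<subseteq> S \<Longrightarrow> wsum \<delta> = (\<Sum>j\<in>S. j * lookup \<delta> j)"
  unfolding wsum_def by (intro sum.mono_neutral_left) (auto simp: in_keys_iff)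

lemma wsum_add: "wsum (\<delta> + \<delta>') = wsum \<delta> + wsum \<delta>'"
proof -
  let ?S = "keys \<delta> \<union> keys \<delta>'"
  have "keys (\<delta> + \<delta>') \<subseteq> ?S" by (rule Poly_Mapping.keys_add)
  then show ?thesis by (simp add: wsum_superset[of ?S] lookup_add sum.distrib algebra_simps)
qed

lemma tsum_add: "tsum (\<delta> + \<delta>') = tsum \<delta> + tsum \<delta>'"
proof -
  let ?S = "keys \<delta> \<union> keys \<delta>'"
  have "keys (\<delta> + \<delta>') \<subseteq> ?S" by (rule Poly_Mapping.keys_add)
  then show ?thesis by (simp add: tsum_superset[of ?S] lookup_add sum.distrib)
qed

lemma tsum_md: "tsum (md h m) = tdeg m"
proof (induction m rule: monom_induct)
  case (step m a)
  then show ?case by (simp add: md_add tsum_add tdeg_add) (simp add: tsum_def)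
qed (simp add: tsum_def tdeg_def)

lemma wsum_less:
  assumes k: "keys \<delta> \<subseteq> {..l}" and ne: "\<delta> \<noteq> single l (tsum \<delta>)"
  shows "wsum \<delta> < l * tsum \<delta>"
proof -
  have t: "tsum \<delta> = (\<Sum>j\<le>l. lookup \<delta> j)" and w: "wsum \<delta> = (\<Sum>j\<le>l. j * lookup \<delta> j)"
    using tsum_superset[OF _ k] wsum_superset[OF _ k] by simp_all
  have "\<exists>j<l. lookup \<delta> j \<noteq> 0"
  proof (rule ccontr)
    assume "\<not> (\<exists>j<l. lookup \<delta> j \<noteq> 0)"
    then have z: "lookup \<delta> j = 0" if "j \<noteq> l" for j
      using that k by (cases j l rule: linorder_cases) (auto simp: in_keys_iff subset_iff)
    have "tsum \<delta> = (\<Sum>j\<le>l. if j = l then lookup \<delta> l else 0)" unfolding t using z by (intro sum.cong) auto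
    then have "tsum \<delta> = lookup \<delta> l" by simp
    then have "\<delta> = single l (tsum \<delta>)"
      using z by (intro poly_mapping_eqI) (auto simp: lookup_single when_def)
    then show False using ne by simp
  qed
  then obtain j where j: "j < l" "lookup \<delta> j \<noteq> 0" by blast
  have "(\<Sum>j\<le>l. j * lookup \<delta> j) < (\<Sum>j\<le>l. l * lookup \<delta> j)"
    by (rule sum_strict_mono_ex1) (use j in auto)
  then show ?thesis unfolding w t sum_distrib_left .
qed

text \<open>In \<open>hpoly p (n - l) (Suc l)\<close> only a power of the variable (0, l) is
  concentrated in column l. Row polarizations keep column degrees, so they carry this property to
  every \<open>B\<close> of the same degree in column l. The induction is on the degree of
  \<open>B\<close> outside row 0.\<close>

lemma polarized_element:
  assumes p: "p \<ge> 1" and l: "l < n"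
  shows "B \<in> box {..<r} {l} \<Longrightarrow> tdeg B = p * (n - l) \<Longrightarrow> r \<ge> 1 \<Longrightarrow>
    \<exists>g\<in>inv_ideal p r n. lookup g B \<noteq> 0 \<and> (\<forall>m\<in>keys g. m \<noteq> B \<longrightarrow>
      keys (md snd m) \<subseteq> {..l} \<and> tdeg m = p * (n - l) \<and> md snd m \<noteq> single l (p * (n - l)))"
proof (induction "tdeg B - lookup B (0, l)" arbitrary: B)
  case 0
  let ?d = "p * (n - l)"
  have row0: "lookup B a = 0" if "a \<noteq> (0, l)" for a
  proof (rule ccontr)
    assume a: "lookup B a \<noteq> 0"
    have "lookup B a + lookup B (0, l) = (\<Sum>x\<in>{a, (0, l)}. lookup B x)" using that by simp
    also have "\<dots> \<le> (\<Sum>x\<in>insert a (insert (0, l) (keys B)). lookup B x)" by (rule sum_mono2) auto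
    also have "\<dots> = tdeg B" by (rule tdeg_superset[symmetric]) auto
    finally show False using 0 a by simp
  qed
  have "lookup B (0, l) = tdeg B" using 0 lookup_le_tdeg[of B "(0, l)"] by simp
  then have B: "B = single (0, l) ?d"
    using 0 row0 by (intro poly_mapping_eqI) (auto simp: lookup_single when_def)
  have "hpoly p (n - l) (Suc l) \<in> inv_ideal p r n"
    using l 0 by (intro hpoly_inv_ideal[where d = "n - Suc l"] p) auto
  moreover have "B \<in> hmons p (n - l) (Suc l)"
    unfolding B hmons_def box_def by (auto simp: lookup_single when_def)
  then have "lookup (hpoly p (n - l) (Suc l)) B \<noteq> 0" by (simp add: lookup_hpoly)
  moreover have "keys (md snd m) \<subseteq> {..l} \<and> tdeg m = ?d \<and> md snd m \<noteq> single l ?d"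
    if m: "m \<in> keys (hpoly p (n - l) (Suc l))" "m \<noteq> B" for m
  proof -
    have mS: "m \<in> box {0} {..<Suc l}" "tdeg m = ?d" using m by (auto simp: keys_hpoly hmons_def)
    have look: "lookup (md snd m) j = lookup m (0, j)" for j
    proof -
      have "lookup (md snd m) j = (\<Sum>i\<in>{0}. lookup m (i, j))"
        using mS(1) by (intro lookup_md_snd) (auto simp: box_def)
      then show ?thesis by simp
    qed
    have "keys (md snd m) \<subseteq> {..l}"
    proof
      fix j assume "j \<in> keys (md snd m)"
      then have "(0, j) \<in> keys m" using look[of j] by (simp add: in_keys_iff)
      then show "j \<in> {..l}" using mS(1) unfolding box_def by auto
    qed
    moreover have "md snd m \<noteq> single l ?d"
    proof
      assume eq: "md snd m = single l ?d"
      have "m = B" unfolding B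
      proof (rule poly_mapping_eqI)
        fix x :: "nat \<times> nat"
        obtain i j where x: "x = (i, j)" by (cases x)
        show "lookup m x = lookup (single (0, l) ?d) x"
        proof (cases "i = 0")
          case True
          then show ?thesis using look[of j] eq x by (simp add: lookup_single when_def)
        next
          case False
          then show ?thesis using lookup_outside_box[OF mS(1), of i j] x by (simp add: lookup_single when_def)
        qed
      qed
      then show False using m by simp
    qed
    ultimately show ?thesis using mS by simp
  qed
  ultimately show ?case by blast
next
  case (Suc s)
  let ?d = "p * (n - l)"
  have "\<exists>i. i \<noteq> 0 \<and> lookup B (i, l) \<noteq> 0"
  proof (rule ccontr)
    assume neg: "\<not> (\<exists>i. i \<noteq> 0 \<and> lookup B (i, l) \<noteq> 0)"
    have "keys B \<subseteq> {(0, l)}"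
    proof
      fix x assume x: "x \<in> keys B"
      obtain i j where ij: "x = (i, j)" by (cases x)
      have "j = l" using x ij Suc.prems(1) unfolding box_def by auto
      moreover have "i = 0" using x ij neg \<open>j = l\<close> by (auto simp: in_keys_iff)
      ultimately show "x \<in> {(0, l)}" using ij by simp
    qed
    then have "tdeg B = (\<Sum>a\<in>{(0, l)}. lookup B a)" by (intro tdeg_superset) auto
    then show False using Suc.hyps(2) by simp
  qed
  then obtain i where i: "i \<noteq> 0" "lookup B (i, l) \<noteq> 0" by blast
  have "(i, l) \<in> keys B" using i(2) by (simp add: in_keys_iff)
  then have ir: "i < r" using Suc.prems(1) unfolding box_def by auto
  \<comment> \<open>One exponent of \<open>B\<close> is moved from row i back to row 0;
    \<open>rowpol n i 0\<close> then takes \<open>B'\<close> to a nonzero multiple of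
    \<open>B\<close>, since all exponents of \<open>B'\<close> lie in column l.\<close>
  define B' where "B' = B - single (i, l) 1 + single (0, l) 1"
  have BB: "B + single (0, l) 1 = B' + single (i, l) 1"
    unfolding B'_def using i(2)
    by (intro poly_mapping_eqI) (auto simp: lookup_add lookup_minus lookup_single when_def)
  then have BB2: "B' + single (i, l) 1 = B + single (0, l) 1" by simp
  have B'b: "B' \<in> box {..<r} {l}" using box_move[OF Suc.prems(1) BB2] Suc.prems(3) by simp
  have B't: "tdeg B' = ?d" using tdeg_move[OF BB2] Suc.prems(2) by simp
  have "lookup B' (0, l) = lookup B (0, l) + 1"
    unfolding B'_def using i(1) by (simp add: lookup_add lookup_minus lookup_single when_def)
  then have "s = tdeg B' - lookup B' (0, l)" using Suc.hyps(2) B't Suc.prems(2) by simp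
  from Suc.hyps(1)[OF this B'b B't Suc.prems(3)] obtain g where g: "g \<in> inv_ideal p r n" "lookup g B' \<noteq> 0"
    "\<And>m. m \<in> keys g \<Longrightarrow> m \<noteq> B' \<Longrightarrow> keys (md snd m) \<subseteq> {..l} \<and> tdeg m = ?d \<and> md snd m \<noteq> single l ?d"
    by blast
  let ?g = "rowpol n i 0 g"
  have mdB: "md snd B = single l ?d"
  proof (rule poly_mapping_eqI)
    fix j
    have "lookup (md snd B) j = (\<Sum>i<r. lookup B (i, j))" by (rule md_snd_box[OF Suc.prems(1)])
    moreover have "tdeg B = (\<Sum>i<r. lookup B (i, l))"
      using tdeg_rectangle[OF Suc.prems(1)] by simp
    moreover have "(\<Sum>i<r. lookup B (i, j)) = 0" if "j \<noteq> l"
      using that lookup_outside_box[OF Suc.prems(1), of _ j] by simp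
    ultimately show "lookup (md snd B) j = lookup (single l ?d) j"
      using Suc.prems(2) by (cases "j = l") (auto simp: lookup_single when_def)
  qed
  have gJ: "?g \<in> inv_ideal p r n" by (rule rowpol_inv_ideal[OF g(1) ir order_refl])
  have "lookup ?g B = (\<Sum>j<n. if j = l then lookup (xd (i, l) (0, l) g) B else 0)"
  proof -
    have "lookup (xd (i, j) (0, j) g) B = 0" if "j \<noteq> l" for j
      using lookup_outside_box[OF Suc.prems(1), of i j] that by (simp add: lookup_xd)
    then show ?thesis unfolding rowpol_def pol_def lookup_sum by (intro sum.cong) auto
  qed
  also have "\<dots> = lookup (xd (i, l) (0, l) g) B" using l by simp
  also have "\<dots> = of_nat (lookup (B - single (i, l) 1) (0, l) + 1) * lookup g B'"
    unfolding lookup_xd B'_def using i(2) by simp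
  finally have "lookup ?g B \<noteq> 0" using g(2) by (simp flip: of_nat_Suc del: of_nat_add)
  moreover have "keys (md snd m) \<subseteq> {..l} \<and> tdeg m = ?d \<and> md snd m \<noteq> single l ?d"
    if m: "m \<in> keys ?g" "m \<noteq> B" for m
  proof -
    obtain j m' where j: "m' \<in> keys g" "m + single (0, j) 1 = m' + single (i, j) 1" "lookup m' (0, j) > 0"
      using m(1) by (rule keys_rowpol) blast
    have "md snd m = md snd m'" using arg_cong[OF j(2), of "md snd"] by (simp add: md_add)
    moreover have "tdeg m = tdeg m'" using tdeg_move[OF j(2)] .
    moreover have "m' \<noteq> B'"
    proof
      assume eq: "m' = B'"
      have "j = l"
      proof (rule ccontr)
        assume "j \<noteq> l"
        then show False using j(3) lookup_outside_box[OF B'b, of 0 j] eq by simp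
      qed
      then have "m + single (0, l) 1 = B + single (0, l) 1" using j(2) eq BB by simp
      then show False using m(2) by simp
    qed
    ultimately show ?thesis using g(3)[OF j(1)] by simp
  qed
  ultimately show ?case using gJ by blast
qed

lemma submonomial:
  assumes "m \<in> box {..<r} {..<n}" "d \<le> lookup (md snd m) l"
  shows "\<exists>B m'. m = B + m' \<and> B \<in> box {..<r} {l} \<and> tdeg B = d"
  using assms(2)
proof (induction d)
  case 0
  then show ?case by (intro exI[of _ 0] exI[of _ m]) (auto simp: box_def tdeg_def)
next
  case (Suc d)
  then obtain B m' where B: "m = B + m'" "B \<in> box {..<r} {l}" "tdeg B = d" by auto
  have m'b: "m' \<in> box {..<r} {..<n}" using assms(1) unfolding B(1) box_add_iff by simp
  have "lookup (md snd m) l = lookup (md snd B) l + lookup (md snd m') l" unfolding B(1) md_add lookup_add ..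
  moreover have "lookup (md snd B) l = d"
    using md_snd_box[OF B(2), of l] B(3) tdeg_rectangle[OF B(2)] by simp
  ultimately have "lookup (md snd m') l \<noteq> 0" using Suc.prems by simp
  then have "(\<Sum>i<r. lookup m' (i, l)) \<noteq> 0" using md_snd_box[OF m'b] by simp
  then obtain i where i: "i < r" "lookup m' (i, l) \<noteq> 0" 
    using sum.neutral[of "{..<r}" "\<lambda>i. lookup m' (i, l)"] by auto
  let ?e = "single (i, l) 1 :: monom"
  have "m' = ?e + (m' - ?e)"
    using i(2) by (intro poly_mapping_eqI) (auto simp: lookup_add lookup_minus lookup_single when_def)
  then have "m = (B + ?e) + (m' - ?e)" using B(1) by (simp add: add.assoc)
  moreover have "B + ?e \<in> box {..<r} {l}" unfolding box_add_iff using B(2) i(1) by (auto simp: box_def)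
  moreover have "tdeg (B + ?e) = Suc d" using B(3) by (simp add: tdeg_add)
  ultimately show ?case by blast
qed

lemma monomial_inv_ideal:
  assumes p: "p \<ge> 1" and r: "r \<ge> 1"
  shows "m \<in> box {..<r} {..<n} \<Longrightarrow> tdeg m > (\<Sum>l<n. p * (n - l) - 1) \<Longrightarrow> single m 1 \<in> inv_ideal p r n"
proof (induction "wsum (md snd m)" arbitrary: m rule: less_induct)
  case less
  have kb: "keys (md snd m) \<subseteq> {..<n}"
  proof
    fix j assume j: "j \<in> keys (md snd m)"
    then have "(\<Sum>i<r. lookup m (i, j)) \<noteq> 0" using md_snd_box[OF less.prems(1), of j] by (simp add: in_keys_iff)
    then obtain i where "lookup m (i, j) \<noteq> 0" by (metis sum.neutral)
    then show "j \<in> {..<n}" using lookup_outside_box[OF less.prems(1), of i j] by auto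
  qed
  \<comment> \<open>Pigeonhole: if every column degree stayed below its threshold, the total degree
    would respect the bound.\<close>
  have "\<exists>l<n. p * (n - l) \<le> lookup (md snd m) l"
  proof (rule ccontr)
    assume "\<not> (\<exists>l<n. p * (n - l) \<le> lookup (md snd m) l)"
    then have "lookup (md snd m) l \<le> p * (n - l) - 1" if "l < n" for l using that by (auto simp: not_le)
    then have "(\<Sum>l<n. lookup (md snd m) l) \<le> (\<Sum>l<n. p * (n - l) - 1)" by (intro sum_mono) auto
    then show False using less.prems(2) tsum_superset[OF _ kb] tsum_md[of snd m] by simp
  qed
  then obtain l where l: "l < n" "p * (n - l) \<le> lookup (md snd m) l" by blast
  let ?d = "p * (n - l)"
  obtain B m' where B: "m = B + m'" "B \<in> box {..<r} {l}" "tdeg B = ?d"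
    using submonomial[OF less.prems(1) l(2)] by blast
  obtain g where g: "g \<in> inv_ideal p r n" "lookup g B \<noteq> 0"
    "\<And>q. q \<in> keys g \<Longrightarrow> q \<noteq> B \<Longrightarrow> keys (md snd q) \<subseteq> {..l} \<and> tdeg q = ?d \<and> md snd q \<noteq> single l ?d"
    using polarized_element[OF p l(1) B(2,3) r] by blast
  have m'b: "m' \<in> box {..<r} {..<n}" using less.prems(1) unfolding B(1) box_add_iff by simp
  have gb: "q \<in> box {..<r} {..<n}" if "q \<in> keys g" for q
    using subsetD[OF inv_ideal_subset g(1)] that by (auto simp: polys_on_def)
  have mdB: "wsum (md snd B) = l * ?d"
  proof -
    have "keys (md snd B) \<subseteq> {l}"
    proof
      fix j assume "j \<in> keys (md snd B)"
      then have "(\<Sum>i<r. lookup B (i, j)) \<noteq> 0" using md_snd_box[OF B(2), of j] by (simp add: in_keys_iff)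
      then obtain i where "lookup B (i, j) \<noteq> 0" by (metis sum.neutral)
      then show "j \<in> {l}" using lookup_outside_box[OF B(2), of i j] by auto
    qed
    then have "wsum (md snd B) = (\<Sum>j\<in>{l}. j * lookup (md snd B) j)" "tsum (md snd B) = (\<Sum>j\<in>{l}. lookup (md snd B) j)"
      by (intro wsum_superset tsum_superset; simp)+
    then show ?thesis using B(3) tsum_md[of snd B] by simp
  qed
  have rest: "single (q + m') 1 \<in> inv_ideal p r n" if q: "q \<in> keys g" "q \<noteq> B" for q
  proof (rule less.hyps)
    note gq = g(3)[OF q]
    have "wsum (md snd q) < l * tsum (md snd q)"
      using gq by (intro wsum_less) (auto simp: tsum_md)
    then have "wsum (md snd q) < wsum (md snd B)" using mdB gq by (simp add: tsum_md)
    then show "wsum (md snd (q + m')) < wsum (md snd m)" unfolding B(1) md_add wsum_add by simp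
    show "q + m' \<in> box {..<r} {..<n}" unfolding box_add_iff using gb[OF q(1)] m'b by simp
    show "(\<Sum>l<n. p * (n - l) - 1) < tdeg (q + m')" using less.prems(2) gq B(3) unfolding B(1) tdeg_add by simp
  qed
  have "g * single m' 1 = (\<Sum>q\<in>keys g. lookup g q *\<^sub>p single (q + m') 1)"
  proof -
    have "g * single m' 1 = (\<Sum>q\<in>keys g. single q (lookup g q)) * single m' 1"
      using poly_mapping_sum_single[of g] by simp
    also have "\<dots> = (\<Sum>q\<in>keys g. single (q + m') (lookup g q))"
      by (simp add: sum_distrib_right mult_single)
    also have "\<dots> = (\<Sum>q\<in>keys g. lookup g q *\<^sub>p single (q + m') 1)"
      by (intro sum.cong refl single_eq_smul)
    finally show ?thesis .
  qed
  also have "\<dots> = lookup g B *\<^sub>p single m 1 + (\<Sum>q\<in>keys g - {B}. lookup g q *\<^sub>p single (q + m') 1)"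
    using g(2) B(1) by (subst sum.remove[of _ B]) (auto simp: in_keys_iff)
  finally have eq: "lookup g B *\<^sub>p single m 1
      = g * single m' 1 - (\<Sum>q\<in>keys g - {B}. lookup g q *\<^sub>p single (q + m') 1)" by simp
  have "g * single m' 1 \<in> inv_ideal p r n" using m'b by (intro inv_ideal_mult[OF g(1)] mpolys_single)
  moreover have "(\<Sum>q\<in>keys g - {B}. lookup g q *\<^sub>p single (q + m') 1) \<in> inv_ideal p r n"
    using rest by (intro mp.subspace_sum[OF subspace_inv_ideal] mp.subspace_scale[OF subspace_inv_ideal]) auto
  ultimately have "lookup g B *\<^sub>p single m 1 \<in> inv_ideal p r n"
    unfolding eq by (rule mp.subspace_diff[OF subspace_inv_ideal])
  then have "(1 / lookup g B) *\<^sub>p (lookup g B *\<^sub>p single m 1) \<in> inv_ideal p r n"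
    by (rule mp.subspace_scale[OF subspace_inv_ideal])
  then show ?case using g(2) by simp
qed

text \<open>Pairing with a monomial reads off its coefficient up to a positive factor, so no
  monomial of the ideal occurs in a harmonic polynomial.\<close>

lemma harmonics_degree:
  assumes "p \<ge> 1" "r \<ge> 1" "f \<in> harmonics p r n" "m \<in> keys f"
  shows "m \<in> dbox {..<r} {..<n} (\<Sum>l<n. p * (n - l) - 1)"
proof -
  have mb: "m \<in> box {..<r} {..<n}" using assms(3,4) by (auto simp: harmonics_def orth_def polys_on_def)
  have "tdeg m \<le> (\<Sum>l<n. p * (n - l) - 1)"
  proof (rule ccontr)
    assume "\<not> tdeg m \<le> (\<Sum>l<n. p * (n - l) - 1)"
    then have "single m 1 \<in> inv_ideal p r n" using monomial_inv_ideal[OF assms(1,2) mb] by simp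
    then have "ip f (single m 1) = 0" using assms(3) by (simp add: harmonics_def orth_def)
    moreover have "ip f (single m 1) = of_nat (mfact m) * lookup f m"
      by (subst ip_superset[of "{m}"]) auto
    ultimately show False using assms(4) mfact_pos[of m] by (simp add: in_keys_iff)
  qed
  then show ?thesis using mb by (simp add: dbox_def)
qed

section \<open>The Hilbert series\<close>

text \<open>This makes the ideal proper, so that the constants remain a field in the
  quotient.\<close>

lemma inv_ideal_const: assumes "f \<in> inv_ideal p r n" shows "lookup f 0 = 0"
  using assms unfolding inv_ideal_def
proof (induction rule: mp.span_induct_alt)
  case (step c a b)
  obtain g h where gh: "a = g * h" "g \<in> pinv p r n" using step(1) by blast
  have "0 \<notin> keys (g * h)"
  proof
    assume "0 \<in> keys (g * h)"
    then obtain x y where xy: "0 = x + y" "x \<in> keys g" using subsetD[OF keys_mult] by blast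
    have "x = 0"
    proof (rule poly_mapping_eqI)
      fix k show "lookup x k = lookup 0 k" using arg_cong[OF xy(1), of "\<lambda>z. lookup z k"] by (simp add: lookup_add)
    qed
    then show False using xy(2) gh(2) by (simp add: pinv_def in_keys_iff)
  qed
  then show ?case using step(2) gh(1) by (simp add: lookup_add in_keys_iff)
qed simp

section \<open>The quotient ring as a vector space over the constants\<close>

lemma Const_mpolys: "Const c \<in> mpolys r n"
  by (auto simp: Const_def polys_on_def box_def)

lemma Const_hom: "Const (a + b) = Const a + Const b" "Const (a * b) = Const a * Const b"
  "Const (- a) = - Const a" "Const 0 = 0" "Const 1 = 1"
  by (simp_all add: Const_def single_add mult_single single_uminus)

lemma subfield_Const: "subfield (range Const) (poly_ring r n)"
proof -
  interpret R: cring "poly_ring r n" by (rule cring_poly_ring)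
  have sub: "subring (range Const) (poly_ring r n)"
  proof (rule R.subringI)
    show "range Const \<subseteq> carrier (poly_ring r n)" using Const_mpolys by (auto simp: poly_ring_simps)
    show "\<one>\<^bsub>poly_ring r n\<^esub> \<in> range Const" using Const_hom(5) by (metis poly_ring_simps(5) rangeI)
    show "\<ominus>\<^bsub>poly_ring r n\<^esub> h \<in> range Const" if h: "h \<in> range Const" for h
    proof -
      obtain a where a: "h = Const a" using h by blast
      have "\<ominus>\<^bsub>poly_ring r n\<^esub> h = Const (- a)" using poly_ring_a_inv[OF Const_mpolys] by (simp add: a Const_hom)
      then show ?thesis by simp
    qed
    fix x y assume "x \<in> range Const" "y \<in> range Const"
    then obtain a b where ab: "x = Const a" "y = Const b" by blast
    have "x \<otimes>\<^bsub>poly_ring r n\<^esub> y = Const (a * b)" "x \<oplus>\<^bsub>poly_ring r n\<^esub> y = Const (a + b)"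
      by (simp_all add: ab Const_hom poly_ring_simps)
    then show "x \<otimes>\<^bsub>poly_ring r n\<^esub> y \<in> range Const" "x \<oplus>\<^bsub>poly_ring r n\<^esub> y \<in> range Const" by simp_all
  qed
  show ?thesis
  proof (rule R.subfieldI)
    show "subcring (range Const) (poly_ring r n)" by (rule R.subcringI'[OF sub])
    let ?kostka = "poly_ring r n \<lparr> carrier := range Const \<rparr>"
    show "Units ?kostka = range Const - {\<zero>\<^bsub>poly_ring r n\<^esub>}"
    proof (intro equalityI subsetI)
      fix x assume "x \<in> Units ?kostka"
      then obtain y where y: "x \<in> range Const" "y \<otimes>\<^bsub>poly_ring r n\<^esub> x = \<one>\<^bsub>poly_ring r n\<^esub>"
        by (auto simp: Units_def)
      then have "y * x = 1" by (simp add: poly_ring_simps)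
      then have "x \<noteq> 0" by auto
      then show "x \<in> range Const - {\<zero>\<^bsub>poly_ring r n\<^esub>}" using y(1) by (simp add: poly_ring_simps)
    next
      fix x assume "x \<in> range Const - {\<zero>\<^bsub>poly_ring r n\<^esub>}"
      then obtain a where a: "x = Const a" "x \<noteq> 0" by (auto simp: poly_ring_simps)
      then have "a \<noteq> 0" using Const_hom(4) by auto
      then have "Const (1 / a) * x = 1" "x * Const (1 / a) = 1" unfolding a(1) Const_hom(2)[symmetric]
        by (simp_all add: Const_hom)
      then show "x \<in> Units ?kostka" using a(1) by (auto simp: Units_def poly_ring_simps)
    qed
  qed
qed

text \<open>A variable for the group keeps the simplifier from turning \<open>G p 1 n\<close> into \<open>G p (Suc 0) n\<close>,
  which would no longer match the facts of the interpreted ring locales.\<close>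

context
  fixes p r n :: nat and Wg
  assumes p: "p \<ge> 1" and Wg: "Wg = G p 1 n"
begin

abbreviation "cl \<equiv> coinv_class Wg r n"
abbreviation "CR \<equiv> coinv_ring Wg r n"

lemma coinv_ideal_inv_ideal: "coinv_ideal Wg r n = inv_ideal p r n"
  unfolding Wg by (rule coinv_ideal_eq[OF p])

lemma ideal_inv_ideal: "ideal (inv_ideal p r n) (poly_ring r n)"
proof -
  interpret R: cring "poly_ring r n" by (rule cring_poly_ring)
  have "ideal (genideal (poly_ring r n) (pos_invariants Wg r n)) (poly_ring r n)"
    by (rule R.genideal_ideal) (auto simp: pos_invariants_def)
  then show ?thesis using coinv_ideal_inv_ideal by (simp add: coinv_ideal_def)
qed

lemma CR_eq: "CR = poly_ring r n Quot inv_ideal p r n"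
  by (simp only: coinv_ring_def coinv_ideal_inv_ideal)

lemma cl_eq: "cl f = inv_ideal p r n +>\<^bsub>poly_ring r n\<^esub> f"
  by (simp only: coinv_class_def coinv_ideal_inv_ideal)

lemma cl_hom: "ring_hom_ring (poly_ring r n) CR cl"
proof -
  interpret ideal "inv_ideal p r n" "poly_ring r n" by (rule ideal_inv_ideal)
  have "cl = (+>\<^bsub>poly_ring r n\<^esub>) (inv_ideal p r n)" by (rule ext) (rule cl_eq)
  then show ?thesis using rcos_ring_hom_ring unfolding CR_eq by simp
qed

lemma cl_eq_iff:
  assumes "f \<in> mpolys r n" "g \<in> mpolys r n" shows "cl f = cl g \<longleftrightarrow> f - g \<in> inv_ideal p r n"
proof -
  interpret ideal "inv_ideal p r n" "poly_ring r n" by (rule ideal_inv_ideal)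
  have "f \<ominus>\<^bsub>poly_ring r n\<^esub> g = f - g"
    using poly_ring_a_inv[OF assms(2)] by (simp add: a_minus_def poly_ring_simps)
  then show ?thesis
    using quotient_eq_iff_same_a_r_cos[OF ideal_inv_ideal, of f g] assms unfolding cl_eq by (simp add: poly_ring_simps)
qed

lemma subfield_cl: "subfield (cl ` range Const) CR"
proof -
  interpret h: ring_hom_ring "poly_ring r n" CR cl by (rule cl_hom)
  have "cl 1 \<noteq> cl 0"
  proof
    assume "cl 1 = cl 0"
    then have "1 \<in> inv_ideal p r n" using cl_eq_iff[of 1 0] by (simp add: mpolys_one polys_on_zero)
    then show False using inv_ideal_const by fastforce
  qed
  then have "\<one>\<^bsub>CR\<^esub> \<noteq> \<zero>\<^bsub>CR\<^esub>" using h.hom_one h.hom_zero by (simp add: poly_ring_simps)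
  then show ?thesis by (rule h.img_is_subfield(2)[OF subfield_Const])
qed

lemma Span_cl:
  assumes "set fs \<subseteq> mpolys r n"
  shows "ring.Span CR (cl ` range Const) (map cl fs) = cl ` mp.span (set fs)"
  using assms
proof (induction fs)
  case Nil
  interpret h: ring_hom_ring "poly_ring r n" CR cl by (rule cl_hom)
  show ?case using h.hom_zero by (simp add: poly_ring_simps)
next
  case (Cons f fs)
  interpret h: ring_hom_ring "poly_ring r n" CR cl by (rule cl_hom)
  have fs: "mp.span (set fs) \<subseteq> mpolys r n" using Cons.prems by (intro mp.span_minimal subspace_polys_on) auto
  have f: "f \<in> mpolys r n" using Cons.prems by simp
  have comb: "cl (Const k) \<otimes>\<^bsub>CR\<^esub> cl f \<oplus>\<^bsub>CR\<^esub> cl v = cl (k *\<^sub>p f + v)" if "v \<in> mp.span (set fs)" for k v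
  proof -
    have v: "v \<in> mpolys r n" using fs that by blast
    have "cl (k *\<^sub>p f + v) = cl (k *\<^sub>p f) \<oplus>\<^bsub>CR\<^esub> cl v"
      using h.hom_add[of "k *\<^sub>p f" v] f v mp.subspace_scale[OF subspace_polys_on f] by (simp add: poly_ring_simps)
    also have "cl (k *\<^sub>p f) = cl (Const k) \<otimes>\<^bsub>CR\<^esub> cl f"
      using h.hom_mult[of "Const k" f] f Const_mpolys by (simp add: poly_ring_simps smul_def)
    finally show ?thesis by simp
  qed
  have "ring.Span CR (cl ` range Const) (map cl (f # fs)) =
      ring.line_extension CR (cl ` range Const) (cl f) (cl ` mp.span (set fs))"
    using Cons by simp
  also have "\<dots> = cl ` mp.span (set (f # fs))"
  proof (intro equalityI subsetI)
    fix x assume "x \<in> ring.line_extension CR (cl ` range Const) (cl f) (cl ` mp.span (set fs))"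
    then obtain k v where kv: "v \<in> mp.span (set fs)" "x = cl (Const k) \<otimes>\<^bsub>CR\<^esub> cl f \<oplus>\<^bsub>CR\<^esub> cl v"
      using h.S.line_extension_mem_iff by auto
    have "k *\<^sub>p f + v \<in> mp.span (set (f # fs))"
      using kv(1) by (auto simp: mp.span_insert intro!: exI[of _ k])
    then show "x \<in> cl ` mp.span (set (f # fs))" using kv(2) comb[OF kv(1)] by simp
  next
    fix x assume "x \<in> cl ` mp.span (set (f # fs))"
    then obtain y where y: "y \<in> mp.span (insert f (set fs))" "x = cl y" by auto
    then obtain k where k: "y - k *\<^sub>p f \<in> mp.span (set fs)" by (auto simp: mp.span_insert)
    have "x = cl (Const k) \<otimes>\<^bsub>CR\<^esub> cl f \<oplus>\<^bsub>CR\<^esub> cl (y - k *\<^sub>p f)" using comb[OF k, of k] y(2) by simp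
    then show "x \<in> ring.line_extension CR (cl ` range Const) (cl f) (cl ` mp.span (set fs))"
      using k h.S.line_extension_mem_iff by blast
  qed
  finally show ?case .
qed

text \<open>Two harmonics in one class differ by a harmonic element of the ideal, which is
  orthogonal to itself; so \<open>cl\<close> is injective on \<open>harmonics\<close>.\<close>

lemma independent_cl:
  assumes "set fs \<subseteq> harmonics p r n" "distinct fs" "mp.independent (set fs)"
  shows "ring.independent CR (cl ` range Const) (map cl fs)"
  using assms
proof (induction fs)
  case Nil
  interpret h: ring_hom_ring "poly_ring r n" CR cl by (rule cl_hom)
  show ?case by simp
next
  case (Cons f fs)
  interpret h: ring_hom_ring "poly_ring r n" CR cl by (rule cl_hom)
  have HP: "harmonics p r n \<subseteq> mpolys r n" by (auto simp: harmonics_def orth_def)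
  have ssH: "mp.subspace (harmonics p r n)" using gl_stable_harmonics[OF order_refl] by (simp add: gl_stable_def)
  have f: "f \<in> mpolys r n" "f \<in> harmonics p r n" using Cons.prems HP by auto
  have sp: "mp.span (set fs) \<subseteq> harmonics p r n" using Cons.prems by (intro mp.span_minimal ssH) auto
  have nf: "f \<notin> mp.span (set fs)" using Cons.prems(2,3) by (auto simp: mp.independent_insert)
  have ind: "mp.independent (set fs)" using Cons.prems(3) by (rule mp.independent_mono) auto
  have "cl f \<notin> cl ` mp.span (set fs)"
  proof
    assume "cl f \<in> cl ` mp.span (set fs)"
    then obtain g where g: "g \<in> mp.span (set fs)" "cl f = cl g" by blast
    have gH: "g \<in> harmonics p r n" using sp g by blast
    have "f - g \<in> inv_ideal p r n" using cl_eq_iff[of f g] f g gH HP by auto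
    moreover have fgH: "f - g \<in> harmonics p r n" using f gH ssH by (simp add: mp.subspace_diff)
    ultimately have "ip (f - g) (f - g) = 0" unfolding harmonics_def orth_def by blast
    then have "f = g" by (simp only: ip_self_eq_0 right_minus_eq)
    then show False using nf g(1) by simp
  qed
  moreover have "set fs \<subseteq> mpolys r n" using Cons.prems(1) HP by auto
  moreover have "cl f \<in> carrier CR" using h.hom_closed f by (simp add: poly_ring_simps)
  moreover have "ring.independent CR (cl ` range Const) (map cl fs)"
    using Cons.prems(1,2) ind by (intro Cons.IH) auto
  ultimately show ?case using Span_cl[of fs] by (auto intro: h.S.independent.li_Cons)
qed

lemma homogeneous_part_eq: "homogeneous_part r n \<alpha> = wtpart \<alpha> (mpolys r n)"
  by (auto simp: homogeneous_part_def wtpart_def weight_hom_def multidegree_eq_md poly_ring_simps)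

lemma finite_wtpart: "wtpart \<alpha> (mpolys r n) \<subseteq> polys_on (dbox {..<r} {..<n} (\<Sum>i<r. lookup \<alpha> i))"
proof
  fix f assume f: "f \<in> wtpart \<alpha> (mpolys r n)"
  have "m \<in> dbox {..<r} {..<n} (\<Sum>i<r. lookup \<alpha> i)" if m: "m \<in> keys f" for m
  proof -
    have "m \<in> box {..<r} {..<n}" "md fst m = \<alpha>" using f m by (auto simp: wtpart_def weight_hom_def polys_on_def)
    then show ?thesis using tdeg_box[of m r n] by (simp add: dbox_def)
  qed
  then show "f \<in> polys_on (dbox {..<r} {..<n} (\<Sum>i<r. lookup \<alpha> i))" by (auto simp: polys_on_def)
qed

text \<open>Orthogonal projection onto the ideal is carried out inside one weight space, which is
  finite-dimensional. The remainder is orthogonal to the whole ideal because \<open>wpart\<close> is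
  self-adjoint and preserves the ideal.\<close>

lemma cl_homogeneous_part: "cl ` homogeneous_part r n \<alpha> = cl ` wtpart \<alpha> (harmonics p r n)"
proof (intro equalityI subsetI)
  fix x assume "x \<in> cl ` homogeneous_part r n \<alpha>"
  then obtain f where f: "f \<in> wtpart \<alpha> (mpolys r n)" "x = cl f" unfolding homogeneous_part_eq by blast
  have fP: "f \<in> mpolys r n" "weight_hom \<alpha> f" using f by (auto simp: wtpart_def)
  have ssW: "mp.subspace (wtpart \<alpha> (inv_ideal p r n))" by (intro subspace_wtpart subspace_inv_ideal)
  have "wtpart \<alpha> (inv_ideal p r n) \<subseteq> wtpart \<alpha> (mpolys r n)" using inv_ideal_subset by (auto simp: wtpart_def)
  then have fin: "wtpart \<alpha> (inv_ideal p r n) \<subseteq> polys_on (dbox {..<r} {..<n} (\<Sum>i<r. lookup \<alpha> i))"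
    using finite_wtpart by (rule order_trans)
  obtain a where a: "a \<in> wtpart \<alpha> (inv_ideal p r n)" "\<And>g. g \<in> wtpart \<alpha> (inv_ideal p r n) \<Longrightarrow> ip (f - a) g = 0"
    using orth_decomp[where f = f, OF ssW finite_dbox fin] by (metis finite_lessThan)
  have aJ: "a \<in> inv_ideal p r n" "weight_hom \<alpha> a" using a(1) by (auto simp: wtpart_def)
  then have aP: "a \<in> mpolys r n" using inv_ideal_subset by blast
  have faP: "f - a \<in> mpolys r n" using mp.subspace_diff[OF subspace_polys_on fP(1) aP] .
  have hfa: "weight_hom \<alpha> (f - a)" using hom_lin[OF fP(2) aJ(2), of 1] by simp
  have "ip (f - a) g = 0" if g: "g \<in> inv_ideal p r n" for g
  proof -
    have "ip (f - a) g = ip (wpart \<alpha> (f - a)) g" using wpart_hom[OF hfa, of \<alpha>] by simp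
    also have "\<dots> = ip (f - a) (wpart \<alpha> g)" by (rule ip_wpart)
    also have "\<dots> = 0" using wpart_inv_ideal[OF g] by (intro a(2)) (simp add: wtpart_def)
    finally show ?thesis .
  qed
  then have "f - a \<in> wtpart \<alpha> (harmonics p r n)" using faP hfa by (simp add: harmonics_def orth_def wtpart_def)
  moreover have "cl f = cl (f - a)" using cl_eq_iff[OF fP(1) faP] aJ(1) by simp
  ultimately show "x \<in> cl ` wtpart \<alpha> (harmonics p r n)" using f(2) by blast
next
  fix x assume "x \<in> cl ` wtpart \<alpha> (harmonics p r n)"
  then show "x \<in> cl ` homogeneous_part r n \<alpha>"
    unfolding homogeneous_part_eq by (auto simp: wtpart_def harmonics_def orth_def)
qed

lemma hilbert_series_eq: "hilbert_series Wg r n \<alpha> = int (mp.dim (wtpart \<alpha> (harmonics p r n)))"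
proof -
  interpret h: ring_hom_ring "poly_ring r n" CR cl by (rule cl_hom)
  have ssH: "mp.subspace (harmonics p r n)" using gl_stable_harmonics[OF order_refl] by (simp add: gl_stable_def)
  have ssW: "mp.subspace (wtpart \<alpha> (harmonics p r n))" by (rule subspace_wtpart[OF ssH])
  have HP: "harmonics p r n \<subseteq> mpolys r n" by (auto simp: harmonics_def orth_def)
  have "wtpart \<alpha> (harmonics p r n) \<subseteq> wtpart \<alpha> (mpolys r n)" using HP by (auto simp: wtpart_def)
  then have fin: "wtpart \<alpha> (harmonics p r n) \<subseteq> polys_on (dbox {..<r} {..<n} (\<Sum>i<r. lookup \<alpha> i))"
    using finite_wtpart by (rule order_trans)
  have findb: "finite (dbox {..<r} {..<n} (\<Sum>i<r. lookup \<alpha> i))" by (intro finite_dbox) auto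
  obtain B where B: "finite B" "mp.independent B" "B \<subseteq> wtpart \<alpha> (harmonics p r n)"
    "mp.span B = wtpart \<alpha> (harmonics p r n)" "card B = mp.dim (wtpart \<alpha> (harmonics p r n))"
    by (rule finite_basis[OF ssW findb fin])
  obtain fs where fs: "set fs = B" "distinct fs" using finite_distinct_list[OF B(1)] by blast
  have fsH: "set fs \<subseteq> harmonics p r n" using fs(1) B(3) by (auto simp: wtpart_def)
  have ind: "ring.independent CR (cl ` range Const) (map cl fs)"
    by (rule independent_cl[OF fsH fs(2)]) (simp add: fs(1) B(2))
  have span: "ring.Span CR (cl ` range Const) (map cl fs) = cl ` homogeneous_part r n \<alpha>"
    using Span_cl[of fs] fsH HP fs(1) B(4) cl_homogeneous_part by auto
  have "ring.dimension CR (length (map cl fs)) (cl ` range Const) (cl ` homogeneous_part r n \<alpha>)"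
    using h.S.dimension_independent[OF ind] unfolding span .
  then have "ring.dim CR (cl ` range Const) (cl ` homogeneous_part r n \<alpha>) = length fs"
    using h.S.dimI[OF subfield_cl] by (simp add: over_def)
  then show ?thesis unfolding hilbert_series_def using distinct_card[OF fs(2)] fs(1) B(5) by simp
qed

end

section \<open>Multiplicities do not depend on the number of rows\<close>

lemma rowpol_zero_row: assumes "f \<in> mpolys r n" "k \<ge> r" shows "rowpol C i k f = 0"
proof -
  have "keys (rowpol C i k f) = {}"
  proof (rule equals0I)
    fix m assume "m \<in> keys (rowpol C i k f)"
    then obtain j m' where j: "m' \<in> keys f" "lookup m' (k, j) > 0" by (rule keys_rowpol) blast
    have "m' \<in> box {..<r} {..<n}" using assms(1) j(1) by (auto simp: polys_on_def)
    then show False using lookup_outside_box[of m' "{..<r}" "{..<n}" k j] j(2) assms(2) by auto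
  qed
  then show ?thesis by simp
qed

lemma hom_pwt_rows:
  assumes "f \<in> mpolys r' n" "weight_hom (pwt \<mu>) f" "length \<mu> \<le> r" shows "f \<in> mpolys r n"
proof -
  have "m \<in> box {..<r} {..<n}" if m: "m \<in> keys f" for m
  proof -
    have mb: "m \<in> box {..<r'} {..<n}" "md fst m = pwt \<mu>" using assms m by (auto simp: polys_on_def weight_hom_def)
    have "i < r \<and> j < n" if ij: "(i, j) \<in> keys m" for i j
    proof -
      have j: "j < n" using mb(1) ij unfolding box_def by auto
      have "lookup m (i, j) \<le> (\<Sum>j<n. lookup m (i, j))" using j by (intro member_le_sum) auto
      then have "lookup m (i, j) \<le> lookup (pwt \<mu>) i" using md_fst_box[OF mb(1), of i] mb(2) by simp
      moreover have "lookup m (i, j) \<noteq> 0" using ij by (simp add: in_keys_iff)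
      ultimately have "lookup (pwt \<mu>) i \<noteq> 0" by linarith
      then show ?thesis using assms(3) j by (auto simp: lookup_pwt split: if_splits)
    qed
    then show ?thesis unfolding box_def by auto
  qed
  then show ?thesis by (auto simp: polys_on_def)
qed

text \<open>Polynomials of weight \<mu> live in the first \<open>length \<mu>\<close> rows, where
  \<open>harmonics_mono_iff\<close> applies. Raising operators that differentiate by the rows from r
  on kill them trivially.\<close>

lemma hwpart_harmonics_mono:
  assumes r: "r \<le> r'" and \<mu>: "length \<mu> \<le> r"
  shows "hwpart r' C \<mu> (harmonics p r' n) = hwpart r C \<mu> (harmonics p r n)"
proof -
  have HP: "harmonics p r n \<subseteq> mpolys r n" for r by (auto simp: harmonics_def orth_def)
  have hw: "hw r' C f \<longleftrightarrow> hw r C f" if "f \<in> mpolys r n" for f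
    using rowpol_zero_row[OF that] r unfolding hw_def by (metis less_le_trans not_le)
  show ?thesis
  proof (intro equalityI subsetI)
    fix f assume f: "f \<in> hwpart r' C \<mu> (harmonics p r' n)"
    then have "f \<in> mpolys r' n" "weight_hom (pwt \<mu>) f" using HP by (auto simp: hwpart_def)
    then have fb: "f \<in> mpolys r n" by (rule hom_pwt_rows[OF _ _ \<mu>])
    then show "f \<in> hwpart r C \<mu> (harmonics p r n)"
      using f harmonics_mono_iff[OF r fb] hw[OF fb] by (simp add: hwpart_def)
  next
    fix f assume f: "f \<in> hwpart r C \<mu> (harmonics p r n)"
    then have fb: "f \<in> mpolys r n" using HP by (auto simp: hwpart_def)
    then show "f \<in> hwpart r' C \<mu> (harmonics p r' n)"
      using f harmonics_mono_iff[OF r fb] hw[OF fb] by (simp add: hwpart_def)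
  qed
qed

text \<open>The first column increases strictly from at least 0, so its entry in row r would be at
  least r.\<close>

lemma kostka_eq_0: assumes "is_partition \<mu>" "length \<mu> > r" shows "kostka r \<mu> \<alpha> = 0"
proof -
  have "ssyt r \<mu> = {}"
  proof (rule equals0I)
    fix U assume U: "U \<in> ssyt r \<mu>"
    have d: "(i, 0) \<in> diagram \<mu>" if "i < length \<mu>" for i
    proof -
      have "\<mu> ! i \<noteq> 0" using nth_mem[OF that] assms(1) unfolding is_partition_def by metis
      then show ?thesis using that by (simp add: diagram_def)
    qed
    have "U (i, 0) \<ge> i" if "i < length \<mu>" for i
      using that
    proof (induction i)
      case (Suc i)
      then have "U (i, 0) < U (Suc i, 0)" by (intro ssyt_colD[OF U] d) auto
      then show ?case using Suc by simp
    qed simp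
    moreover have "U (r, 0) < r" using U d[OF assms(2)] unfolding ssyt_def by (auto simp: PiE_def)
    ultimately show False using assms(2) by (meson not_le)
  qed
  then show ?thesis by (simp add: kostka_def)
qed

lemma finite_bounded_partitions:
  "finite {\<mu>. is_partition \<mu> \<and> length \<mu> \<le> n \<and> sum_list \<mu> \<le> N}"
proof (rule finite_subset)
  show "{\<mu>. is_partition \<mu> \<and> length \<mu> \<le> n \<and> sum_list \<mu> \<le> N} \<subseteq> {xs. set xs \<subseteq> {..N} \<and> length xs \<le> n}"
    using member_le_sum_list order_trans by fastforce
  show "finite {xs. set xs \<subseteq> {..N} \<and> length xs \<le> n}" by (intro finite_lists_length_le) auto
qed

text \<open>The subtraction of natural numbers is exact in each summand, as p * (n - l) \<ge> 1 for
  l < n.\<close>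

lemma degree_bound_eq:
  assumes "p \<ge> 1"
  shows "real (\<Sum>l<n. p * (n - l) - 1) = real n * (real p * real n + real p - 2) / 2"
proof (induction n)
  case (Suc n)
  have "(\<Sum>l<Suc n. p * (Suc n - l) - 1) = (p * Suc n - 1) + (\<Sum>l<n. p * (n - l) - 1)"
    by (subst sum.lessThan_Suc_shift) simp
  moreover have "p * Suc n \<ge> 1" using assms by simp
  then have "real (p * Suc n - 1) = real p * real (Suc n) - 1" by (simp only: of_nat_diff of_nat_mult of_nat_1)
  ultimately have "real (\<Sum>l<Suc n. p * (Suc n - l) - 1) = real p * real (Suc n) - 1 + real (\<Sum>l<n. p * (n - l) - 1)"
    by (simp only: of_nat_add)
  then show ?case unfolding Suc.IH by (simp add: field_simps)
qed simp

theorem theorem1: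
  fixes n p :: nat
  assumes "n \<ge> 1" and "p \<ge> 1"
  shows "\<exists>(M :: nat list set) (c :: nat list \<Rightarrow> nat).
    M \<subseteq> {\<mu>. is_partition \<mu> \<and> length \<mu> \<le> n \<and>
            real (sum_list \<mu>) \<le> real n * (real p * real n + real p - 2) / 2} \<and>
    (\<forall>\<mu>\<in>M. c \<mu> > 0) \<and>
    (\<forall>r\<ge>1. hilbert_series (G p 1 n) r n =
              Poly_Mapping.lookup (\<Sum>\<mu>\<in>M. of_nat (c \<mu>) * schur r \<mu>))"
proof -
  define N where "N = (\<Sum>l<n. p * (n - l) - 1)"
  define M0 where "M0 = {\<mu>. is_partition \<mu> \<and> length \<mu> \<le> n \<and> sum_list \<mu> \<le> N}"
  \<comment> \<open>Partitions in \<open>M0\<close> have at most n parts, so n rows already contain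
    all their highest weight vectors; n + n columns leave room for the reference modules.\<close>
  define c where "c = (\<lambda>\<mu>. mp.dim (hwpart n (n + n) \<mu> (harmonics p n n)))"
  define M where "M = {\<mu>\<in>M0. c \<mu> > 0}"
  have finM0: "finite M0" unfolding M0_def by (rule finite_bounded_partitions)
  have "M \<subseteq> {\<mu>. is_partition \<mu> \<and> length \<mu> \<le> n \<and>
            real (sum_list \<mu>) \<le> real n * (real p * real n + real p - 2) / 2}"
    unfolding M_def M0_def degree_bound_eq[OF assms(2), symmetric] N_def
    by (auto simp del: of_nat_sum)
  moreover have "hilbert_series (G p 1 n) r n = lookup (\<Sum>\<mu>\<in>M. of_nat (c \<mu>) * schur r \<mu>)" if r: "r \<ge> 1" for r
  proof
    fix \<alpha>
    let ?S = "dbox {..<r} {..<n} N"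
    have finS: "finite ?S" by (intro finite_dbox) auto
    have Sb: "?S \<subseteq> box {..<r} {..<n}" by (auto simp: dbox_def)
    have HS: "harmonics p r n \<subseteq> polys_on ?S" using harmonics_degree[OF assms(2) r] by (auto simp: polys_on_def N_def)
    have M0V: "\<mu> \<in> M0" if \<mu>: "is_partition \<mu>" "length \<mu> \<le> n" "hwpart r (n + n) \<mu> (harmonics p r n) \<noteq> {0}" for \<mu>
    proof -
      have "0 \<in> hwpart r (n + n) \<mu> (harmonics p r n)"
        using gl_stable_harmonics[of n "n + n" r p] by (intro mp.subspace_0 subspace_hwpart) (simp add: gl_stable_def)
      then obtain f where f: "f \<in> hwpart r (n + n) \<mu> (harmonics p r n)" "f \<noteq> 0" using \<mu>(3) by blast
      then obtain m where m: "m \<in> keys f" by (metis equals0I keys_eq_empty)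
      have mS: "m \<in> ?S" "md fst m = pwt \<mu>" using f m HS by (auto simp: hwpart_def weight_hom_def polys_on_def)
      \<comment> \<open>A polynomial of weight \<mu> has total degree the size of \<mu>, so the
        degree bound on harmonics bounds that size.\<close>
      have "sum_list \<mu> = tsum (pwt \<mu>)"
        by (subst tsum_superset[of "{..<length \<mu>}"])
           (auto simp: in_keys_iff lookup_pwt sum_list_sum_nth lessThan_atLeast0 split: if_splits)
      also have "\<dots> = tdeg m" using tsum_md[of fst m] mS(2) by simp
      finally show ?thesis using \<mu> mS(1) by (simp add: M0_def dbox_def)
    qed
    have "mp.dim (wtpart \<alpha> (harmonics p r n)) = (\<Sum>\<mu>\<in>M0. mp.dim (hwpart r (n + n) \<mu> (harmonics p r n)) * kostka r \<mu> \<alpha>)"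
      by (rule gl_character[OF order_refl finS Sb finM0 _ gl_stable_harmonics HS M0V]) (auto simp: M0_def)
    also have "\<dots> = (\<Sum>\<mu>\<in>M0. c \<mu> * kostka r \<mu> \<alpha>)"
    proof (rule sum.cong)
      fix \<mu> assume \<mu>: "\<mu> \<in> M0"
      show "mp.dim (hwpart r (n + n) \<mu> (harmonics p r n)) * kostka r \<mu> \<alpha> = c \<mu> * kostka r \<mu> \<alpha>"
      proof (cases "length \<mu> \<le> r")
        case True
        have len: "length \<mu> \<le> n" using \<mu> by (simp add: M0_def)
        \<comment> \<open>The comparison lemma passes from fewer rows to more; it is read from r to
          n or from n to r, whichever is larger.\<close>
        have "hwpart r (n + n) \<mu> (harmonics p r n) = hwpart n (n + n) \<mu> (harmonics p n n)"
          using hwpart_harmonics_mono[of r n \<mu> "n + n" p n] hwpart_harmonics_mono[of n r \<mu> "n + n" p n] True len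
          by (cases "r \<le> n") auto
        then show ?thesis by (simp add: c_def)
      next
        \<comment> \<open>With more than r parts there are no tableaux, so the term vanishes
          whatever the multiplicity for n rows is.\<close>
        case False
        then show ?thesis using kostka_eq_0[of \<mu> r \<alpha>] \<mu> by (simp add: M0_def)
      qed
    qed simp
    also have "\<dots> = (\<Sum>\<mu>\<in>M. c \<mu> * kostka r \<mu> \<alpha>)"
      unfolding M_def using finM0 by (intro sum.mono_neutral_right) auto
    finally have "hilbert_series (G p 1 n) r n \<alpha> = (\<Sum>\<mu>\<in>M. int (c \<mu>) * int (kostka r \<mu> \<alpha>))"
      using hilbert_series_eq[OF assms(2) refl, of n r \<alpha>] by simp
    also have "\<dots> = lookup (\<Sum>\<mu>\<in>M. of_nat (c \<mu>) * schur r \<mu>) \<alpha>"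
    proof -
      have "lookup (of_nat k * f) \<alpha> = int k * lookup f \<alpha>" for k and f :: "(nat \<Rightarrow>\<^sub>0 nat) \<Rightarrow>\<^sub>0 int"
        using lookup_single_mult[of 0 "int k" f \<alpha>] by simp
      then show ?thesis by (simp add: lookup_sum lookup_schur)
    qed
    finally show "hilbert_series (G p 1 n) r n \<alpha> = lookup (\<Sum>\<mu>\<in>M. of_nat (c \<mu>) * schur r \<mu>) \<alpha>" .
  qed
  moreover have "\<forall>\<mu>\<in>M. c \<mu> > 0" by (simp add: M_def)
  ultimately show ?thesis by blast
qed

end
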